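(* Let $m\ge1$, let $v$ be an $m$-cell of the level-$m$ cell graph $\Gamma_m$ of the projective octagasket, and let $n$ be a positive integer with $n<2^{m-1}$. Then $\#B_m(v,n)\le 200\,n^3$.
   Context: Let $\rho=\frac{1}{2+\sqrt2}$ and for $n=0,\dots,7$ let $F_n(x,y)=\rho\,\bigl(x+(1+\sqrt2)\cos\frac{(5-2n)\pi}{8},\; y+(1+\sqrt2)\sin\frac{(5-2n)\pi}{8}\bigr)$. Let $P\subset\mathbb{R}^2$ be the closed filled regular octagon centered at the origin with vertices $V_0=\{(\cos\frac{(5-2n)\pi}{8},\sin\frac{(5-2n)\pi}{8}) : n=0,\dots,7\}$. For a word $w=(j_1,\dots,j_m)\in\{0,\dots,7\}^m$ put $F_w=F_{j_1}\circ\cdots\circ F_{j_m}$ and $P_w=F_w(P)$. The octagons $P_w$ have disjoint interiors and two of them can share a full edge. Level-$m$ cell graph $\Gamma_m$ ($m\ge1$): let $O_m=\bigcup_{|w|=m}P_w$. The complement $\mathbb{R}^2\setminus O_m$ has one unbounded component and finitely many bounded components (the central holes of cells, and the holes, called pseudo-cells, between neighbouring cells). Each component $H$ is centrally symmetric about a point $c_H$ (with $c_H=0$ for the unbounded one). Identify each point $x\in\partial H$ with its antipode $2c_H-x$, for every component $H$. After these identifications each of the 8 edges of each octagon $P_w$ is shared with exactly one other octagon. The $m$-cells are the $8^m$ octagons $P_w$; two distinct $m$-cells are adjacent in $\Gamma_m$ if they share at least one octagon edge after the identifications. A path of length $n$ in $\Gamma_m$ is a sequence $c_0c_1\cdots c_n$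 of $m$-cells in which consecutive cells are adjacent and distinct. $D_m(w,v)$ is the minimum length of a path with end points $w$ and $v$. The ball is $B_m(v,n)=\{w \text{ an } m\text{-cell} : D_m(v,w)\le n\}$, and $\#$ denotes cardinality. *)

theory Defs
  imports "HOL-Analysis.Analysis"
begin

definition rho :: real where
  "rho = 1 / (2 + sqrt 2)"

definition V0 :: "nat \<Rightarrow> real \<times> real" where
  "V0 n = (cos ((5 - 2 * real n) * pi / 8), sin ((5 - 2 * real n) * pi / 8))"

definition F :: "nat \<Rightarrow> real \<times> real \<Rightarrow> real \<times> real" where
  "F n = (\<lambda>(x, y).
     (rho * (x + (1 + sqrt 2) * cos ((5 - 2 * real n) * pi / 8)),
      rho * (y + (1 + sqrt 2) * sin ((5 - 2 * real n) * pi / 8))))"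

definition octagon :: "(real \<times> real) set" where
  "octagon = convex hull (V0 ` {..<8})"

definition F_word :: "nat list \<Rightarrow> real \<times> real \<Rightarrow> real \<times> real" where
  "F_word w = foldr (\<lambda>j g. F j \<circ> g) w id"

definition cell :: "nat list \<Rightarrow> (real \<times> real) set" where
  "cell w = F_word w ` octagon"

definition cells :: "nat \<Rightarrow> (real \<times> real) set set" where
  "cells m = cell ` {w. length w = m \<and> set w \<subseteq> {..<8}}"

definition O_level :: "nat \<Rightarrow> (real \<times> real) set" where
  "O_level m = \<Union> (cells m)"

text \<open>A nonempty bounded set has at most one centre of symmetry, so the description is unique;
  the components of interest are indeed centrally symmetric.\<close>

definition hole_center :: "(real \<times> real) set \<Rightarrow> real \<times> real" where
  "hole_center H =
     (if bounded H then (THE c. (\<lambda>x. 2 *\<^sub>R c - x) ` H = H) else 0)"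

definition antipodal :: "nat \<Rightarrow> real \<times> real \<Rightarrow> real \<times> real \<Rightarrow> bool" where
  "antipodal m x y \<longleftrightarrow>
     (\<exists>H \<in> components (- O_level m). x \<in> frontier H \<and> y = 2 *\<^sub>R hole_center H - x)"

text \<open>The quotient map: a point is sent to its class under the equivalence relation generated
  by the antipodal identifications. Vertices of octagons may lie on the boundary of several
  components, so \<^const>\<open>antipodal\<close> itself need not be transitive.\<close>

definition glue :: "nat \<Rightarrow> real \<times> real \<Rightarrow> (real \<times> real) set" where
  "glue m x = {y. equivclp (antipodal m) x y}"

definition adjacent :: "nat \<Rightarrow> (real \<times> real) set \<Rightarrow> (real \<times> real) set \<Rightarrow> bool" where
  "adjacent m c d \<longleftrightarrow> c \<in> cells m \<and> d \<in> cells m \<and> c \<noteq> d \<and>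
     (\<exists>e e'. e edge_of c \<and> e' edge_of d \<and> glue m ` e = glue m ` e')"

text \<open>A path of length \<open>n\<close> is a list of \<open>n + 1\<close> cells.\<close>

definition is_path :: "nat \<Rightarrow> (real \<times> real) set list \<Rightarrow> bool" where
  "is_path m cs \<longleftrightarrow> cs \<noteq> [] \<and> set cs \<subseteq> cells m \<and> successively (adjacent m) cs"

text \<open>The value is infinite when no path exists.\<close>

definition path_dist :: "nat \<Rightarrow> (real \<times> real) set \<Rightarrow> (real \<times> real) set \<Rightarrow> enat" where
  "path_dist m w v =
     (INF cs \<in> {cs. is_path m cs \<and> hd cs = w \<and> last cs = v}. enat (length cs - 1))"

definition graph_ball :: "nat \<Rightarrow> (real \<times> real) set \<Rightarrow> nat \<Rightarrow> (real \<times> real) set set" where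
  "graph_ball m v n = {w \<in> cells m. path_dist m v w \<le> enat n}"

end

(*
  Subdividing an octagon edge cuts it into four child edges, the middle two bordering a
  triangular gap; on a shared edge the two triangles on either side merge into a new hole, and on
  the boundary of an old hole the triangle enlarges that hole.  Inductively this identifies the
  components of the complement of O_level m and their centres, so every edge (u, i) has an explicit
  partner under the gluing.  Consequently an integer-valued function on the corners of the level-l
  cells that respects the gluing and varies by at most 1 on each cell extends, after doubling, to
  such a function on level l + 1.  Start with 0 on the corner classes of the level-l block b of v
  and 1 elsewhere: after k refinements, the minimum over the corners of a cell changes by at most 1
  along each edge of the graph, vanishes on v and is at least 2^k outside the blocks sharing a
  corner class with b.  Every corner class has at most 4 elements, so there are at most
  1 + 8 * 3 = 25 such blocks with 8^k cells each, and the least k with n < 2^k gives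
  25 * 8^k <= 200 * n^3.
*)
theory Submission
  imports Defs
begin

section \<open>The regular octagon\<close>

text \<open>Adjacency is defined topologically, through components, symmetry centres and a generated
  equivalence, while the task is to bound distances from below. One direction of the dictionary
  therefore suffices: every antipodal pair of points must come from an edge and its
  \<open>partner\<close>. Paths are not traced through the gluing, whose classes at corners can
  chain several identifications. A function that respects each single identification is
  automatically constant along such chains, so distance is measured by functions instead. The factor
  2 per level has a geometric source. Let \<open>p\<close> and \<open>q\<close> be the values at the
  ends of a parent edge. After doubling, the five corners along its four child edges read 2p, p+q,
  p+q, p+q, 2q: the two base ends of the triangle and its apex share one value. The base ends cannot
  be separated, since for a shared edge the newborn square hole identifies them. A jump by 1 thus
  becomes two jumps by 1, one at each end.\<close>

text \<open>The vector \<open>V0 k + V0 (k + 1)\<close> is twice the midpoint of the \<open>k\<close>-th edge, hence an outer normal of it.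
  All polygons below are described by the eight functionals \<open>nf k\<close> (indices modulo 8), which satisfy
  \<open>nf (k + 4) = - nf k\<close> and \<open>nf k + nf (k + 2) = sqrt 2 * nf (k + 1)\<close>.\<close>

definition nf :: "nat \<Rightarrow> real \<times> real \<Rightarrow> real" where
  "nf k x = (V0 k + V0 (k + 1)) \<bullet> x"

text \<open>The value of \<open>nf k\<close> along the whole edge \<open>k\<close>: the squared
  length 1 of \<open>V0 k\<close> plus the cosine of 45 degrees. The normals are not unit vectors;
  their squared length is \<open>2 * kap\<close>.\<close>

definition kap :: real where "kap = 1 + sqrt 2 / 2"

lemma V0_add4: "V0 (n + 4) = - V0 n"
proof -
  have "(5 - 2 * real (n + 4)) * pi / 8 = (5 - 2 * real n) * pi / 8 - pi"
    by (simp add: field_simps)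
  then show ?thesis
    unfolding V0_def by (simp only: cos_diff sin_diff) simp
qed

lemma V0_rec: "V0 n + V0 (n + 2) = sqrt 2 *\<^sub>R V0 (n + 1)"
proof -
  let ?t = "(5 - 2 * real (n + 1)) * pi / 8"
  have "(5 - 2 * real n) * pi / 8 = ?t + pi / 4" "(5 - 2 * real (n + 2)) * pi / 8 = ?t - pi / 4"
    by (simp_all add: field_simps)
  then show ?thesis
    unfolding V0_def by (simp only: cos_diff sin_diff cos_add sin_add cos_45 sin_45) (simp add: algebra_simps)
qed

lemma V0_inner: "V0 a \<bullet> V0 b = cos ((real a - real b) * pi / 4)"
proof -
  have "(real a - real b) * pi / 4 = (5 - 2 * real b) * pi / 8 - (5 - 2 * real a) * pi / 8"
    by (simp add: field_simps)
  then show ?thesis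
    unfolding V0_def by (simp only: cos_diff) (simp add: mult.commute)
qed

lemma V0_inner_0: "V0 a \<bullet> V0 a = 1"
  by (simp add: V0_inner)

lemma V0_inner_1: "V0 a \<bullet> V0 (Suc a) = sqrt 2 / 2" "V0 (Suc a) \<bullet> V0 a = sqrt 2 / 2"
  using cos_45 by (simp_all add: V0_inner)

lemma nf_add: "nf k (x + y) = nf k x + nf k y"
  and nf_diff: "nf k (x - y) = nf k x - nf k y"
  and nf_minus: "nf k (- x) = - nf k x"
  and nf_scaleR: "nf k (c *\<^sub>R x) = c * nf k x"
  and nf_0: "nf k 0 = 0"
  by (simp_all add: nf_def inner_right_distrib inner_diff_right algebra_simps)

lemmas nf_linear = nf_add nf_diff nf_minus nf_scaleR nf_0

lemma nf_add4: "nf (k + 4) x = - nf k x"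
  using V0_add4[of k] V0_add4[of "k + 1"] by (simp add: nf_def inner_add_left inner_diff_left)

lemma nf_rec: "nf k x + nf (k + 2) x = sqrt 2 * nf (k + 1) x"
proof -
  have "(V0 k + V0 (k + 1)) + (V0 (k + 2) + V0 (k + 3)) = sqrt 2 *\<^sub>R (V0 (k + 1) + V0 (k + 2))"
    using V0_rec[of k] V0_rec[of "k + 1"] by (simp add: algebra_simps numeral_eq_Suc)
  then show ?thesis
    unfolding nf_def by (metis add.assoc inner_add_left inner_scaleR_left nat_1_add_1 numeral_Bit1 numerals(1) one_plus_numeral_commute)
qed

text \<open>Four consecutive functionals represent all eight up to sign, and the plane has dimension
  two. With these linear relations and rational bounds on \<open>sqrt 2\<close>, most estimates
  below become linear arithmetic.\<close>

lemma nf_rels: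
  "sqrt 2 * nf k x = nf (k + 1) x - nf (k + 3) x"
  "sqrt 2 * nf (k + 1) x = nf k x + nf (k + 2) x"
  "sqrt 2 * nf (k + 2) x = nf (k + 1) x + nf (k + 3) x"
  "sqrt 2 * nf (k + 3) x = nf (k + 2) x - nf k x"
  using nf_rec[of k x] nf_rec[of "k + 1" x] nf_rec[of "k + 2" x] nf_rec[of "k + 3" x]
    nf_add4[of k x] nf_add4[of "k + 1" x]
  by (simp_all add: numeral_eq_Suc)

lemma sqrt2_bounds: "7/5 < sqrt (2::real)" "sqrt (2::real) < 71/50"
  by (rule real_less_rsqrt, simp add: power2_eq_square) (rule real_less_lsqrt, simp_all add: power2_eq_square)

lemma V0_mod: "V0 (n mod 8) = V0 n"
proof -
  have 8: "V0 (k + 8) = V0 k" for k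
    using V0_add4[of k] V0_add4[of "k + 4"] by (simp add: add.commute)
  have "V0 (k + 8 * q) = V0 k" for k q
    by (induction q) (simp_all add: 8 add.assoc[symmetric] add.commute[of 8])
  from this[of "n mod 8" "n div 8"] show ?thesis by simp
qed

lemma nf_cong: "a mod 8 = b mod 8 \<Longrightarrow> nf a = nf b"
proof -
  assume "a mod 8 = b mod 8"
  moreover from this have "Suc a mod 8 = Suc b mod 8" by (metis mod_Suc)
  ultimately show ?thesis
    unfolding nf_def using V0_mod[of a] V0_mod[of b] V0_mod[of "Suc a"] V0_mod[of "Suc b"] by simp
qed

lemma nf_mod: "nf (n mod 8) = nf n"
  by (rule nf_cong) simp

lemma nf_V0:
  "nf k (V0 k) = kap" "nf (k + 1) (V0 k) = sqrt 2 / 2"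
  "nf (k + 2) (V0 k) = - (sqrt 2 / 2)" "nf (k + 3) (V0 k) = - kap"
proof -
  show 0: "nf k (V0 k) = kap"
    by (simp add: nf_def kap_def inner_add_left V0_inner_0 V0_inner_1)
  have 2: "V0 (k + 2) = sqrt 2 *\<^sub>R V0 (k + 1) - V0 k"
    using V0_rec[of k] by (simp add: algebra_simps)
  have "V0 (k + 2) \<bullet> V0 k = 0"
    unfolding 2 by (simp add: inner_diff_left V0_inner_0 V0_inner_1)
  then show 1: "nf (k + 1) (V0 k) = sqrt 2 / 2"
    by (simp add: nf_def inner_add_left V0_inner_1)
  have "sqrt 2 * (sqrt 2 / 2) = kap + nf (k + 2) (V0 k)"
    using nf_rels(2)[of k "V0 k"] unfolding 0 1 .
  then show "nf (k + 2) (V0 k) = - (sqrt 2 / 2)" by (simp add: kap_def)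
  show "nf (k + 3) (V0 k) = - kap"
    using nf_rels(1)[of k "V0 k"] 0 1 by (simp add: kap_def algebra_simps)
qed

lemma nf_V0_Suc: "nf k (V0 (k + 1)) = kap" "nf (k + 1) (V0 (k + 1)) = kap"
   "nf (k + 2) (V0 (k + 1)) = sqrt 2 / 2" "nf (k + 3) (V0 (k + 1)) = - (sqrt 2 / 2)"
proof -
  show "nf k (V0 (k + 1)) = kap"
    by (simp add: nf_def kap_def inner_add_left V0_inner_0 V0_inner_1)
  show "nf (k + 1) (V0 (k + 1)) = kap"
   "nf (k + 2) (V0 (k + 1)) = sqrt 2 / 2" "nf (k + 3) (V0 (k + 1)) = - (sqrt 2 / 2)"
    using nf_V0[of "k + 1"] by (simp_all add: numeral_eq_Suc)
qed

lemma nf_eqI: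
  assumes "nf k x = nf k y" "nf (k + 1) x = nf (k + 1) y"
  shows "x = y"
proof -
  have "nf k (x - y) = 0" "nf (k + 1) (x - y) = 0" using assms by (simp_all add: nf_linear)
  then have "(V0 k + V0 (k + 1)) \<bullet> (x - y) = 0" "(V0 (k + 1) + V0 (k + 2)) \<bullet> (x - y) = 0"
    by (simp_all add: nf_def)
  moreover have "V0 (k + 2) \<bullet> (x - y) = sqrt 2 * (V0 (k + 1) \<bullet> (x - y)) - V0 k \<bullet> (x - y)"
    by (metis V0_rec add_diff_cancel_left' inner_diff_left inner_scaleR_left)
  ultimately have
    e: "V0 k \<bullet> (x - y) + V0 (k + 1) \<bullet> (x - y) = 0"
    "(1 + sqrt 2) * (V0 (k + 1) \<bullet> (x - y)) - V0 k \<bullet> (x - y) = 0"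
    by (simp_all add: inner_add_left algebra_simps)
  then have "(2 + sqrt 2) * (V0 (k + 1) \<bullet> (x - y)) = 0"
    by (simp add: algebra_simps)
  moreover have "2 + sqrt 2 > (0::real)" using sqrt2_bounds by linarith
  ultimately have v1: "V0 (k + 1) \<bullet> (x - y) = 0" by simp
  with e have v0: "V0 k \<bullet> (x - y) = 0" by simp
  define a where "a = (5 - 2 * real k) * pi / 8"
  have a1: "(5 - 2 * real (k + 1)) * pi / 8 = a - pi / 4" by (simp add: a_def field_simps)
  obtain p q where pq: "x - y = (p, q)" by (cases "x - y")
  have A: "cos a * p + sin a * q = 0" using v0 by (simp add: V0_def pq a_def)
  have "cos (a - pi / 4) * p + sin (a - pi / 4) * q = 0"
    using v1 unfolding V0_def pq a1 by simp
  then have "sqrt 2 / 2 * ((cos a + sin a) * p + (sin a - cos a) * q) = 0"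
    by (simp add: cos_diff sin_diff cos_45 sin_45 algebra_simps)
  then have "(cos a + sin a) * p + (sin a - cos a) * q = 0" by simp
  then have B: "sin a * p - cos a * q = 0" using A by (simp add: algebra_simps)
  have "p * (cos a * cos a + sin a * sin a) = cos a * (cos a * p + sin a * q) + sin a * (sin a * p - cos a * q)"
    by algebra
  with A B have "p = 0" using sin_cos_squared_add3[of a] by simp
  have "q * (cos a * cos a + sin a * sin a) = sin a * (cos a * p + sin a * q) - cos a * (sin a * p - cos a * q)"
    by algebra
  with A B have "q = 0" using sin_cos_squared_add3[of a] by simp
  with \<open>p = 0\<close> pq show "x = y" by (simp add: zero_prod_def[symmetric])
qed

lemma mod8_shift: obtains d :: nat where "d < 8" "k mod 8 = (j + d) mod 8"
proof
  show "(k + 7 * j) mod 8 < 8" by simp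
  show "k mod 8 = (j + (k + 7 * j) mod 8) mod 8" by (simp add: mod_simps)
qed

lemma less8_cases:
  assumes "(d::nat) < 8"
  obtains "d = 0" | "d = 1" | "d = 2" | "d = 3" | "d = 4" | "d = 5" | "d = 6" | "d = 7"
  using assms by linarith

lemma nf_add4_numeral: "nf (a + 4) x = - nf a x" "nf (a + 5) x = - nf (a + 1) x"
  "nf (a + 6) x = - nf (a + 2) x" "nf (a + 7) x = - nf (a + 3) x"
  using nf_add4[of a x] nf_add4[of "a + 1" x] nf_add4[of "a + 2" x] nf_add4[of "a + 3" x]
  by (simp_all add: numeral_eq_Suc)

text \<open>The starting index \<open>a\<close> is free, so the eight-fold symmetry is used by
  shifting indices instead of rotating the plane.\<close>

lemma all_nf:
  "(\<forall>k. Q (nf k x)) \<longleftrightarrow> Q (nf a x) \<and> Q (nf (a + 1) x) \<and> Q (nf (a + 2) x) \<and> Q (nf (a + 3) x) \<and>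
     Q (- nf a x) \<and> Q (- nf (a + 1) x) \<and> Q (- nf (a + 2) x) \<and> Q (- nf (a + 3) x)" (is "?L = ?R")
proof
  assume ?L
  then show ?R by (metis nf_add4_numeral)
next
  assume R: ?R
  show ?L
  proof
    fix k
    obtain d where d: "d < 8" "k mod 8 = (a + d) mod 8" by (rule mod8_shift)
    have "Q (nf (a + d) x)"
      using d(1) by (rule less8_cases) (use R nf_add4_numeral[of a x] in auto)
    then show "Q (nf k x)" using nf_cong[OF d(2)] by simp
  qed
qed

lemma nf_V0_le: "nf k (V0 j) \<le> kap"
  using all_nf[where a = j and Q = "\<lambda>v. v \<le> kap" and x = "V0 j"] sqrt2_bounds
  unfolding nf_V0 by (simp add: kap_def)

lemma kap_pos: "kap > 0" using sqrt2_bounds by (simp add: kap_def)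

lemma V0_in_octagon: "V0 j \<in> octagon"
proof -
  have "V0 (j mod 8) \<in> octagon"
    unfolding octagon_def by (rule hull_inc) simp
  then show ?thesis by (simp add: V0_mod)
qed

lemma convex_octagon: "convex octagon" by (simp add: octagon_def)

lemma cone_expansion:
  "x = (nf j x - nf (j + 1) x) *\<^sub>R V0 j + (nf (j + 1) x - (sqrt 2 - 1) * nf j x) *\<^sub>R V0 (j + 1)"
proof -
  define p where "p = nf j x"
  define q where "q = nf (j + 1) x"
  have "x = (p - q) *\<^sub>R V0 j + (q - (sqrt 2 - 1) * p) *\<^sub>R V0 (j + 1)"
  proof (rule nf_eqI[of j])
    have "(p - q) * kap + (q - (sqrt 2 - 1) * p) * kap = p"
      by (simp add: kap_def field_simps)
    then show "nf j x = nf j ((p - q) *\<^sub>R V0 j + (q - (sqrt 2 - 1) * p) *\<^sub>R V0 (j + 1))"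
      unfolding nf_linear nf_V0 nf_V0_Suc by (simp add: p_def)
    have "(p - q) * (sqrt 2 / 2) + (q - (sqrt 2 - 1) * p) * kap = q"
      by (simp add: kap_def field_simps)
    then show "nf (j + 1) x = nf (j + 1) ((p - q) *\<^sub>R V0 j + (q - (sqrt 2 - 1) * p) *\<^sub>R V0 (j + 1))"
      unfolding nf_linear nf_V0 nf_V0_Suc by (simp add: q_def)
  qed
  then show ?thesis by (simp add: p_def q_def)
qed

text \<open>For the converse, let \<open>nf j x\<close> be the largest of the eight values.
  Comparing it with its two neighbours makes both coefficients of \<open>cone_expansion\<close>
  nonnegative, and \<open>nf j x \<le> kap\<close> bounds their sum by 1; so \<open>x\<close> lies
  in the triangle with corners 0, \<open>V0 j\<close> and \<open>V0 (j + 1)\<close>.\<close>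

lemma octagon_iff: "x \<in> octagon \<longleftrightarrow> (\<forall>k. nf k x \<le> kap)"
proof
  have "octagon \<subseteq> {x. \<forall>k. nf k x \<le> kap}"
    unfolding octagon_def
  proof (rule hull_minimal)
    show "V0 ` {..<8} \<subseteq> {x. \<forall>k. nf k x \<le> kap}" by (auto simp: nf_V0_le)
    have "{x. \<forall>k. nf k x \<le> kap} = (\<Inter>k. {x. (V0 k + V0 (k + 1)) \<bullet> x \<le> kap})"
      by (auto simp: nf_def)
    then show "convex {x. \<forall>k. nf k x \<le> kap}"
      by (simp add: convex_halfspace_le convex_INT del: of_nat_Suc)
  qed
  then show "x \<in> octagon \<Longrightarrow> \<forall>k. nf k x \<le> kap" by blast
next
  assume le: "\<forall>k. nf k x \<le> kap"
  have "Max ((\<lambda>k. nf k x) ` {..<8}) \<in> (\<lambda>k. nf k x) ` {..<8}"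
    by (rule Max_in) (auto simp: lessThan_empty_iff)
  then obtain j where "nf j x = Max ((\<lambda>k. nf k x) ` {..<8})" by force
  then have "\<forall>k<8. nf k x \<le> nf j x" by simp
  then have mx: "nf k x \<le> nf j x" for k
    by (metis mod_less_divisor nf_mod zero_less_numeral)
  define \<alpha> where "\<alpha> = nf j x - nf (j + 1) x"
  define \<beta> where "\<beta> = nf (j + 1) x - (sqrt 2 - 1) * nf j x"
  have ge: "\<alpha> \<ge> 0" "\<beta> \<ge> 0"
    using mx[of "j + 1"] mx[of "j + 7"] nf_rels(1)[of j x] nf_add4_numeral[of j x]
    by (simp_all add: \<alpha>_def \<beta>_def algebra_simps)
  have "(2 - sqrt 2) * nf j x \<le> (2 - sqrt 2) * kap"
    using le sqrt2_bounds by (intro mult_left_mono) auto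
  then have le1: "\<alpha> + \<beta> \<le> 1" by (simp add: \<alpha>_def \<beta>_def kap_def field_simps)
  have V4: "V0 (j + 4) \<in> octagon" "V0 j \<in> octagon" by (rule V0_in_octagon)+
  have "(1/2) *\<^sub>R V0 j + (1/2) *\<^sub>R V0 (j + 4) \<in> octagon"
    by (rule convexD[OF convex_octagon]) (auto intro: V0_in_octagon)
  then have 0: "0 \<in> octagon" by (simp add: V0_add4)
  have "\<alpha> *\<^sub>R V0 j + \<beta> *\<^sub>R V0 (j + 1) + (1 - \<alpha> - \<beta>) *\<^sub>R 0 \<in> convex hull {V0 j, V0 (j + 1), 0}"
    unfolding convex_hull_3 using ge le1 by (intro CollectI exI[of _ \<alpha>] exI[of _ \<beta>] exI[of _ "1 - \<alpha> - \<beta>"]) auto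
  moreover have "convex hull {V0 j, V0 (j + 1), 0} \<subseteq> octagon"
    by (rule hull_minimal) (auto intro: V0_in_octagon convex_octagon 0)
  ultimately show "x \<in> octagon"
    using cone_expansion[of x j] by (auto simp: \<alpha>_def \<beta>_def)
qed

lemma octagon_iff4:
  "x \<in> octagon \<longleftrightarrow> nf a x \<le> kap \<and> nf (a + 1) x \<le> kap \<and> nf (a + 2) x \<le> kap \<and> nf (a + 3) x \<le> kap \<and>
     - nf a x \<le> kap \<and> - nf (a + 1) x \<le> kap \<and> - nf (a + 2) x \<le> kap \<and> - nf (a + 3) x \<le> kap"
  unfolding octagon_iff by (rule all_nf)

definition side :: "nat \<Rightarrow> (real \<times> real) set" where
  "side k = closed_segment (V0 k) (V0 (k + 1))"

lemma in_side: "x \<in> side k \<longleftrightarrow> (\<exists>t\<in>{0..1}. x = (1 - t) *\<^sub>R V0 k + t *\<^sub>R V0 (k + 1))"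
  by (auto simp: side_def in_segment)

lemma side_param:
  assumes "x \<in> octagon" "nf k x = kap"
  shows "x = (1 - (nf (k + 1) x - sqrt 2 / 2)) *\<^sub>R V0 k + (nf (k + 1) x - sqrt 2 / 2) *\<^sub>R V0 (k + 1)"
    and "nf (k + 1) x - sqrt 2 / 2 \<in> {0..1}"
proof -
  have "(sqrt 2 - 1) * kap = sqrt 2 / 2" by (simp add: kap_def field_simps)
  then show "x = (1 - (nf (k + 1) x - sqrt 2 / 2)) *\<^sub>R V0 k + (nf (k + 1) x - sqrt 2 / 2) *\<^sub>R V0 (k + 1)"
    using cone_expansion[of x k] unfolding assms(2)
    by (metis add_diff_eq diff_diff_eq2 kap_def)
  have "nf (k + 1) x \<le> kap" "- nf (k + 3) x \<le> kap"
    using assms(1) nf_add4_numeral(4)[of k x] by (metis octagon_iff)+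
  then show "nf (k + 1) x - sqrt 2 / 2 \<in> {0..1}"
    using nf_rels(1)[of k x] assms(2) by (simp add: kap_def algebra_simps)
qed

lemma side_iff: "x \<in> side k \<longleftrightarrow> x \<in> octagon \<and> nf k x = kap"
proof
  assume "x \<in> side k"
  moreover have "side k \<subseteq> octagon"
    unfolding side_def by (rule closed_segment_subset) (auto intro: V0_in_octagon convex_octagon)
  moreover have "nf k ((1 - t) *\<^sub>R V0 k + t *\<^sub>R V0 (k + 1)) = kap" for t
    unfolding nf_linear nf_V0 nf_V0_Suc by (simp add: algebra_simps)
  ultimately show "x \<in> octagon \<and> nf k x = kap"
    using in_side by (metis subsetD)
next
  assume "x \<in> octagon \<and> nf k x = kap"
  then show "x \<in> side k" unfolding in_side using side_param[of x k] by metis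
qed

section \<open>The maps \<open>F a\<close> and the decomposition of the octagon into children,
  triangles and star\<close>

lemma rho_eq: "rho = 1 - sqrt 2 / 2"
proof -
  have "(1 - sqrt 2 / 2) * (2 + sqrt 2) = (1::real)" by (simp add: field_simps)
  moreover have "2 + sqrt 2 \<noteq> (0::real)" using sqrt2_bounds by linarith
  ultimately show ?thesis by (simp add: rho_def field_simps)
qed

lemma rho_pos: "rho > 0" using sqrt2_bounds by (simp add: rho_eq)

lemma F_eq: "F a x = rho *\<^sub>R x + (sqrt 2 / 2) *\<^sub>R V0 a"
proof -
  have "rho * (1 + sqrt 2) = sqrt 2 / 2" by (simp add: rho_eq field_simps)
  then show ?thesis
    by (cases x) (simp add: F_def V0_def distrib_left mult.assoc[symmetric])
qed

lemma nf_F: "nf k (F a x) = rho * nf k x + sqrt 2 / 2 * nf k (V0 a)"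
  by (simp add: F_eq nf_linear)

lemma F_bij: "\<exists>y. F a y = x"
proof
  show "F a ((1 / rho) *\<^sub>R (x - (sqrt 2 / 2) *\<^sub>R V0 a)) = x"
    using rho_pos by (simp add: F_eq)
qed

lemma rho_kap: "rho * kap = 1 / 2" by (simp add: rho_eq kap_def field_simps)

text \<open>All four intervals have length 1, the width \<open>2 * rho * kap\<close> of a child in
  the scale of the functionals; their positions are read off from \<open>nf_V0\<close>.\<close>

lemma child_iff: "x \<in> F a ` octagon \<longleftrightarrow> nf a x \<in> {sqrt 2 / 2..kap} \<and> nf (a + 1) x \<in> {0..1} \<and>
   nf (a + 2) x \<in> {-1..0} \<and> nf (a + 3) x \<in> {-kap..-(sqrt 2 / 2)}"
proof -
  obtain y where x: "x = F a y" using F_bij by metis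
  have inj: "F a z = F a y \<longleftrightarrow> z = y" for z using rho_pos by (simp add: F_eq)
  have le: "s \<le> kap \<longleftrightarrow> rho * s \<le> 1 / 2" for s
    using rho_pos rho_kap by (metis mult_le_cancel_left_pos)
  have k: "sqrt 2 / 2 * kap = 1 / 2 + sqrt 2 / 2" "sqrt 2 / 2 * (sqrt 2 / 2) = 1 / 2"
    by (simp_all add: kap_def field_simps)
  have "x \<in> F a ` octagon \<longleftrightarrow> y \<in> octagon" unfolding x image_iff using inj by metis
  also have "\<dots> \<longleftrightarrow> nf a x \<in> {sqrt 2 / 2..kap} \<and> nf (a + 1) x \<in> {0..1} \<and>
   nf (a + 2) x \<in> {-1..0} \<and> nf (a + 3) x \<in> {-kap..-(sqrt 2 / 2)}"
    unfolding octagon_iff4[of y a] le x nf_F nf_V0 mult_minus_right k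
    by (auto simp: kap_def)
  finally show ?thesis .
qed

text \<open>The children of the octagon leave uncovered eight triangles, one on each edge, and a star-shaped
  16-gon around the centre. The open base of the triangle on an edge belongs to it.\<close>

definition Tri :: "nat \<Rightarrow> (real \<times> real) set" where
  "Tri i = {x. nf i x \<le> kap \<and> nf (i + 1) x > 1 \<and> nf (i + 3) x < - 1}"

definition Star :: "(real \<times> real) set" where
  "Star = {x. \<forall>k. nf k x < sqrt 2 / 2 \<or> nf (k + 1) x < sqrt 2 / 2}"

lemma nf_add8_numeral: "nf (a + 8) x = nf a x" "nf (a + 9) x = nf (a + 1) x" "nf (a + 10) x = nf (a + 2) x"
proof -
  have 8: "nf (b + 8) x = nf b x" for b
    using nf_cong[of "b + 8" b] by simp
  have e: "a + 9 = (a + 1) + 8" "a + 10 = (a + 2) + 8" by simp_all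
  show "nf (a + 8) x = nf a x" "nf (a + 9) x = nf (a + 1) x" "nf (a + 10) x = nf (a + 2) x"
    unfolding e 8 by (rule refl)+
qed

lemmas nf_shift = nf_add4_numeral nf_add8_numeral

lemma nf_shift2: "nf (a + 7 + 1) x = nf a x" "nf (a + 7 + 3) x = nf (a + 2) x"
  "nf (a + 1 + 1) x = nf (a + 2) x" "nf (a + 1 + 2) x = nf (a + 3) x" "nf (a + 1 + 3) x = - nf a x"
proof -
  have e: "a + 7 + 1 = a + 8" "a + 7 + 3 = a + 10" "a + 1 + 1 = a + 2" "a + 1 + 2 = a + 3" "a + 1 + 3 = a + 4"
    by simp_all
  show "nf (a + 7 + 1) x = nf a x" "nf (a + 7 + 3) x = nf (a + 2) x"
    "nf (a + 1 + 1) x = nf (a + 2) x" "nf (a + 1 + 2) x = nf (a + 3) x" "nf (a + 1 + 3) x = - nf a x"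
    unfolding e nf_shift by (rule refl)+
qed

lemma all_less8: "(\<forall>d<8. P d) \<longleftrightarrow> P 0 \<and> P 1 \<and> P 2 \<and> P 3 \<and> P 4 \<and> P 5 \<and> P 6 \<and> P (7::nat)"
  (is "?L \<longleftrightarrow> ?R")
proof
  assume R: ?R
  show ?L
  proof (intro allI impI)
    fix d :: nat assume "d < 8"
    then show "P d" by (rule less8_cases) (use R in simp_all)
  qed
qed simp

lemma all_nf2:
  "(\<forall>k. Q (nf k x) (nf (k + 1) x)) \<longleftrightarrow>
     Q (nf a x) (nf (a + 1) x) \<and> Q (nf (a + 1) x) (nf (a + 2) x) \<and>
     Q (nf (a + 2) x) (nf (a + 3) x) \<and> Q (nf (a + 3) x) (- nf a x) \<and>
     Q (- nf a x) (- nf (a + 1) x) \<and> Q (- nf (a + 1) x) (- nf (a + 2) x) \<and>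
     Q (- nf (a + 2) x) (- nf (a + 3) x) \<and> Q (- nf (a + 3) x) (nf a x)" (is "?L \<longleftrightarrow> ?R")
proof -
  have e: "a + 0 = a" "a + (0 + 1) = a + 1" "a + (1 + 1) = a + 2" "a + (2 + 1) = a + 3" "a + (3 + 1) = a + 4"
    "a + (4 + 1) = a + 5" "a + (5 + 1) = a + 6" "a + (6 + 1) = a + 7" "a + (7 + 1) = a + 8" by simp_all
  have "?L \<longleftrightarrow> (\<forall>d<8. Q (nf (a + d) x) (nf (a + (d + 1)) x))"
  proof
    assume ?L
    then show "\<forall>d<8. Q (nf (a + d) x) (nf (a + (d + 1)) x)" by (metis add.assoc)
  next
    assume R: "\<forall>d<8. Q (nf (a + d) x) (nf (a + (d + 1)) x)"
    show ?L
    proof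
      fix k
      obtain d where d: "d < 8" "k mod 8 = (a + d) mod 8" by (rule mod8_shift)
      have "(k + 1) mod 8 = (a + (d + 1)) mod 8"
        using mod_add_cong[OF d(2) refl, of 1] by (simp only: add.assoc)
      then show "Q (nf k x) (nf (k + 1) x)" using R nf_cong d by metis
    qed
  qed
  also have "(\<forall>d<8. P d) \<longleftrightarrow> P 0 \<and> P 1 \<and> P 2 \<and> P 3 \<and> P 4 \<and> P 5 \<and> P 6 \<and> P (7::nat)" for P
    using all_less8 .
  finally show ?thesis unfolding e nf_shift .
qed

lemma Tri_cong: "a mod 8 = b mod 8 \<Longrightarrow> Tri a = Tri b"
proof -
  assume a: "a mod 8 = b mod 8"
  then have "(a + 1) mod 8 = (b + 1) mod 8" "(a + 3) mod 8 = (b + 3) mod 8"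
    by (rule mod_add_cong[OF _ refl])+
  with a have "nf a = nf b" "nf (a + 1) = nf (b + 1)" "nf (a + 3) = nf (b + 3)" using nf_cong by blast+
  then show ?thesis by (simp only: Tri_def)
qed

lemma side_cong: "a mod 8 = b mod 8 \<Longrightarrow> side a = side b"
  by (rule set_eqI) (simp add: side_iff nf_cong[of a b])

lemma F_mod: "F (n mod 8) = F n"
  by (rule ext) (simp add: F_eq V0_mod)

lemma sqrt2_kap: "sqrt 2 * kap = sqrt 2 + 1" by (simp add: kap_def field_simps)

lemma kap_bounds: "17/10 < kap" "kap < 171/100" using sqrt2_bounds by (simp_all add: kap_def)

lemma sqrt2_mult_le: "sqrt 2 * a \<le> sqrt 2 * b \<longleftrightarrow> a \<le> b" by simp

lemma sqrt2_cancel: "a < sqrt 2 * b \<Longrightarrow> 71/50 * c \<le> a \<Longrightarrow> 0 \<le> c \<Longrightarrow> c < (b::real)"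
proof (rule ccontr)
  assume *: "a < sqrt 2 * b" "71/50 * c \<le> a" "0 \<le> c" "\<not> c < b"
  then have "sqrt 2 * b \<le> sqrt 2 * c" by simp
  also have "\<dots> \<le> 71/50 * c" using * sqrt2_bounds by (intro mult_right_mono) auto
  finally show False using * by simp
qed

lemma Tri_bounds:
  assumes "x \<in> Tri i"
  shows "nf i x > 1" "nf i x \<le> kap" "1 < nf (i + 1) x" "nf (i + 1) x < 3/2"
    "\<bar>nf (i + 2) x\<bar> < 1" "nf (i + 3) x < - 1" "-3/2 < nf (i + 3) x"
proof -
  show 1: "nf i x \<le> kap" "1 < nf (i + 1) x" "nf (i + 3) x < - 1" using assms by (auto simp: Tri_def)
  then have "2 < sqrt 2 * nf i x" using nf_rels(1)[of i x] by linarith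
  then show "nf i x > 1" by (rule sqrt2_cancel) auto
  have "sqrt 2 * nf i x \<le> sqrt 2 + 1" using 1(1) sqrt2_kap sqrt2_mult_le by metis
  then show 2: "nf (i + 1) x < 3/2" "-3/2 < nf (i + 3) x"
    using 1 nf_rels(1)[of i x] sqrt2_bounds by linarith+
  then have "\<bar>sqrt 2 * nf (i + 2) x\<bar> < 1" using nf_rels(3)[of i x] 1 by linarith
  moreover have "sqrt 2 * \<bar>nf (i + 2) x\<bar> = \<bar>sqrt 2 * nf (i + 2) x\<bar>" by (simp add: abs_mult)
  ultimately have "sqrt 2 * \<bar>nf (i + 2) x\<bar> < sqrt 2 * 1"
    using sqrt2_bounds(1) by linarith
  then show "\<bar>nf (i + 2) x\<bar> < 1" by (simp only: mult_less_cancel_left) auto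
qed

lemma Tri_unique:
  assumes "x \<in> Tri i" "x \<in> Tri j" "i < 8" "j < 8"
  shows "i = j"
proof -
  obtain d where d: "d < 8" "j mod 8 = (i + d) mod 8" by (rule mod8_shift)
  note B = Tri_bounds[OF assms(1)]
  have "x \<in> Tri (i + d)" using assms(2) Tri_cong[OF d(2)] by simp
  note C = Tri_bounds(1)[OF this] Tri_bounds(3)[OF this] Tri_bounds(6)[OF this]
  have "d = 0" using d(1)
    by (rule less8_cases)
     (use B C nf_add4_numeral[of i x] nf_add8_numeral[of i x] in \<open>simp_all add: numeral_eq_Suc\<close>)
  with d assms show ?thesis by simp
qed

lemma Tri_subset_octagon: "Tri i \<subseteq> octagon"
proof
  fix x assume "x \<in> Tri i"
  note B = Tri_bounds[OF this]
  show "x \<in> octagon"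
    unfolding octagon_iff4[of _ i] using B kap_bounds by auto
qed

lemma child_subset_octagon: "F a ` octagon \<subseteq> octagon"
proof
  fix x assume "x \<in> F a ` octagon"
  then show "x \<in> octagon"
    unfolding octagon_iff4[of _ a] child_iff using kap_bounds sqrt2_bounds by auto
qed

text \<open>If \<open>nf k x\<close> reaches \<open>sqrt 2 / 2\<close>, then both neighbouring
  values stay below it, and \<open>sqrt 2 * nf k x\<close> is their sum. Hence the star stays away
  from the edges of the octagon, where some functional equals \<open>kap\<close>.\<close>

lemma Star_less1:
  assumes "x \<in> Star"
  shows "nf k x < 1"
proof (cases "nf k x < sqrt 2 / 2")
  case True
  then show ?thesis using sqrt2_bounds by linarith
next
  case False
  have "nf (k + 7) x < sqrt 2 / 2 \<or> nf (k + 7 + 1) x < sqrt 2 / 2"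
    "nf k x < sqrt 2 / 2 \<or> nf (k + 1) x < sqrt 2 / 2"
    using assms unfolding Star_def by blast+
  with False have "nf (k + 1) x < sqrt 2 / 2" "- nf (k + 3) x < sqrt 2 / 2"
    unfolding nf_shift2 nf_shift by auto
  then have "sqrt 2 * nf k x < sqrt 2 * 1" using nf_rels(1)[of k x] by simp
  then show ?thesis by (simp only: mult_less_cancel_left) auto
qed

lemma Star_subset_octagon: "Star \<subseteq> octagon"
  using less_imp_le[OF less_trans[OF Star_less1]] kap_bounds by (auto simp: octagon_iff)

lemma Star_Tri_disjoint: "Star \<inter> Tri i = {}"
proof -
  have "\<not> nf (i + 1) x > 1" if "x \<in> Star" for x using Star_less1[OF that, of "i + 1"] by linarith
  then show ?thesis unfolding Tri_def by blast
qed

lemma Tri_child_disjoint: "Tri i \<inter> F a ` octagon = {}"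
proof (rule ccontr)
  assume "Tri i \<inter> F a ` octagon \<noteq> {}"
  then obtain x where x: "x \<in> Tri i" "x \<in> F a ` octagon" by blast
  obtain d where d: "d < 8" "i mod 8 = (a + d) mod 8" by (rule mod8_shift)
  have "x \<in> Tri (a + d)" using x(1) Tri_cong[OF d(2)] by simp
  note C = Tri_bounds(1)[OF this] Tri_bounds(3)[OF this] Tri_bounds(6)[OF this]
  show False using d(1)
    by (rule less8_cases)
     (use x(2) C nf_add4_numeral[of a x] nf_add8_numeral[of a x] sqrt2_bounds
        in \<open>simp_all add: numeral_eq_Suc child_iff\<close>)
qed

lemma Star_child_disjoint: "Star \<inter> F a ` octagon = {}"
proof (rule ccontr)
  assume "Star \<inter> F a ` octagon \<noteq> {}"
  then obtain x where x: "x \<in> Star" "x \<in> F a ` octagon" by blast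
  have "nf (a + 7) x < sqrt 2 / 2 \<or> nf (a + 7 + 1) x < sqrt 2 / 2"
    using x(1) unfolding Star_def by blast
  then show False
    using x(2) unfolding child_iff nf_shift2 nf_shift by auto
qed

text \<open>Otherwise a nonnegative value at \<open>k\<close> would force a positive one at
  \<open>k + 1\<close>, and so on up to \<open>k + 4\<close>, where the value is
  \<open>- nf k x\<close>. The sector found is the one of 45 degrees about \<open>V0 a\<close>,
  between the midpoints of the two edges at that vertex.\<close>

lemma sector_exists: "\<exists>a<8. nf (a + 1) x \<ge> 0 \<and> nf (a + 2) x \<le> 0"
proof (rule ccontr)
  assume neg: "\<not> ?thesis"
  have step: "nf (k + 1) x > 0" if "nf k x \<ge> 0" for k
  proof (rule ccontr)
    let ?a = "(k + 7) mod 8"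
    assume "\<not> nf (k + 1) x > 0"
    moreover have "(?a + 1) mod 8 = k mod 8" "(?a + 2) mod 8 = (k + 1) mod 8"
      unfolding mod_add_left_eq using mod_add_self2[of k 8] mod_add_self2[of "k + 1" 8]
      by (simp_all only: add.assoc) simp_all
    then have "nf (?a + 1) x = nf k x" "nf (?a + 2) x = nf (k + 1) x" using nf_cong by metis+
    ultimately show False using neg that by (metis linorder_not_less mod_less_divisor zero_less_numeral)
  qed
  have "False" if "nf k x \<ge> 0" for k
    using step[OF that] step[of "k + 1"] step[of "k + 2"] step[of "k + 3"] nf_add4_numeral(1)[of k x] that
    by (simp add: numeral_eq_Suc)
  then show False using nf_add4_numeral(1)[of 0 x] by (smt (verit))
qed

text \<open>Inside the sector about \<open>V0 a\<close> only the child \<open>a\<close>, the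
  triangles on edges \<open>a\<close> and \<open>a - 1\<close>, and the star can occur, and the sign
  conditions give the two comparisons in \<open>mono\<close> that decide between them.\<close>

lemma octagon_cover:
  assumes "x \<in> octagon"
  shows "(\<exists>a<8. x \<in> F a ` octagon) \<or> x \<in> Star \<or> (\<exists>i<8. x \<in> Tri i)"
proof -
  obtain a where a: "a < 8" "nf (a + 1) x \<ge> 0" "nf (a + 2) x \<le> 0" using sector_exists by blast
  have le: "nf a x \<le> kap" "- nf (a + 3) x \<le> kap"
    using assms nf_add4_numeral(4)[of a x] by (metis octagon_iff)+
  have "sqrt 2 * nf (a + 2) x \<le> 0" "sqrt 2 * nf (a + 1) x \<ge> 0"
    using a by (simp_all add: mult_nonneg_nonpos)
  then have mono: "nf (a + 1) x \<le> - nf (a + 3) x" "- nf (a + 2) x \<le> nf a x"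
    using nf_rels[of a x] by linarith+
  consider "nf a x \<ge> sqrt 2 / 2" "- nf (a + 3) x \<ge> sqrt 2 / 2" "nf (a + 1) x \<le> 1" "nf (a + 2) x \<ge> -1"
    | "nf (a + 1) x > 1" | "nf (a + 2) x < - 1"
    | "nf a x < sqrt 2 / 2 \<or> - nf (a + 3) x < sqrt 2 / 2" by linarith
  then show ?thesis
  proof cases
    case 1
    then have "x \<in> F a ` octagon" unfolding child_iff using a le by auto
    then show ?thesis using a(1) by blast
  next
    case 2
    then have "x \<in> Tri a" using mono le by (simp add: Tri_def)
    then show ?thesis using a(1) by blast
  next
    case 3
    then have "x \<in> Tri (a + 7)" using mono le
      unfolding Tri_def mem_Collect_eq nf_shift2 nf_shift by auto
    moreover have "Tri (a + 7) = Tri ((a + 7) mod 8)" by (rule Tri_cong) simp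
    ultimately show ?thesis by (metis mod_less_divisor zero_less_numeral)
  next
    case 4
    have "x \<in> Star" unfolding Star_def mem_Collect_eq all_nf2[where a = a and Q = "\<lambda>u v. u < sqrt 2 / 2 \<or> v < sqrt 2 / 2"]
      using 4 a mono sqrt2_bounds by (smt (verit))
    then show ?thesis by blast
  qed
qed

section \<open>Closures, connectedness and symmetry of the triangles and the star\<close>

lemma closure_radial:
  fixes x q :: "'a::euclidean_space"
  assumes "q \<in> S" "\<And>t. 0 < t \<Longrightarrow> t < 1 \<Longrightarrow> (1 - t) *\<^sub>R x + t *\<^sub>R q \<in> S"
  shows "x \<in> closure S"
proof (cases "x = q")
  case True
  then show ?thesis using assms(1) closure_subset by blast
next
  case False
  then have "x \<in> closure (open_segment x q)" by (simp add: closure_open_segment)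
  moreover have "open_segment x q \<subseteq> S" using assms(2) by (auto simp: in_segment)
  ultimately show ?thesis using closure_mono by blast
qed

lemma closed_nf_le: "closed {x. nf k x \<le> c}" "closed {x. nf k x \<ge> c}"
  unfolding nf_def by (simp_all add: closed_halfspace_le closed_halfspace_ge)

lemma convex_nf: "convex {x. nf k x \<le> c}" "convex {x. nf k x > c}" "convex {x. nf k x < c}"
  unfolding nf_def by (simp_all add: convex_halfspace_le convex_halfspace_gt convex_halfspace_lt)

lemma convex_Tri: "convex (Tri i)"
proof -
  have "Tri i = {x. nf i x \<le> kap} \<inter> {x. nf (i + 1) x > 1} \<inter> {x. nf (i + 3) x < -1}"
    by (auto simp: Tri_def)
  then show ?thesis by (simp only: convex_Int convex_nf)
qed

definition midside :: "nat \<Rightarrow> real \<times> real" where "midside i = (1 / 2) *\<^sub>R (V0 i + V0 (i + 1))"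

lemma nf_midside: "nf i (midside i) = kap" "nf (i + 1) (midside i) = (1 + sqrt 2) / 2" "nf (i + 3) (midside i) = - (1 + sqrt 2) / 2"
  unfolding midside_def nf_linear nf_V0 nf_V0_Suc by (simp_all add: kap_def field_simps)

lemma midside_in_Tri: "midside i \<in> Tri i"
  unfolding Tri_def mem_Collect_eq nf_midside using sqrt2_bounds by (simp add: field_simps)

lemma midside_in_side: "midside i \<in> side i"
  unfolding in_side midside_def by (rule bexI[of _ "1/2"]) (auto simp: algebra_simps)

lemma child_edge_iff: "x \<in> F a ` side k \<longleftrightarrow> x \<in> F a ` octagon \<and> nf k x = 1 / 2 + sqrt 2 / 2 * nf k (V0 a)"
proof -
  have "rho * nf k y = 1 / 2 \<longleftrightarrow> nf k y = kap" for y
    using rho_pos rho_kap by (metis mult_cancel_left less_irrefl)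
  then show ?thesis
    by (auto simp: nf_F side_iff image_iff rho_kap)
qed

lemma child_edges:
  "x \<in> F a ` side a \<longleftrightarrow> x \<in> F a ` octagon \<and> nf a x = kap"
  "x \<in> F a ` side (a + 1) \<longleftrightarrow> x \<in> F a ` octagon \<and> nf (a + 1) x = 1"
  "x \<in> F a ` side (a + 3) \<longleftrightarrow> x \<in> F a ` octagon \<and> nf (a + 3) x = - (sqrt 2 / 2)"
  "x \<in> F a ` side (a + 4) \<longleftrightarrow> x \<in> F a ` octagon \<and> nf a x = sqrt 2 / 2"
  "x \<in> F (a + 1) ` side a \<longleftrightarrow> x \<in> F (a + 1) ` octagon \<and> nf a x = kap"
  "x \<in> F (a + 1) ` side (a + 7) \<longleftrightarrow> x \<in> F (a + 1) ` octagon \<and> nf (a + 3) x = -1"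
  unfolding child_edge_iff nf_add4_numeral nf_V0 nf_V0_Suc by (auto simp: kap_def field_simps)

text \<open>The base already belongs to the triangle, so only the two legs are added; they are edges
  of the children \<open>i\<close> and \<open>i + 1\<close>. \<open>?W\<close> relaxes the strict
  inequalities, and each of its points is a limit along the segment to
  \<open>midside i\<close>.\<close>

lemma closure_Tri: "closure (Tri i) = Tri i \<union> F i ` side (i + 1) \<union> F (i + 1) ` side (i + 7)"
proof -
  let ?W = "{x. nf i x \<le> kap} \<inter> {x. nf (i + 1) x \<ge> 1} \<inter> {x. nf (i + 3) x \<le> -1}"
  have W: "?W = Tri i \<union> F i ` side (i + 1) \<union> F (i + 1) ` side (i + 7)"
  proof (intro equalityI subsetI)
    fix x assume x: "x \<in> ?W"
    have r: "sqrt 2 * nf i x \<le> sqrt 2 + 1" using x sqrt2_kap sqrt2_mult_le by (metis Int_iff mem_Collect_eq)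
    have r1: "nf i x \<ge> 1"
      using x nf_rels(1)[of i x] sqrt2_cancel[of "19/10" "nf i x" 1] by simp
    consider "x \<in> Tri i" | "nf (i + 1) x = 1" | "nf (i + 3) x = -1"
      using x by (fastforce simp: Tri_def)
    then show "x \<in> Tri i \<union> F i ` side (i + 1) \<union> F (i + 1) ` side (i + 7)"
    proof cases
      case 2
      have "sqrt 2 * nf (i + 2) x \<le> sqrt 2 * 0" "sqrt 2 * (-1) \<le> sqrt 2 * nf (i + 2) x"
        using 2 x r nf_rels[of i x] by auto
      then have "nf (i + 2) x \<in> {-1..0}" by (simp only: sqrt2_mult_le) simp
      then have "x \<in> F i ` octagon"
        using 2 x r r1 nf_rels(1,3)[of i x] kap_bounds sqrt2_bounds
        unfolding child_iff atLeastAtMost_iff Int_iff mem_Collect_eq by (intro conjI) linarith+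
      then show ?thesis using 2 child_edges(2) by auto
    next
      case 3
      have "sqrt 2 * nf (i + 2) x \<ge> sqrt 2 * 0" "sqrt 2 * 1 \<ge> sqrt 2 * nf (i + 2) x"
        using 3 x r nf_rels[of i x] by auto
      then have "nf (i + 2) x \<in> {0..1}" by (simp only: sqrt2_mult_le) simp
      then have "x \<in> F (i + 1) ` octagon"
        using 3 x r r1 nf_rels(1,3)[of i x] kap_bounds sqrt2_bounds
        unfolding child_iff nf_shift2 atLeastAtMost_iff Int_iff mem_Collect_eq by (intro conjI) linarith+
      then show ?thesis using 3 child_edges(6) by auto
    qed auto
  next
    fix x assume "x \<in> Tri i \<union> F i ` side (i + 1) \<union> F (i + 1) ` side (i + 7)"
    then consider "x \<in> Tri i" | "x \<in> F i ` side (i + 1)" | "x \<in> F (i + 1) ` side (i + 7)" by blast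
    then show "x \<in> ?W"
    proof cases
      case 1
      then show ?thesis by (simp add: Tri_def)
    next
      case 2
      then have *: "nf (i + 1) x = 1" "nf i x \<le> kap" "nf (i + 2) x \<le> 0"
        unfolding child_edges child_iff by auto
      have "sqrt 2 * nf (i + 2) x \<le> 0" using * by (simp add: mult_nonneg_nonpos)
      then show ?thesis using * nf_rels(3)[of i x] by auto
    next
      case 3
      then have *: "nf (i + 3) x = -1" "- kap \<le> nf (i + 1 + 3) x" "nf (i + 1 + 1) x \<ge> 0"
        unfolding child_edges child_iff by auto
      then have "nf i x \<le> kap" "nf (i + 2) x \<ge> 0"
        unfolding nf_shift2 by simp_all
      moreover from this have "sqrt 2 * nf (i + 2) x \<ge> 0" by simp
      ultimately show ?thesis using * nf_rels(3)[of i x]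
        unfolding Int_iff mem_Collect_eq by (intro conjI) linarith+
    qed
  qed
  show ?thesis unfolding W[symmetric]
  proof (rule antisym)
    show "closure (Tri i) \<subseteq> ?W"
      by (rule closure_minimal) (auto simp: Tri_def intro!: closed_Int closed_nf_le)
    show "?W \<subseteq> closure (Tri i)"
    proof
      fix x assume x: "x \<in> ?W"
      show "x \<in> closure (Tri i)"
      proof (rule closure_radial[OF midside_in_Tri[of i]])
        fix t :: real assume t: "0 < t" "t < 1"
        note q = midside_in_Tri[of i, unfolded Tri_def mem_Collect_eq]
        have "(1 - t) * nf i x + t * nf i (midside i) \<le> (1 - t) * kap + t * kap"
          using t q x by (intro add_mono mult_left_mono) auto
        moreover have "(1 - t) * 1 + t * 1 < (1 - t) * nf (i + 1) x + t * nf (i + 1) (midside i)"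
          using t q x by (intro add_le_less_mono mult_left_mono mult_strict_left_mono) auto
        moreover have "(1 - t) * nf (i + 3) x + t * nf (i + 3) (midside i) < (1 - t) * (-1) + t * (-1)"
          using t q x by (intro add_le_less_mono mult_left_mono mult_strict_left_mono) auto
        ultimately show "(1 - t) *\<^sub>R x + t *\<^sub>R midside i \<in> Tri i"
          unfolding Tri_def mem_Collect_eq nf_linear by (simp add: algebra_simps)
      qed
    qed
  qed
qed

text \<open>Again strict inequalities are relaxed, and points are approached along the segment to 0,
  about which the star is star-shaped. The added boundary consists of the two inner edges of each
  child.\<close>

lemma closure_Star: "closure Star = Star \<union> (\<Union>a<8. F a ` side (a + 3) \<union> F a ` side (a + 4))"
proof -
  let ?W = "{x. \<forall>k. nf k x \<le> sqrt 2 / 2 \<or> nf (k + 1) x \<le> sqrt 2 / 2}"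
  have W: "?W = Star \<union> (\<Union>a<8. F a ` side (a + 3) \<union> F a ` side (a + 4))"
  proof (intro equalityI subsetI)
    fix x assume x: "x \<in> ?W"
    show "x \<in> Star \<union> (\<Union>a<8. F a ` side (a + 3) \<union> F a ` side (a + 4))"
    proof (cases "x \<in> Star")
      case False
      then obtain k where k: "nf k x \<ge> sqrt 2 / 2" "nf (k + 1) x \<ge> sqrt 2 / 2"
        by (auto simp: Star_def not_less)
      have W: "nf (k + 7) x \<le> sqrt 2 / 2 \<or> nf (k + 7 + 1) x \<le> sqrt 2 / 2"
         "nf k x \<le> sqrt 2 / 2 \<or> nf (k + 1) x \<le> sqrt 2 / 2"
         "nf (k + 1) x \<le> sqrt 2 / 2 \<or> nf (k + 1 + 1) x \<le> sqrt 2 / 2"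
        using x by blast+
      then have W1: "- nf (k + 3) x \<le> sqrt 2 / 2 \<or> nf k x \<le> sqrt 2 / 2"
        and W2: "nf (k + 1) x \<le> sqrt 2 / 2 \<or> nf (k + 2) x \<le> sqrt 2 / 2"
        unfolding nf_shift2 nf_shift by auto
      have le1: "nf k x \<le> 1"
      proof (cases "nf k x \<le> sqrt 2 / 2")
        case False
        then have "sqrt 2 * nf k x \<le> sqrt 2 * 1" using W W1 nf_rels(1)[of k x] by auto
        then show ?thesis by (simp only: sqrt2_mult_le)
      qed (use sqrt2_bounds in linarith)
      have le2: "nf (k + 1) x \<le> 1"
      proof (cases "nf (k + 1) x \<le> sqrt 2 / 2")
        case False
        then have "sqrt 2 * nf (k + 1) x \<le> sqrt 2 * 1" using W W2 nf_rels(2)[of k x] by auto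
        then show ?thesis by (simp only: sqrt2_mult_le)
      qed (use sqrt2_bounds in linarith)
      have s: "sqrt 2 * nf k x \<ge> 1" "sqrt 2 * nf (k + 1) x \<ge> 1" "sqrt 2 * nf k x \<le> sqrt 2" "sqrt 2 * nf (k + 1) x \<le> sqrt 2"
        using k le1 le2 sqrt2_mult_le[of "sqrt 2 / 2"] by auto
      have h: "nf k x = sqrt 2 / 2 \<or> nf (k + 1) x = sqrt 2 / 2" using W k by linarith
      have e: "sqrt 2 * (sqrt 2 / 2) = (1::real)" by simp
      have h2: "nf k x = sqrt 2 / 2 \<Longrightarrow> sqrt 2 * nf k x = 1" "nf (k + 1) x = sqrt 2 / 2 \<Longrightarrow> sqrt 2 * nf (k + 1) x = 1"
        by (simp_all only: e)
      have c: "nf (k + 2) x \<in> {0..1}" "nf (k + 3) x \<in> {-1..0}"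
      proof -
        consider "nf k x = sqrt 2 / 2" "sqrt 2 * nf k x = 1" | "nf (k + 1) x = sqrt 2 / 2" "sqrt 2 * nf (k + 1) x = 1"
          using h h2 by blast
        then have "0 \<le> nf (k + 2) x \<and> nf (k + 2) x \<le> 1 \<and> -1 \<le> nf (k + 3) x \<and> nf (k + 3) x \<le> 0"
          by cases (use s le1 le2 k nf_rels(1,2)[of k x] sqrt2_bounds in \<open>(intro conjI, linarith+)\<close>)
        then show "nf (k + 2) x \<in> {0..1}" "nf (k + 3) x \<in> {-1..0}" by auto
      qed
      \<comment> \<open>Vertex \<open>k + 1\<close> lies between the edges \<open>k\<close> and
        \<open>k + 1\<close>, so two large consecutive values point to the child with that
        index.\<close>
      define a where "a = (k + 1) mod 8"
      have "nf (a + d) = nf (k + 1 + d)" for d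
        by (rule nf_cong) (simp add: a_def mod_simps)
      from this[of 0] this[of 1] this[of 2] this[of 3]
      have n: "nf a x = nf (k + 1) x" "nf (a + 1) x = nf (k + 2) x" "nf (a + 2) x = nf (k + 3) x"
        "nf (a + 3) x = - nf k x" unfolding add_0_right by (simp_all only: nf_shift2)
      have "x \<in> F a ` octagon" unfolding child_iff n using c k le1 le2 kap_bounds by auto
      then have "x \<in> F a ` side (a + 3) \<or> x \<in> F a ` side (a + 4)"
        using h unfolding child_edges n by auto
      moreover have "a < 8" by (simp add: a_def)
      ultimately show ?thesis by blast
    qed simp
  next
    fix x assume "x \<in> Star \<union> (\<Union>a<8. F a ` side (a + 3) \<union> F a ` side (a + 4))"
    then consider "x \<in> Star" | a where "x \<in> F a ` octagon" "nf (a + 3) x = - (sqrt 2 / 2) \<or> nf a x = sqrt 2 / 2"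
      unfolding UN_iff Un_iff child_edges by blast
    then show "x \<in> ?W"
    proof cases
      case 1
      then show ?thesis unfolding Star_def using less_imp_le by blast
    next
      case 2
      note c = 2(1)[unfolded child_iff]
      have "sqrt 2 * nf (a + 2) x \<le> 0" "sqrt 2 * nf (a + 1) x \<ge> 0"
        using c by (simp_all add: mult_nonneg_nonpos)
      then have mono: "nf (a + 1) x \<le> - nf (a + 3) x" "- nf (a + 2) x \<le> nf a x"
        using nf_rels[of a x] by linarith+
      show ?thesis unfolding mem_Collect_eq all_nf2[where a = a and Q = "\<lambda>u v. u \<le> sqrt 2 / 2 \<or> v \<le> sqrt 2 / 2"]
        using 2(2) c mono sqrt2_bounds by auto
    qed
  qed
  show ?thesis unfolding W[symmetric]
  proof (rule antisym)
    have "?W = (\<Inter>k. {x. nf k x \<le> sqrt 2 / 2} \<union> {x. nf (k + 1) x \<le> sqrt 2 / 2})" by auto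
    moreover have "closed (\<Inter>k. {x. nf k x \<le> sqrt 2 / 2} \<union> {x. nf (k + 1) x \<le> sqrt 2 / 2})"
      by (intro closed_INT ballI closed_Un closed_nf_le)
    ultimately have "closed ?W" by simp
    then show "closure Star \<subseteq> ?W"
      by (intro closure_minimal) (auto simp: Star_def intro: less_imp_le)
    show "?W \<subseteq> closure Star"
    proof
      fix x assume x: "x \<in> ?W"
      show "x \<in> closure Star"
      proof (rule closure_radial[of 0])
        show "0 \<in> Star" by (simp add: Star_def nf_0)
        fix t :: real assume t: "0 < t" "t < 1"
        have "(1 - t) * v < sqrt 2 / 2" if "v \<le> sqrt 2 / 2" for v
        proof -
          have "(1 - t) * v \<le> (1 - t) * (sqrt 2 / 2)" using that t by (intro mult_left_mono) auto
          also have "\<dots> < 1 * (sqrt 2 / 2)" using t by (intro mult_strict_right_mono) auto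
          finally show ?thesis by simp
        qed
        then show "(1 - t) *\<^sub>R x + t *\<^sub>R 0 \<in> Star"
          using x unfolding Star_def mem_Collect_eq nf_linear by (simp, blast)
      qed
    qed
  qed
qed

lemma connected_Star: "connected Star"
proof (rule starlike_imp_connected)
  show "starlike Star" unfolding starlike_def
  proof (intro bexI ballI)
    show "0 \<in> Star" by (simp add: Star_def nf_0)
    fix x assume x: "x \<in> Star"
    have "t * v < sqrt 2 / 2" if "v < sqrt 2 / 2" "0 \<le> t" "t \<le> 1" for v t :: real
    proof (cases "v \<ge> 0")
      case True
      then have "t * v \<le> 1 * v" using that by (intro mult_right_mono) auto
      then show ?thesis using that by simp
    next
      case False
      then have "t * v \<le> 0" using that by (simp add: mult_nonneg_nonpos)
      then show ?thesis by (smt (verit) real_sqrt_gt_zero half_gt_zero)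
    qed
    then show "closed_segment 0 x \<subseteq> Star"
      using x by (auto simp: in_segment Star_def nf_linear) blast
  qed
qed

lemma Star_uminus: "- x \<in> Star \<longleftrightarrow> x \<in> Star"
  unfolding Star_def mem_Collect_eq all_nf2[where a = 0 and Q = "\<lambda>u v. u < sqrt 2 / 2 \<or> v < sqrt 2 / 2"] nf_linear by auto

lemma Tri_uminus: "- x \<in> Tri (i + 4) \<longleftrightarrow> x \<in> Tri i"
proof -
  have e: "i + 4 + 1 = i + 5" "i + 4 + 3 = i + 7" by simp_all
  show ?thesis unfolding Tri_def mem_Collect_eq nf_linear e nf_shift by auto
qed

lemma octagon_uminus: "- x \<in> octagon \<longleftrightarrow> x \<in> octagon"
  unfolding octagon_iff4[of _ 0] nf_linear by auto

lemma side_subset: "side i \<subseteq> F i ` side i \<union> F (i + 1) ` side i \<union> Tri i"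
proof
  fix x assume "x \<in> side i"
  then have x: "x \<in> octagon" "nf i x = kap" by (auto simp: side_iff)
  then have p: "nf (i + 1) x - sqrt 2 / 2 \<in> {0..1}" by (rule side_param)
  have 3: "nf (i + 3) x = nf (i + 1) x - sqrt 2 - 1"
    using nf_rels(1)[of i x] sqrt2_kap unfolding x(2) by linarith
  then have 2: "sqrt 2 * nf (i + 2) x = 2 * nf (i + 1) x - sqrt 2 - 1" using nf_rels(3)[of i x] by simp
  consider "x \<in> Tri i" | "nf (i + 1) x \<le> 1" | "nf (i + 3) x \<ge> - 1"
    using x by (force simp: Tri_def)
  then show "x \<in> F i ` side i \<union> F (i + 1) ` side i \<union> Tri i"
  proof cases
    case c2: 2
    then have "sqrt 2 * nf (i + 2) x \<le> sqrt 2 * 0" "sqrt 2 * (-1) \<le> sqrt 2 * nf (i + 2) x"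
      using p 2 sqrt2_bounds by auto
    then have "nf (i + 2) x \<in> {-1..0}" by (simp only: sqrt2_mult_le) simp
    then have "x \<in> F i ` octagon"
      unfolding child_iff using c2 x p 3 kap_bounds sqrt2_bounds by (auto simp: kap_def)
    then show ?thesis using x child_edges(1) by auto
  next
    case c3: 3
    then have "sqrt 2 * nf (i + 2) x \<ge> sqrt 2 * 0" "sqrt 2 * 1 \<ge> sqrt 2 * nf (i + 2) x"
      using p 2 3 sqrt2_bounds by auto
    then have "nf (i + 2) x \<in> {0..1}" by (simp only: sqrt2_mult_le) simp
    then have "x \<in> F (i + 1) ` octagon"
      unfolding child_iff nf_shift2 using c3 x p 3 kap_bounds sqrt2_bounds by (auto simp: kap_def)
    then show ?thesis using x child_edges(5) by auto
  qed auto
qed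

lemma child_side_subset: "F i ` side i \<subseteq> side i" "F (i + 1) ` side i \<subseteq> side i"
  using child_edges(1,5) child_subset_octagon unfolding subset_iff side_iff by blast+

section \<open>Words and partner edges\<close>

text \<open>Words are reversed here: the head of the list is the last letter, i.e. the innermost map.\<close>

definition words :: "nat \<Rightarrow> nat list set" where
  "words m = {u. length u = m \<and> set u \<subseteq> {..<8}}"

definition opposite :: "nat \<Rightarrow> nat" where "opposite i = (i + 4) mod 8"

text \<open>Edge \<open>i\<close> of the cell \<open>u\<close> is identified with edge \<open>opposite i\<close> of \<open>partner u i\<close>; the two edges are
  equal as sets if \<open>shared u i\<close> holds, and antipodal with respect to a hole otherwise. For a child
  \<open>a # u\<close> the position \<open>d\<close> of the edge relative to \<open>a\<close> decides: 0 and 7 lie on edges of the parent, 1 and 6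
  border triangles, 2 and 5 are shared with siblings, and 3 and 4 border the star in the middle.\<close>

fun shared :: "nat list \<Rightarrow> nat \<Rightarrow> bool" where
  "shared [] i = False"
| "shared (a # u) i = (let d = (i + 8 - a) mod 8 in d = 2 \<or> d = 5 \<or> ((d = 0 \<or> d = 7) \<and> shared u i))"

fun partner :: "nat list \<Rightarrow> nat \<Rightarrow> nat list" where
  "partner [] i = []"
| "partner (a # u) i = (let d = (i + 8 - a) mod 8 in
     if d = 0 then (if shared u i then (a + 5) mod 8 else (a + 4) mod 8) # partner u i
     else if d = 1 then ((a + 4) mod 8) # partner u a
     else if d = 2 then ((a + 1) mod 8) # u
     else if d = 5 then ((a + 7) mod 8) # u
     else if d = 6 then ((a + 4) mod 8) # partner u ((i + 1) mod 8)
     else if d = 7 then (if shared u i then (a + 3) mod 8 else (a + 4) mod 8) # partner u i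
     else ((a + 4) mod 8) # u)"

fun centre :: "nat list \<Rightarrow> real \<times> real" where
  "centre [] = 0"
| "centre (a # u) = centre u + (rho ^ length u * (sqrt 2 / 2)) *\<^sub>R V0 a"

datatype hole_id = Outer | Central "nat list" | Square "real \<times> real" "(nat list \<times> nat) set"

fun id_centre :: "hole_id \<Rightarrow> real \<times> real" where
  "id_centre Outer = 0"
| "id_centre (Central u) = centre u"
| "id_centre (Square p K) = p"

text \<open>\<open>gap_hole u i\<close> names the hole that absorbs the triangle on edge \<open>i\<close> of \<open>u\<close> at the next level. A square
  hole is named by its centre and the two edges that it grew from.\<close>

fun gap_hole :: "nat list \<Rightarrow> nat \<Rightarrow> hole_id" where
  "gap_hole [] i = Outer"
| "gap_hole (a # u) i = (let d = (i + 8 - a) mod 8 in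
     if shared (a # u) i then Square (midpoint (centre (a # u)) (centre (partner (a # u) i))) {(a # u, i), (partner (a # u) i, opposite i)}
     else if d = 0 \<or> d = 7 then gap_hole u i
     else if d = 1 then gap_hole u a
     else if d = 6 then gap_hole u ((i + 1) mod 8)
     else Central u)"

lemma words_0: "words 0 = {[]}" by (auto simp: words_def)

lemma words_Suc: "u \<in> words (Suc m) \<longleftrightarrow> (\<exists>a v. u = a # v \<and> a < 8 \<and> v \<in> words m)"
  by (cases u) (auto simp: words_def)

lemma words_Cons [simp]: "a # v \<in> words (Suc m) \<longleftrightarrow> a < 8 \<and> v \<in> words m"
  by (simp add: words_Suc)

lemma words_length: "u \<in> words m \<Longrightarrow> length u = m" by (simp add: words_def)

lemma opposite_less: "opposite i < 8" by (simp add: opposite_def)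

lemma opposite_opposite: "i < 8 \<Longrightarrow> opposite (opposite i) = i"
  by (simp add: opposite_def mod_simps)

lemma partner_words: "u \<in> words m \<Longrightarrow> i < 8 \<Longrightarrow> partner u i \<in> words m"
proof (induction m arbitrary: u i)
  case (Suc m)
  then obtain a v where "u = a # v" "a < 8" "v \<in> words m" by (auto simp: words_Suc)
  with Suc.IH[of v] Suc.prems(2) show ?case by (simp add: Let_def)
qed (simp add: words_0)

lemma partner_length: "u \<in> words m \<Longrightarrow> i < 8 \<Longrightarrow> length (partner u i) = length u"
  using partner_words words_length by metis

text \<open>With \<open>a\<close> and \<open>i\<close> concrete the recursion evaluates, leaving the
  induction hypothesis for the parent. For shared parent edges the offsets 5 and 3 replace 4 because
  positions 0 and 7 are exchanged: edge \<open>a\<close> of child \<open>a\<close> meets edge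
  \<open>a + 4\<close> of child \<open>a + 5\<close>, which has position 7 there.\<close>

lemma partner_involution:
  assumes "u \<in> words m" "i < 8"
  shows "shared (partner u i) (opposite i) = shared u i \<and> partner (partner u i) (opposite i) = u"
  using assms
proof (induction m arbitrary: u i)
  case 0
  then show ?case by (simp add: words_0)
next
  case (Suc m)
  then obtain a v where u: "u = a # v" "a < 8" "v \<in> words m" by (auto simp: words_Suc)
  note IH = Suc.IH[OF u(3), unfolded opposite_def]
  note IHs = IH[of 0] IH[of 1] IH[of 2] IH[of 3] IH[of 4] IH[of 5] IH[of 6] IH[of 7]
  note IHn = IHs[simplified]
  show ?case unfolding u(1) opposite_def
    by (rule less8_cases[OF u(2)]; rule less8_cases[OF Suc.prems(2)]; cases "shared v i"; simp add: IHn IHn[unfolded numeral_2_eq_2] Let_def)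
qed

lemma gap_hole_shared:
  "shared u i \<Longrightarrow> gap_hole u i = Square (midpoint (centre u) (centre (partner u i))) {(u, i), (partner u i, opposite i)}"
  by (cases u) (simp_all add: Let_def)

text \<open>The triangles on an edge and on its partner are absorbed by the same hole. For a shared
  edge this holds because the name is symmetric in the two edges; otherwise it is inherited from the
  parent. Both the merging of triangles and the symmetry of holes rest on it.\<close>

lemma gap_hole_partner:
  assumes "u \<in> words m" "i < 8"
  shows "gap_hole (partner u i) (opposite i) = gap_hole u i"
proof -
  have sh: "gap_hole (partner u i) (opposite i) = gap_hole u i" if "shared u i" "u \<in> words m" "i < 8" for u i m
    using that partner_involution[OF that(2,3)] opposite_opposite[OF that(3)]
    by (simp add: gap_hole_shared midpoint_sym insert_commute)
  show ?thesis using assms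
  proof (induction m arbitrary: u i)
    case 0
    then show ?case by (simp add: words_0)
  next
    case (Suc m)
    then obtain a v where u: "u = a # v" "a < 8" "v \<in> words m" by (auto simp: words_Suc)
    note IH = Suc.IH[OF u(3), unfolded opposite_def]
    note inv = partner_involution[OF u(3), unfolded opposite_def, THEN conjunct1]
    note IHn = IH[of 0, simplified] IH[of 1, simplified] IH[of 2, simplified] IH[of 3, simplified]
      IH[of 4, simplified] IH[of 5, simplified] IH[of 6, simplified] IH[of 7, simplified]
    note invn = inv[of 0, simplified] inv[of 1, simplified] inv[of 2, simplified] inv[of 3, simplified]
      inv[of 4, simplified] inv[of 5, simplified] inv[of 6, simplified] inv[of 7, simplified]
    have "\<not> shared (a # v) i \<Longrightarrow> gap_hole (partner (a # v) i) (opposite i) = gap_hole (a # v) i"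
      unfolding opposite_def
      by (rule less8_cases[OF u(2)]; rule less8_cases[OF Suc.prems(2)]; simp add: IHn invn IHn[unfolded numeral_2_eq_2] invn[unfolded numeral_2_eq_2] Let_def)
    with u Suc.prems sh[of u i "Suc m"] show ?case by blast
  qed
qed

text \<open>For a shared edge the centre of the hole is the midpoint by definition. Otherwise the
  child \<open>a\<close> is paired with the child \<open>a + 4\<close> of the parent or of a partner
  of the parent, and \<open>V0 (a + 4) = - V0 a\<close> carries the reflection one level
  down.\<close>

lemma centre_partner:
  assumes "u \<in> words m" "i < 8"
  shows "centre (partner u i) = 2 *\<^sub>R id_centre (gap_hole u i) - centre u"
proof -
  have sh: "centre (partner u i) = 2 *\<^sub>R id_centre (gap_hole u i) - centre u" if "shared u i" for u i
    using that by (simp add: gap_hole_shared midpoint_def)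
  show ?thesis using assms
  proof (induction m arbitrary: u i)
    case 0
    then show ?case by (simp add: words_0)
  next
    case (Suc m)
    then obtain a v where u: "u = a # v" "a < 8" "v \<in> words m" by (auto simp: words_Suc)
    note l = words_length[OF u(3)]
    show ?case
    proof (cases "shared u i")
      case False
      have opposite: "centre (((a + 4) mod 8) # w) = centre w - (rho ^ length w * (sqrt 2 / 2)) *\<^sub>R V0 a" for w
        by (simp add: V0_mod V0_add4)
      define d where "d = (i + 8 - a) mod 8"
      have "d < 8" by (simp add: d_def)
      then show ?thesis
        by (rule less8_cases)
         (use False u Suc.prems Suc.IH[OF u(3)] partner_length[OF u(3)] d_def[symmetric]
           in \<open>simp_all add: opposite l Let_def algebra_simps scaleR_2 del: centre.simps(2)\<close>,
          simp_all add: l algebra_simps scaleR_2)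
    qed (rule sh)
  qed
qed

text \<open>Names record the birth of a hole: one named by words of length \<open>m\<close> is first
  present at level \<open>m + 1\<close>. This is how newborn holes are told apart from growing ones
  when connectedness is proved.\<close>

lemma gap_hole_Central_level: "gap_hole u i = Central v \<Longrightarrow> length v < length u"
  by (induction u arbitrary: i) (auto simp: Let_def less_SucI split: if_splits)

lemma gap_hole_Square_level:
  "\<not> shared u i \<Longrightarrow> u \<in> words m \<Longrightarrow> i < 8 \<Longrightarrow> gap_hole u i = Square p K \<Longrightarrow> \<forall>(v, j)\<in>K. length v < length u"
proof (induction u arbitrary: i m)
  case (Cons a u)
  obtain m' where w: "a < 8" "u \<in> words m'" using Cons.prems(2) by (cases m) (auto simp: words_def)
  obtain s where s: "s < 8" "gap_hole u s = Square p K"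
    using Cons.prems w(1) that[of i] that[of a] that[of "(i + 1) mod 8"] by (auto simp: Let_def split: if_splits)
  show ?case
  proof (cases "shared u s")
    case True
    then have "K = {(u, s), (partner u s, opposite s)}" using gap_hole_shared[OF True] s(2) by simp
    then show ?thesis using partner_length[OF w(2) s(1)] by simp
  next
    case False
    then show ?thesis using Cons.IH[OF False w(2) s] by fastforce
  qed
qed simp

lemma edge_index:
  fixes a i :: nat
  assumes "a < 8" "i < 8"
  shows "i = (a + (i + 8 - a) mod 8) mod 8"
  using assms by (simp add: mod_simps)

lemma V0_basis: "V0 (a + 2) = sqrt 2 *\<^sub>R V0 (a + 1) - V0 a" "V0 (a + 3) = V0 (a + 1) - sqrt 2 *\<^sub>R V0 a"
proof -
  show 2: "V0 (a + 2) = sqrt 2 *\<^sub>R V0 (a + 1) - V0 a" using V0_rec[of a] by (simp add: algebra_simps)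
  have e: "a + 1 + 2 = a + 3" "a + 1 + 1 = a + 2" by simp_all
  have "V0 (a + 1) + V0 (a + 3) = sqrt 2 *\<^sub>R V0 (a + 2)" using V0_rec[of "a + 1"] unfolding e .
  then show "V0 (a + 3) = V0 (a + 1) - sqrt 2 *\<^sub>R V0 a" unfolding 2
    by (simp add: scaleR_diff_right eq_diff_eq scaleR_2)
qed

lemma V0_shift: "V0 (a + 4) = - V0 a" "V0 (a + 5) = - V0 (a + 1)" "V0 (a + 6) = - V0 (a + 2)" "V0 (a + 7) = - V0 (a + 3)" "V0 (a + 8) = V0 a"
proof -
  have e: "a + 5 = a + 1 + 4" "a + 6 = a + 2 + 4" "a + 7 = a + 3 + 4" "a + 8 = a + 4 + 4" by simp_all
  show "V0 (a + 4) = - V0 a" "V0 (a + 5) = - V0 (a + 1)" "V0 (a + 6) = - V0 (a + 2)" "V0 (a + 7) = - V0 (a + 3)"  "V0 (a + 8) = V0 a"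
    unfolding e V0_add4 by simp_all
qed

text \<open>The right-hand sides are twice the vectors from the centre of a child to the midpoints
  of its edges \<open>a + 2\<close> and \<open>a + 5\<close>; so consecutive siblings touch along
  these edges, the positions 2 and 5 in \<open>shared\<close>.\<close>

lemma neighbour_offset:
  "(sqrt 2 / 2) *\<^sub>R (V0 (a + 1) - V0 a) = rho *\<^sub>R (V0 (a + 2) + V0 (a + 3))"
  "(sqrt 2 / 2) *\<^sub>R (V0 (a + 7) - V0 a) = rho *\<^sub>R (V0 (a + 5) + V0 (a + 6))"
proof -
  show "(sqrt 2 / 2) *\<^sub>R (V0 (a + 1) - V0 a) = rho *\<^sub>R (V0 (a + 2) + V0 (a + 3))"
    unfolding V0_basis by (cases "V0 a"; cases "V0 (a + 1)") (simp add: rho_eq field_simps)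
  show "(sqrt 2 / 2) *\<^sub>R (V0 (a + 7) - V0 a) = rho *\<^sub>R (V0 (a + 5) + V0 (a + 6))"
    unfolding V0_shift V0_basis by (cases "V0 a"; cases "V0 (a + 1)") (simp add: rho_eq field_simps)
qed

lemma shared_centre:
  assumes "u \<in> words m" "i < 8" "shared u i"
  shows "centre (partner u i) = centre u + rho ^ m *\<^sub>R (V0 i + V0 (i + 1))"
  using assms
proof (induction m arbitrary: u i)
  case 0
  then show ?case by (simp add: words_0)
next
  case (Suc m)
  then obtain a v where u: "u = a # v" "a < 8" "v \<in> words m" by (auto simp: words_Suc)
  note l = words_length[OF u(3)]
  define d where "d = (i + 8 - a) mod 8"
  have i: "i = (a + d) mod 8" unfolding d_def by (rule edge_index) fact+
  have Vi: "V0 i = V0 (a + d)" unfolding i by (rule V0_mod)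
  have "(i + 1) mod 8 = (a + d + 1) mod 8" unfolding i by (simp add: mod_simps)
  then have Vi1: "V0 (i + 1) = V0 (a + d + 1)" by (metis V0_mod)
  consider "d = 2" | "d = 5" | "d = 0" "shared v i" | "d = 7" "shared v i"
    using Suc.prems(3) unfolding u by (auto simp: Let_def d_def[symmetric])
  then show ?case
  proof cases
    case 1
    have e: "a + 2 + 1 = a + 3" by simp
    have "centre (partner u i) = centre u + rho ^ m *\<^sub>R ((sqrt 2 / 2) *\<^sub>R (V0 (a + 1) - V0 a))"
      using 1 d_def l unfolding u by (simp add: Let_def V0_mod algebra_simps)
    then show ?thesis unfolding neighbour_offset Vi Vi1 1 e by (simp add: mult.commute)
  next
    case 2
    have e: "a + 5 + 1 = a + 6" by simp
    have "centre (partner u i) = centre u + rho ^ m *\<^sub>R ((sqrt 2 / 2) *\<^sub>R (V0 (a + 7) - V0 a))"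
      using 2 d_def l unfolding u by (simp add: Let_def V0_mod algebra_simps)
    then show ?thesis unfolding neighbour_offset Vi Vi1 2 e by (simp add: mult.commute)
  next
    case 3
    have "V0 ((a + 5) mod 8) = - V0 (a + 1)" unfolding V0_mod V0_shift by simp
    then have "centre (partner u i) = centre (partner v i) - (rho ^ m * (sqrt 2 / 2)) *\<^sub>R V0 (a + 1)"
      using 3 d_def l partner_length[OF u(3) Suc.prems(2)] unfolding u by (simp add: Let_def)
    also have "\<dots> = centre u + rho ^ m *\<^sub>R (rho *\<^sub>R (V0 a + V0 (a + 1)))"
      using Suc.IH[OF u(3) Suc.prems(2) 3(2)] unfolding u Vi Vi1 3
      by (simp add: l rho_eq algebra_simps)
    finally show ?thesis unfolding Vi Vi1 3 by (simp add: mult.commute)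
  next
    case 4
    have e: "a + 7 + 1 = a + 8" by simp
    have "V0 ((a + 3) mod 8) = V0 (a + 3)" by (rule V0_mod)
    then have "centre (partner u i) = centre (partner v i) + (rho ^ m * (sqrt 2 / 2)) *\<^sub>R V0 (a + 3)"
      using 4 d_def l partner_length[OF u(3) Suc.prems(2)] unfolding u by (simp add: Let_def)
    also have "\<dots> = centre u + rho ^ m *\<^sub>R (rho *\<^sub>R (V0 (a + 7) + V0 (a + 8)))"
      using Suc.IH[OF u(3) Suc.prems(2) 4(2)] unfolding u Vi Vi1 4 e V0_shift
      by (simp add: l rho_eq algebra_simps)
    finally show ?thesis unfolding Vi Vi1 4 e by (simp add: mult.commute)
  qed
qed

section \<open>Intersections of cells\<close>

definition place :: "nat list \<Rightarrow> real \<times> real \<Rightarrow> real \<times> real" where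
  "place u x = centre u + rho ^ length u *\<^sub>R x"

lemma place_Nil: "place [] = id" by (auto simp: place_def)

lemma place_Cons: "place (a # u) x = place u (F a x)"
  by (simp add: place_def F_eq algebra_simps)

lemma place_Cons_image: "place (a # u) ` S = place u ` F a ` S"
  by (simp add: image_image place_Cons)

lemma place_eq_iff: "place u x = place u y \<longleftrightarrow> x = y"
  using rho_pos by (simp add: place_def)

lemma place_surj: "\<exists>y. place u y = x"
proof
  show "place u ((1 / rho ^ length u) *\<^sub>R (x - centre u)) = x"
    using rho_pos by (simp add: place_def)
qed

lemma place_image_iff: "place u x \<in> place u ` S \<longleftrightarrow> x \<in> S"
  by (auto simp: place_eq_iff)

lemma place_rev_append: "place (rev w) x = F_word w x"
proof (induction w arbitrary: x rule: rev_induct)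
  case Nil
  then show ?case by (simp add: place_Nil F_word_def)
next
  case (snoc a w)
  have "F_word (w @ [a]) x = F_word w (F a x)"
    unfolding F_word_def by (induction w) simp_all
  then show ?case using snoc.IH by (simp add: place_Cons)
qed

definition cell_of :: "nat list \<Rightarrow> (real \<times> real) set" where "cell_of u = place u ` octagon"

lemma cells_eq: "cells m = cell_of ` words m"
proof -
  have "cell w = cell_of (rev w)" for w
    unfolding cell_def cell_of_def by (rule image_cong) (simp_all add: place_rev_append)
  moreover have "{w. length w = m \<and> set w \<subseteq> {..<8}} = rev ` words m"
    by (force simp: words_def image_iff intro: exI[of _ "rev _"])
  ultimately show ?thesis unfolding cells_def by (force simp: image_image)
qed

lemma O_level_eq: "O_level m = (\<Union>u\<in>words m. cell_of u)"
  by (simp add: O_level_def cells_eq)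

lemma norm_V0: "norm (V0 n) = 1"
  using V0_inner_0[of n] by (simp add: norm_eq_sqrt_inner)

lemma octagon_norm: "x \<in> octagon \<Longrightarrow> norm x \<le> 1"
proof -
  have "octagon \<subseteq> cball 0 1"
    unfolding octagon_def by (rule hull_minimal) (auto simp: norm_V0 convex_cball)
  then show "x \<in> octagon \<Longrightarrow> norm x \<le> 1" by auto
qed

lemma rho_bounds: "29/100 < rho" "rho < 3/10"
  using sqrt2_bounds by (simp_all add: rho_eq)

lemma nf_V0_all:
  "nf i (V0 i) = kap" "nf i (V0 (i + 1)) = kap" "nf i (V0 (i + 2)) = sqrt 2 / 2" "nf i (V0 (i + 3)) = - (sqrt 2 / 2)"
  "nf i (V0 (i + 4)) = - kap" "nf i (V0 (i + 5)) = - kap" "nf i (V0 (i + 6)) = - (sqrt 2 / 2)" "nf i (V0 (i + 7)) = sqrt 2 / 2"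
  unfolding V0_shift V0_basis nf_linear nf_V0 nf_V0_Suc by (simp_all add: kap_def field_simps)

lemma norm_edge_normal: "(V0 i + V0 (i + 1)) \<bullet> (V0 i + V0 (i + 1)) = 2 * kap"
  using nf_V0_all(1,2)[of i] by (simp only: nf_def inner_add_right)

lemma V0_cong: "a mod 8 = b mod 8 \<Longrightarrow> V0 a = V0 b"
  using V0_mod[of a] V0_mod[of b] by simp

lemma V0_inner_shift:
  "V0 a \<bullet> V0 (a + 2) = 0" "V0 a \<bullet> V0 (a + 3) = - (sqrt 2 / 2)" "V0 a \<bullet> V0 (a + 4) = - 1"
  "V0 a \<bullet> V0 (a + 5) = - (sqrt 2 / 2)" "V0 a \<bullet> V0 (a + 6) = 0"
proof -
  have 1: "V0 a \<bullet> V0 (a + 1) = sqrt 2 / 2" using V0_inner_1(1)[of a] by simp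
  show "V0 a \<bullet> V0 (a + 2) = 0" "V0 a \<bullet> V0 (a + 3) = - (sqrt 2 / 2)" "V0 a \<bullet> V0 (a + 4) = - 1"
    "V0 a \<bullet> V0 (a + 5) = - (sqrt 2 / 2)" "V0 a \<bullet> V0 (a + 6) = 0"
    unfolding V0_shift V0_basis inner_diff_right inner_scaleR_right inner_minus_right 1 V0_inner_0
    by simp_all
qed

text \<open>The hypothesis says that the circumscribed discs of two siblings meet, in units of the
  parent. It forces \<open>V0 a\<close> and \<open>V0 b\<close> to have inner product above 1/2, an
  angle below 60 degrees, which leaves at most one step of 45 degrees.\<close>

lemma near_children:
  assumes "norm ((sqrt 2 / 2) *\<^sub>R (V0 a - V0 b)) \<le> 2 * rho" "a < 8" "b < 8"
  shows "b = a \<or> b = (a + 1) mod 8 \<or> b = (a + 7) mod 8"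
proof -
  obtain d where d: "d < 8" "b mod 8 = (a + d) mod 8" by (rule mod8_shift)
  have b: "b = (a + d) mod 8" "V0 b = V0 (a + d)" using d assms(3) V0_cong[OF d(2)] by simp_all
  have "sqrt 2 / 2 * norm (V0 a - V0 b) \<le> 2 * rho" using assms(1) by simp
  then have "norm (V0 a - V0 b) \<le> 4 * rho / sqrt 2" by (simp add: field_simps)
  also have "\<dots> < 1" using sqrt2_bounds rho_bounds by (simp add: field_simps)
  finally have "norm (V0 a - V0 b) ^ 2 < 1 ^ 2" by (intro power_strict_mono) auto
  then have "(V0 a - V0 b) \<bullet> (V0 a - V0 b) < 1" by (simp add: power2_norm_eq_inner)
  then have lt: "1 / 2 < V0 a \<bullet> V0 (a + d)"
    unfolding b(2) by (simp add: inner_diff_left inner_diff_right V0_inner_0 inner_commute)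
  have "d = 0 \<or> d = 1 \<or> d = 7" using d(1)
    by (rule less8_cases) (use lt V0_inner_shift[of a] sqrt2_bounds in auto)
  then show ?thesis using b(1) assms(2) by auto
qed

lemma near_cousins:
  assumes "norm (V0 i + V0 (i + 1) + (sqrt 2 / 2) *\<^sub>R (V0 b - V0 a)) \<le> 2 * rho" "i < 8" "a < 8" "b < 8"
  shows "(a = i \<and> b = (i + 5) mod 8) \<or> (a = (i + 1) mod 8 \<and> b = (i + 4) mod 8)"
proof -
  obtain d where d: "d < 8" "a mod 8 = (i + d) mod 8" by (rule mod8_shift)
  have a: "a = (i + d) mod 8" "V0 a = V0 (i + d)" using d assms(3) V0_cong[OF d(2)] by simp_all
  obtain e where e: "e < 8" "b mod 8 = (i + e) mod 8" by (rule mod8_shift)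
  have b: "b = (i + e) mod 8" "V0 b = V0 (i + e)" using e assms(4) V0_cong[OF e(2)] by simp_all
  define W where "W = V0 i + V0 (i + 1) + (sqrt 2 / 2) *\<^sub>R (V0 b - V0 a)"
  have r2: "rho * rho = 3 / 2 - sqrt 2" by (simp add: rho_eq field_simps)
  have "W \<bullet> W \<le> (2 * rho) ^ 2"
    using assms(1) unfolding W_def[symmetric] power2_norm_eq_inner[symmetric] by (intro power_mono) auto
  then have WW: "W \<bullet> W \<le> 6 - 4 * sqrt 2" using r2 by (simp add: power2_eq_square)
  \<comment> \<open>\<open>W\<close> joins the centres of the two children, in units of the parents.
    Its component normal to the shared edge is small only if both children border that edge.\<close>
  have "(nf i W)\<^sup>2 \<le> (2 * kap) * (W \<bullet> W)"
    using Cauchy_Schwarz_ineq[of "V0 i + V0 (i + 1)" W] unfolding nf_def norm_edge_normal .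
  also have "\<dots> \<le> (2 * kap) * (6 - 4 * sqrt 2)"
    using WW kap_pos by (intro mult_left_mono) auto
  also have "\<dots> = 4 - 2 * sqrt 2" by (simp add: kap_def field_simps)
  \<comment> \<open>The constant 3/2 separates \<open>sqrt (4 - 2 * sqrt 2)\<close>, the largest
    value allowed here, from \<open>1 + sqrt 2 / 2\<close>, the smallest possible if one of the
    children is off the edge.\<close>
  also have "\<dots> < (3 / 2)\<^sup>2" using sqrt2_bounds by (simp add: power2_eq_square)
  finally have "nf i W < 3 / 2" using power2_less_imp_less by fastforce
  moreover have "nf i W = 2 * kap + (sqrt 2 / 2) * nf i (V0 b) - (sqrt 2 / 2) * nf i (V0 a)"
    unfolding W_def nf_linear nf_V0_all by (simp add: algebra_simps)
  ultimately have lt: "2 * kap + (sqrt 2 / 2) * nf i (V0 (i + e)) - (sqrt 2 / 2) * nf i (V0 (i + d)) < 3 / 2"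
    by (simp only: a(2) b(2))
  have k: "sqrt 2 / 2 * kap = 1 / 2 + sqrt 2 / 2" "sqrt 2 / 2 * (sqrt 2 / 2) = 1 / 2"
    by (simp_all add: kap_def field_simps)
  have eb: "sqrt 2 / 2 * nf i (V0 (i + e)) \<ge> - (1 / 2 + sqrt 2 / 2) \<and> (e = 4 \<or> e = 5 \<or> sqrt 2 / 2 * nf i (V0 (i + e)) \<ge> - (1 / 2))"
    using e(1) by (rule less8_cases)
      (simp_all only: add_0_right nf_V0_all k mult_minus_right, use sqrt2_bounds in auto)
  have db: "sqrt 2 / 2 * nf i (V0 (i + d)) \<le> 1 / 2 + sqrt 2 / 2 \<and> (d = 0 \<or> d = 1 \<or> sqrt 2 / 2 * nf i (V0 (i + d)) \<le> 1 / 2)"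
    using d(1) by (rule less8_cases)
      (simp_all only: add_0_right nf_V0_all k mult_minus_right, use sqrt2_bounds in auto)
  have de: "(d = 0 \<or> d = 1) \<and> (e = 4 \<or> e = 5)"
    using eb db lt sqrt2_bounds by (auto simp: kap_def)
  have i: "V0 i \<bullet> V0 i = 1" "V0 (i + 1) \<bullet> V0 (i + 1) = 1" "V0 i \<bullet> V0 (i + 1) = sqrt 2 / 2" "V0 (i + 1) \<bullet> V0 i = sqrt 2 / 2"
    using V0_inner_0 V0_inner_1[of i] by simp_all
  \<comment> \<open>The two diagonal pairs along the edge remain. Their squared distance
    \<open>2 - sqrt 2\<close> exceeds the permitted \<open>6 - 4 * sqrt 2\<close>.\<close>
  have "\<not> (d = 0 \<and> e = 4)"
  proof
    assume de: "d = 0 \<and> e = 4"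
    have "W = (1 - sqrt 2) *\<^sub>R V0 i + V0 (i + 1)"
      unfolding W_def a b using de by (simp add: V0_mod V0_shift algebra_simps flip: scaleR_2)
    then have "W \<bullet> W = 2 - sqrt 2"
      by (simp only: inner_add_left inner_add_right inner_scaleR_left inner_scaleR_right i) (simp add: algebra_simps)
    with WW sqrt2_bounds show False by simp
  qed
  moreover have "\<not> (d = 1 \<and> e = 5)"
  proof
    assume de: "d = 1 \<and> e = 5"
    have "W = V0 i + (1 - sqrt 2) *\<^sub>R V0 (i + 1)"
      unfolding W_def a b V0_mod using de V0_shift(2)[of i] by (simp add: algebra_simps flip: scaleR_2)
    then have "W \<bullet> W = 2 - sqrt 2"
      by (simp only: inner_add_left inner_add_right inner_scaleR_left inner_scaleR_right i) (simp add: algebra_simps)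
    with WW sqrt2_bounds show False by simp
  qed
  ultimately show ?thesis using de a(1) b(1) assms(2) by auto
qed

text \<open>The induction closes because \<open>2 * rho + sqrt 2 = 2\<close>: circumscribed discs that meet come from
  parents whose circumscribed discs meet.\<close>

lemma near_cells:
  assumes "u \<in> words m" "u' \<in> words m" "norm (centre u - centre u') \<le> 2 * rho ^ m"
  shows "u = u' \<or> (\<exists>i<8. shared u i \<and> partner u i = u')"
  using assms
proof (induction m arbitrary: u u')
  case 0
  then show ?case by (simp add: words_0)
next
  case (Suc m)
  obtain a v where u: "u = a # v" "a < 8" "v \<in> words m" using Suc.prems by (auto simp: words_Suc)
  obtain b v' where u': "u' = b # v'" "b < 8" "v' \<in> words m" using Suc.prems by (auto simp: words_Suc)
  note l = words_length[OF u(3)] words_length[OF u'(3)]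
  have pm: "rho ^ m > 0" using rho_pos by simp
  have diff: "centre u - centre u' = (centre v - centre v') + (rho ^ m * (sqrt 2 / 2)) *\<^sub>R (V0 a - V0 b)"
    by (simp add: u u' l algebra_simps)
  have "norm (V0 a - V0 b) \<le> 2" using norm_triangle_ineq4[of "V0 a" "V0 b"] by (simp add: norm_V0)
  then have "norm ((rho ^ m * (sqrt 2 / 2)) *\<^sub>R (V0 a - V0 b)) \<le> (rho ^ m * (sqrt 2 / 2)) * 2"
    using pm by (simp add: abs_mult)
  moreover have "norm (centre v - centre v') \<le> norm (centre u - centre u') + norm ((rho ^ m * (sqrt 2 / 2)) *\<^sub>R (V0 a - V0 b))"
    using norm_triangle_ineq4[of "centre u - centre u'" "(rho ^ m * (sqrt 2 / 2)) *\<^sub>R (V0 a - V0 b)"] unfolding diff by simp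
  ultimately have "norm (centre v - centre v') \<le> 2 * rho ^ Suc m + (rho ^ m * (sqrt 2 / 2)) * 2"
    using Suc.prems(3) by linarith
  also have "\<dots> = 2 * rho ^ m * (rho + sqrt 2 / 2)" by (simp add: algebra_simps)
  also have "\<dots> = 2 * rho ^ m" by (simp add: rho_eq)
  finally have "v = v' \<or> (\<exists>i<8. shared v i \<and> partner v i = v')" using Suc.IH u(3) u'(3) by blast
  then show ?case
  proof
    assume v: "v = v'"
    have "norm (centre u - centre u') = rho ^ m * norm ((sqrt 2 / 2) *\<^sub>R (V0 a - V0 b))"
      unfolding diff v using pm by (simp add: abs_mult)
    then have "rho ^ m * norm ((sqrt 2 / 2) *\<^sub>R (V0 a - V0 b)) \<le> rho ^ m * (2 * rho)"
      using Suc.prems(3) by (simp only: power_Suc mult_ac)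
    then have "norm ((sqrt 2 / 2) *\<^sub>R (V0 a - V0 b)) \<le> 2 * rho"
      using pm by (simp only: mult_le_cancel_left_pos)
    then consider "b = a" | "b = (a + 1) mod 8" | "b = (a + 7) mod 8"
      using near_children u(2) u'(2) by blast
    then show ?thesis
    proof cases
      case 2
      have "((a + 2) mod 8 + 8 - a) mod 8 = 2" using u(2) by (rule less8_cases) simp_all
      then have "shared u ((a + 2) mod 8) \<and> partner u ((a + 2) mod 8) = u'"
        unfolding u u' v 2 by (simp only: shared.simps partner.simps Let_def) simp
      then show ?thesis by (metis mod_less_divisor zero_less_numeral)
    next
      case 3
      have "((a + 5) mod 8 + 8 - a) mod 8 = 5" using u(2) by (rule less8_cases) simp_all
      then have "shared u ((a + 5) mod 8) \<and> partner u ((a + 5) mod 8) = u'"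
        unfolding u u' v 3 by (simp only: shared.simps partner.simps Let_def) simp
      then show ?thesis by (metis mod_less_divisor zero_less_numeral)
    qed (use u u' v in simp)
  next
    assume "\<exists>i<8. shared v i \<and> partner v i = v'"
    then obtain i where i: "i < 8" "shared v i" "partner v i = v'" by blast
    have "centre u' - centre u = rho ^ m *\<^sub>R (V0 i + V0 (i + 1) + (sqrt 2 / 2) *\<^sub>R (V0 b - V0 a))"
      using diff shared_centre[OF u(3) i(1,2)] unfolding i(3) by (simp add: algebra_simps)
    then have "norm (centre u - centre u') = rho ^ m * norm (V0 i + V0 (i + 1) + (sqrt 2 / 2) *\<^sub>R (V0 b - V0 a))"
      using pm by (simp add: norm_minus_commute)
    then have "rho ^ m * norm (V0 i + V0 (i + 1) + (sqrt 2 / 2) *\<^sub>R (V0 b - V0 a)) \<le> rho ^ m * (2 * rho)"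
      using Suc.prems(3) by (simp only: power_Suc mult_ac)
    then have "norm (V0 i + V0 (i + 1) + (sqrt 2 / 2) *\<^sub>R (V0 b - V0 a)) \<le> 2 * rho"
      using pm by (simp only: mult_le_cancel_left_pos)
    then consider "a = i" "b = (i + 5) mod 8" | "a = (i + 1) mod 8" "b = (i + 4) mod 8"
      using near_cousins u(2) u'(2) i(1) by blast
    then have "shared u i \<and> partner u i = u'"
    proof cases
      case 1
      then show ?thesis unfolding u u' i(3)[symmetric] using i by (simp add: Let_def)
    next
      case 2
      have "(i + 8 - (i + 1) mod 8) mod 8 = 7" "((i + 1) mod 8 + 3) mod 8 = (i + 4) mod 8"
        using i(1) by (rule less8_cases; simp)+
      then show ?thesis unfolding u u' i(3)[symmetric] 2 using i(2) by (simp only: shared.simps partner.simps Let_def) simp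
    qed
    with i(1) show ?thesis by blast
  qed
qed

text \<open>A common point makes the circumscribed discs meet, so by \<open>near_cells\<close> the
  cells share an edge \<open>j\<close>. The two values of the functionals normal to that edge add up
  to \<open>2 * kap\<close> and neither exceeds \<open>kap\<close>, so the point lies on the edge.
  In particular, cells never touch at a corner alone.\<close>

lemma common_point:
  assumes "u \<in> words m" "u' \<in> words m" "u \<noteq> u'" "place u x = place u' y" "x \<in> octagon" "y \<in> octagon"
  obtains j where "j < 8" "shared u j" "partner u j = u'" "y = x - (V0 j + V0 (j + 1))"
    "nf j x = kap" "nf (opposite j) y = kap"
proof -
  note l = words_length[OF assms(1)] words_length[OF assms(2)]
  have pm: "rho ^ m > 0" using rho_pos by simp
  have e: "centre u - centre u' = rho ^ m *\<^sub>R (y - x)" using assms(4) by (simp add: place_def l algebra_simps)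
  have "norm (y - x) \<le> 2"
    using norm_triangle_ineq4[of y x] octagon_norm[OF assms(5)] octagon_norm[OF assms(6)] by linarith
  then have "norm (centre u - centre u') \<le> 2 * rho ^ m" unfolding e using pm by simp
  then obtain j where j: "j < 8" "shared u j" "partner u j = u'" using near_cells assms(1-3) by blast
  have "rho ^ m *\<^sub>R (y - x) = rho ^ m *\<^sub>R (- (V0 j + V0 (j + 1)))"
    using e shared_centre[OF assms(1) j(1,2)] unfolding j(3) by (simp add: algebra_simps)
  then have "y - x = - (V0 j + V0 (j + 1))" using pm by (simp only: scaleR_cancel_left) (use rho_pos in auto)
  then have y: "y = x - (V0 j + V0 (j + 1))" by (simp add: algebra_simps)
  have o: "nf (opposite j) = nf (j + 4)" unfolding opposite_def by (rule nf_mod)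
  have "nf (opposite j) y = 2 * kap - nf j x"
    unfolding o y nf_linear nf_shift nf_V0_all by simp
  moreover have "nf (opposite j) y \<le> kap" "nf j x \<le> kap" using assms(5,6) octagon_iff by auto
  ultimately show thesis using that[OF j y] by linarith
qed

text \<open>Translation by the edge normal passes to the coordinates of the neighbouring cell. The
  open base of a triangle is thus also the open base of the triangle across a shared edge, along
  which the two merge.\<close>

lemma Tri_opposite:
  assumes "x \<in> Tri i" "nf i x = kap"
  shows "x - (V0 i + V0 (i + 1)) \<in> Tri (opposite i)"
proof -
  have o: "Tri (opposite i) = Tri (i + 4)" unfolding opposite_def by (rule Tri_cong) simp
  have e: "i + 4 + 1 = i + 5" "i + 4 + 3 = i + 7" by simp_all
  have "nf (i + 1) x < sqrt 2" "nf (i + 3) x > - sqrt 2"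
    using assms nf_rels(1)[of i x] sqrt2_kap by (auto simp: Tri_def)
  then show ?thesis
    unfolding o unfolding Tri_def mem_Collect_eq e nf_shift nf_linear nf_V0 nf_V0_Suc assms(2) by (auto simp: kap_def)
qed

lemma Tri_nf_kap: "x \<in> Tri i \<Longrightarrow> nf j x = kap \<Longrightarrow> i < 8 \<Longrightarrow> j < 8 \<Longrightarrow> i = j"
proof -
  assume a: "x \<in> Tri i" "nf j x = kap" "i < 8" "j < 8"
  obtain d where d: "d < 8" "j mod 8 = (i + d) mod 8" by (rule mod8_shift)
  have k: "nf (i + d) x = kap" using a(2) nf_cong[OF d(2)] by simp
  have "d = 0" using d(1)
    by (rule less8_cases) (use k Tri_bounds[OF a(1)] kap_bounds nf_shift[of i x] in auto)
  then show "i = j" using d a by simp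
qed

section \<open>The holes\<close>

declare shared.simps(2) [simp del] partner.simps(2) [simp del] gap_hole.simps(2) [simp del]

definition tri_of :: "nat list \<Rightarrow> nat \<Rightarrow> (real \<times> real) set" where "tri_of u i = place u ` Tri i"
definition side_of :: "nat list \<Rightarrow> nat \<Rightarrow> (real \<times> real) set" where "side_of u i = place u ` side i"
definition star_of :: "nat list \<Rightarrow> (real \<times> real) set" where "star_of u = place u ` Star"

lemma cell_of_Cons: "cell_of (a # u) = place u ` F a ` octagon"
  by (simp add: cell_of_def place_Cons_image)

lemma cell_of_Cons_subset: "cell_of (a # u) \<subseteq> cell_of u"
  unfolding cell_of_def place_Cons_image by (rule image_mono[OF child_subset_octagon])

lemma tri_of_subset_cell_of: "tri_of u i \<subseteq> cell_of u"
  unfolding tri_of_def cell_of_def using Tri_subset_octagon by (rule image_mono)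

lemma star_of_subset_cell_of: "star_of u \<subseteq> cell_of u"
  unfolding star_of_def cell_of_def using Star_subset_octagon by (rule image_mono)

lemma side_of_subset_cell_of: "side_of u i \<subseteq> cell_of u"
  unfolding side_of_def cell_of_def by (rule image_mono) (auto simp: side_iff)

lemma cell_of_cover: "cell_of u \<subseteq> (\<Union>a<8. cell_of (a # u)) \<union> star_of u \<union> (\<Union>i<8. tri_of u i)"
proof
  fix p assume "p \<in> cell_of u"
  then obtain x where x: "x \<in> octagon" "p = place u x" by (auto simp: cell_of_def)
  from octagon_cover[OF x(1)] show "p \<in> (\<Union>a<8. cell_of (a # u)) \<union> star_of u \<union> (\<Union>i<8. tri_of u i)"
    unfolding cell_of_Cons star_of_def tri_of_def x(2) by (auto simp: place_image_iff)
qed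

lemma images_meet: "f ` A \<inter> g ` rim_of \<noteq> {} \<Longrightarrow> \<exists>x y. f x = g y \<and> x \<in> A \<and> y \<in> rim_of"
  by force

text \<open>Children of the same cell avoid the triangle. Another cell can meet it only in its base,
  and there the point belongs to that cell's own triangle, which its children avoid as well.\<close>

lemma tri_of_avoid:
  assumes "u \<in> words m" "i < 8" "v \<in> words (Suc m)"
  shows "tri_of u i \<inter> cell_of v = {}"
proof (rule ccontr)
  assume ne: "tri_of u i \<inter> cell_of v \<noteq> {}"
  obtain a w where v: "v = a # w" "w \<in> words m" using assms(3) by (auto simp: words_Suc)
  obtain x y where xy: "place u x = place w y" "x \<in> Tri i" "y \<in> F a ` octagon"
    using images_meet ne[unfolded tri_of_def v(1) cell_of_Cons] by metis
  show False
  proof (cases "u = w")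
    case True
    then show False using xy Tri_child_disjoint by (auto simp: place_eq_iff)
  next
    case False
    obtain j where j: "j < 8" "shared u j" "partner u j = w" "y = x - (V0 j + V0 (j + 1))"
        "nf j x = kap" "nf (opposite j) y = kap"
      by (rule common_point[OF assms(1) v(2) False xy(1) subsetD[OF Tri_subset_octagon xy(2)] subsetD[OF child_subset_octagon xy(3)]])
    have "i = j" by (rule Tri_nf_kap[OF xy(2) j(5) assms(2) j(1)])
    then have "y \<in> Tri (opposite i)" using Tri_opposite[OF xy(2)] j by simp
    then show False using xy(3) Tri_child_disjoint by blast
  qed
qed

lemma star_of_avoid:
  assumes "u \<in> words m" "v \<in> words (Suc m)"
  shows "star_of u \<inter> cell_of v = {}"
proof (rule ccontr)
  assume ne: "star_of u \<inter> cell_of v \<noteq> {}"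
  obtain a w where v: "v = a # w" "w \<in> words m" using assms(2) by (auto simp: words_Suc)
  obtain x y where xy: "place u x = place w y" "x \<in> Star" "y \<in> F a ` octagon"
    using images_meet ne[unfolded star_of_def v(1) cell_of_Cons] by metis
  show False
  proof (cases "u = w")
    case True
    then show False using xy Star_child_disjoint by (auto simp: place_eq_iff)
  next
    case False
    obtain j where j: "j < 8" "shared u j" "partner u j = w" "y = x - (V0 j + V0 (j + 1))"
        "nf j x = kap" "nf (opposite j) y = kap"
      by (rule common_point[OF assms(1) v(2) False xy(1) subsetD[OF Star_subset_octagon xy(2)] subsetD[OF child_subset_octagon xy(3)]])
    show False using Star_less1[OF xy(2), of j] j(5) kap_bounds by simp
  qed
qed

lemma tri_of_meet:
  assumes "u \<in> words m" "i < 8" "v \<in> words m" "k < 8" "p \<in> tri_of u i" "p \<in> tri_of v k"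
  shows "gap_hole u i = gap_hole v k"
proof -
  obtain x y where xy: "place u x = place v y" "x \<in> Tri i" "y \<in> Tri k"
    using images_meet[of "place u" "Tri i" "place v" "Tri k"] assms(5,6) unfolding tri_of_def by blast
  show ?thesis
  proof (cases "u = v")
    case True
    then have "x \<in> Tri k" using xy by (simp add: place_eq_iff)
    then show ?thesis using True Tri_unique[OF xy(2) _ assms(2,4)] by simp
  next
    case False
    obtain j where j: "j < 8" "shared u j" "partner u j = v" "y = x - (V0 j + V0 (j + 1))"
        "nf j x = kap" "nf (opposite j) y = kap"
      by (rule common_point[OF assms(1,3) False xy(1) subsetD[OF Tri_subset_octagon xy(2)] subsetD[OF Tri_subset_octagon xy(3)]])
    have "i = j" "k = opposite j"
      using Tri_nf_kap[OF xy(2) j(5) assms(2) j(1)] Tri_nf_kap[OF xy(3) j(6) assms(4) opposite_less] by auto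
    then show ?thesis using gap_hole_partner[OF assms(1,2)] j by simp
  qed
qed

lemma tri_of_star_of_disjoint:
  assumes "u \<in> words m" "i < 8" "v \<in> words m"
  shows "tri_of u i \<inter> star_of v = {}"
proof (rule ccontr)
  assume "tri_of u i \<inter> star_of v \<noteq> {}"
  then have "star_of v \<inter> tri_of u i \<noteq> {}" by blast
  then obtain x y where xy: "place v y = place u x" "x \<in> Tri i" "y \<in> Star"
    unfolding tri_of_def star_of_def using images_meet by metis
  show False
  proof (cases "v = u")
    case True
    then show ?thesis using xy Star_Tri_disjoint by (auto simp: place_eq_iff)
  next
    case False
    obtain j where j: "j < 8" "shared v j" "partner v j = u" "x = y - (V0 j + V0 (j + 1))"
        "nf j y = kap" "nf (opposite j) x = kap"
      by (rule common_point[OF assms(3,1) False xy(1) subsetD[OF Star_subset_octagon xy(3)] subsetD[OF Tri_subset_octagon xy(2)]])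
    show False using Star_less1[OF xy(3), of j] j(5) kap_bounds by simp
  qed
qed

lemma star_of_meet:
  assumes "u \<in> words m" "v \<in> words m" "p \<in> star_of u" "p \<in> star_of v"
  shows "u = v"
proof (rule ccontr)
  assume ne: "u \<noteq> v"
  obtain x y where xy: "place u x = place v y" "x \<in> Star" "y \<in> Star"
    using images_meet[of "place u" Star "place v" Star] assms(3,4) unfolding star_of_def by blast
  obtain j where j: "j < 8" "shared u j" "partner u j = v" "y = x - (V0 j + V0 (j + 1))"
      "nf j x = kap" "nf (opposite j) y = kap"
    by (rule common_point[OF assms(1,2) ne xy(1) subsetD[OF Star_subset_octagon xy(2)] subsetD[OF Star_subset_octagon xy(3)]])
  show False using Star_less1[OF xy(2), of j] j(5) kap_bounds by simp
qed

text \<open>The part of the hole named \<open>h\<close> that is present at level \<open>m\<close>; it is empty before the hole is born.\<close>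

primrec hole_of :: "nat \<Rightarrow> hole_id \<Rightarrow> (real \<times> real) set" where
  "hole_of 0 h = (if h = Outer then - octagon else {})"
| "hole_of (Suc m) h = hole_of m h \<union> (\<Union>(u, i)\<in>{(u, i). u \<in> words m \<and> i < 8 \<and> gap_hole u i = h}. tri_of u i) \<union>
     (\<Union>u\<in>{u \<in> words m. Central u = h}. star_of u)"

section \<open>The holes partition the complement of \<open>O_level m\<close>\<close>

lemma finite_words: "finite (words m)"
proof -
  have "words m = {xs. set xs \<subseteq> {..<8} \<and> length xs = m}" by (auto simp: words_def)
  then show ?thesis by (simp add: finite_lists_length_eq)
qed

lemma O_level_0: "O_level 0 = octagon" by (simp add: O_level_eq words_0 cell_of_def place_Nil)

lemma O_level_Suc: "O_level (Suc m) = (\<Union>u\<in>words m. \<Union>a<8. cell_of (a # u))"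
  unfolding O_level_eq by (rule set_eqI, simp only: UN_iff words_Suc lessThan_iff Bex_def) blast

lemma O_level_mono: "O_level (Suc m) \<subseteq> O_level m"
  unfolding O_level_Suc unfolding O_level_eq using cell_of_Cons_subset by blast

lemma tri_of_subset_O_level: "u \<in> words m \<Longrightarrow> tri_of u i \<subseteq> O_level m"
  unfolding O_level_eq using tri_of_subset_cell_of by blast

lemma star_of_subset_O_level: "u \<in> words m \<Longrightarrow> star_of u \<subseteq> O_level m"
  unfolding O_level_eq using star_of_subset_cell_of by blast

lemma hole_of_subset: "hole_of m h \<subseteq> - O_level m"
proof (induction m)
  case 0
  then show ?case by (simp add: O_level_0)
next
  case (Suc m)
  have "tri_of u i \<subseteq> - O_level (Suc m)" if "u \<in> words m" "i < 8" for u i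
    using tri_of_avoid[OF that] unfolding O_level_eq by blast
  moreover have "star_of u \<subseteq> - O_level (Suc m)" if "u \<in> words m" for u
    using star_of_avoid[OF that] unfolding O_level_eq by blast
  moreover have "hole_of m h \<subseteq> - O_level (Suc m)" using Suc O_level_mono[of m] by blast
  ultimately show ?case unfolding hole_of.simps
    by (intro Un_least UN_least; clarsimp; blast)
qed

lemma hole_of_cover: "x \<notin> O_level m \<Longrightarrow> \<exists>h. x \<in> hole_of m h"
proof (induction m)
  case 0
  then show ?case by (auto simp: O_level_0)
next
  case (Suc m)
  show ?case
  proof (cases "x \<in> O_level m")
    case False
    then show ?thesis using Suc.IH by auto
  next
    case True
    then obtain u where u: "u \<in> words m" "x \<in> cell_of u" by (auto simp: O_level_eq)
    have "x \<notin> (\<Union>a<8. cell_of (a # u))" using Suc.prems u by (auto simp: O_level_Suc)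
    then consider "x \<in> star_of u" | i where "i < 8" "x \<in> tri_of u i" using cell_of_cover u(2) by blast
    then show ?thesis
    proof cases
      case 1
      then have "x \<in> hole_of (Suc m) (Central u)" using u by auto
      then show ?thesis ..
    next
      case 2
      then have "x \<in> hole_of (Suc m) (gap_hole u i)" using u by auto
      then show ?thesis ..
    qed
  qed
qed

lemma gap_hole_not_Central: "u \<in> words m \<Longrightarrow> v \<in> words m \<Longrightarrow> gap_hole u i \<noteq> Central v"
  using gap_hole_Central_level words_length by (metis less_irrefl)

text \<open>A point outside \<open>O_level m\<close> lies only in an old part, where the induction
  hypothesis applies; a point inside lies in triangles or stars of level \<open>m\<close>, and those
  that overlap carry the same name.\<close>

lemma hole_of_disjoint: "x \<in> hole_of m h \<Longrightarrow> x \<in> hole_of m h' \<Longrightarrow> h = h'"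
proof (induction m)
  case 0
  then show ?case by (auto split: if_splits)
next
  case (Suc m)
  have cases: "x \<in> hole_of m g \<and> x \<notin> O_level m \<or>
     x \<in> O_level m \<and> ((\<exists>u i. u \<in> words m \<and> i < 8 \<and> gap_hole u i = g \<and> x \<in> tri_of u i) \<or> (\<exists>u\<in>words m. Central u = g \<and> x \<in> star_of u))"
    if "x \<in> hole_of (Suc m) g" for g
    using that hole_of_subset[of m g] tri_of_subset_O_level[of _ m] star_of_subset_O_level[of _ m] by auto blast+
  from cases[OF Suc.prems(1)] cases[OF Suc.prems(2)] show ?case
    using Suc.IH tri_of_meet[of _ m _ _ _ x] star_of_meet[of _ m _ x] tri_of_star_of_disjoint[of _ m] by (elim disjE) (blast | metis disjoint_iff)+
qed

text \<open>The boundary of the hole at level \<open>m\<close>, as \<open>closure_hole_of\<close>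
  shows. Shared edges are excluded because the square hole that \<open>gap_hole\<close> assigns to
  them is born only at the next level.\<close>

definition rim_of :: "nat \<Rightarrow> hole_id \<Rightarrow> (real \<times> real) set" where
  "rim_of m h = (\<Union>(u, i)\<in>{(u, i). u \<in> words m \<and> i < 8 \<and> \<not> shared u i \<and> gap_hole u i = h}. side_of u i)"

lemma closure_place_image: "closure (place u ` S) = place u ` closure S"
proof -
  have e: "place u ` X = (+) (centre u) ` (*\<^sub>R) (rho ^ length u) ` X" for X
    by (simp add: image_image place_def)
  show ?thesis unfolding e by (simp add: closure_translation closure_scaleR)
qed

lemma closure_finite_UN: "finite A \<Longrightarrow> closure (\<Union>x\<in>A. S x) = (\<Union>x\<in>A. closure (S x))"
  by (induction A rule: finite_induct) simp_all

text \<open>The refinement rule for rims: outer child edges inherit the hole of the parent edge,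
  legs of the triangle face the hole that absorbs it, and inner edges face the star.\<close>

lemma child_edge_id:
  assumes "i < 8"
  shows "shared (i # u) i = shared u i" "\<not> shared u i \<Longrightarrow> gap_hole (i # u) i = gap_hole u i"
    "shared (((i + 1) mod 8) # u) i = shared u i" "\<not> shared u i \<Longrightarrow> gap_hole (((i + 1) mod 8) # u) i = gap_hole u i"
    "\<not> shared (i # u) ((i + 1) mod 8)" "gap_hole (i # u) ((i + 1) mod 8) = gap_hole u i"
    "\<not> shared (((i + 1) mod 8) # u) ((i + 7) mod 8)" "gap_hole (((i + 1) mod 8) # u) ((i + 7) mod 8) = gap_hole u i"
    "\<not> shared (i # u) ((i + 3) mod 8)" "gap_hole (i # u) ((i + 3) mod 8) = Central u"
    "\<not> shared (i # u) ((i + 4) mod 8)" "gap_hole (i # u) ((i + 4) mod 8) = Central u"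
proof -
  have m: "(i + 8 - i) mod 8 = 0" "(i + 8 - (i + 1) mod 8) mod 8 = 7" "((i + 1) mod 8 + 8 - i) mod 8 = 1"
    "((i + 7) mod 8 + 8 - (i + 1) mod 8) mod 8 = 6" "((i + 3) mod 8 + 8 - i) mod 8 = 3"
    "((i + 4) mod 8 + 8 - i) mod 8 = 4" "((i + 7) mod 8 + 1) mod 8 = i"
    using assms by - (rule less8_cases[OF assms], simp_all)+
  show "shared (i # u) i = shared u i" "shared (((i + 1) mod 8) # u) i = shared u i"
    "\<not> shared (i # u) ((i + 1) mod 8)" "\<not> shared (((i + 1) mod 8) # u) ((i + 7) mod 8)"
    "\<not> shared (i # u) ((i + 3) mod 8)" "\<not> shared (i # u) ((i + 4) mod 8)"
    unfolding shared.simps Let_def m by simp_all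
  then show "\<not> shared u i \<Longrightarrow> gap_hole (i # u) i = gap_hole u i" "\<not> shared u i \<Longrightarrow> gap_hole (((i + 1) mod 8) # u) i = gap_hole u i"
    "gap_hole (i # u) ((i + 1) mod 8) = gap_hole u i" "gap_hole (((i + 1) mod 8) # u) ((i + 7) mod 8) = gap_hole u i"
    "gap_hole (i # u) ((i + 3) mod 8) = Central u" "gap_hole (i # u) ((i + 4) mod 8) = Central u"
    unfolding gap_hole.simps Let_def m by simp_all
qed

lemma side_of_children:
  "side_of u i \<subseteq> side_of (i # u) i \<union> side_of (((i + 1) mod 8) # u) i \<union> tri_of u i"
  "side_of (i # u) i \<subseteq> side_of u i" "side_of (((i + 1) mod 8) # u) i \<subseteq> side_of u i"
  unfolding side_of_def tri_of_def place_Cons_image F_mod image_Un[symmetric]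
  by (intro image_mono side_subset child_side_subset)+

lemma side_mod: "side (n mod 8) = side n" by (rule side_cong) simp

lemma octagon_not_interior:
  assumes "x \<in> octagon" "x \<notin> interior octagon"
  obtains i where "i < 8" "x \<in> side i"
proof -
  have "\<exists>i. nf i x = kap"
  proof (rule ccontr)
    assume "\<nexists>i. nf i x = kap"
    then have lt: "\<forall>i. nf i x < kap" using assms(1) octagon_iff less_le by metis
    have "open (\<Inter>i\<in>{..<8}. {x. nf i x < kap})"
      by (intro open_INT) (auto simp: nf_def open_halfspace_lt)
    moreover have "x \<in> (\<Inter>i\<in>{..<8}. {x. nf i x < kap})" using lt by auto
    moreover have "(\<Inter>i\<in>{..<8}. {x. nf i x < kap}) \<subseteq> octagon"
    proof
      fix y assume y: "y \<in> (\<Inter>i\<in>{..<8}. {x. nf i x < kap})"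
      have "nf i y \<le> kap" for i
        using y nf_mod[of i] by (metis INT_E less_imp_le lessThan_iff mem_Collect_eq mod_less_divisor zero_less_numeral)
      then show "y \<in> octagon" by (simp add: octagon_iff)
    qed
    ultimately have "x \<in> interior octagon" by (meson interiorI)
    then show False using assms(2) by blast
  qed
  then obtain i where "x \<in> side i" using assms(1) side_iff by blast
  then have "x \<in> side (i mod 8)" by (simp only: side_mod)
  then show thesis using that by (metis mod_less_divisor zero_less_numeral)
qed

lemma closure_tri_of:
  "closure (tri_of u i) = tri_of u i \<union> side_of (i # u) ((i + 1) mod 8) \<union> side_of (((i + 1) mod 8) # u) ((i + 7) mod 8)"
  unfolding side_of_def tri_of_def place_Cons_image F_mod side_mod image_Un[symmetric] closure_place_image closure_Tri ..

lemma closure_star_of: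
  "closure (star_of u) = star_of u \<union> (\<Union>a<8. side_of (a # u) ((a + 3) mod 8) \<union> side_of (a # u) ((a + 4) mod 8))"
  unfolding side_of_def star_of_def place_Cons_image side_mod closure_place_image closure_Star by auto

lemma side_of_subset_rim_of:
  "u \<in> words m \<Longrightarrow> i < 8 \<Longrightarrow> \<not> shared u i \<Longrightarrow> gap_hole u i = h \<Longrightarrow> side_of u i \<subseteq> rim_of m h"
  by (auto simp: rim_of_def)

text \<open>In passing to the next level, each rim edge splits into two child edges, which stay on
  the rim, and the base of an absorbed triangle, whose legs join the rim. A newborn star contributes
  the inner edges of the children. Closure commutes with these unions because they are
  finite.\<close>

lemma closure_hole_of: "closure (hole_of m h) = hole_of m h \<union> rim_of m h"
proof (induction m)
  case 0
  show ?case
  proof (cases "h = Outer")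
    case True
    have rim: "rim_of 0 h = (\<Union>i<8. side i)" unfolding rim_of_def True side_of_def by (auto simp: words_0 place_Nil)
    have "closure (- octagon) = - octagon \<union> (\<Union>i<8. side i)"
    proof (intro equalityI subsetI)
      fix x assume x: "x \<in> closure (- octagon)"
      show "x \<in> - octagon \<union> (\<Union>i<8. side i)"
      proof (cases "x \<in> octagon")
        case True
        moreover have "x \<notin> interior octagon" using x by (simp add: closure_complement)
        ultimately obtain i where "i < 8" "x \<in> side i" by (rule octagon_not_interior)
        then show ?thesis by blast
      qed simp
    next
      fix x assume "x \<in> - octagon \<union> (\<Union>i<8. side i)"
      then consider "x \<in> - octagon" | i where "x \<in> side i" by blast
      then show "x \<in> closure (- octagon)"
      proof cases
        case 1
        then show ?thesis by (rule subsetD[OF closure_subset])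
      next
        case 2
        then have n: "nf i x = kap" by (simp add: side_iff)
        have out: "c *\<^sub>R x \<notin> octagon" if "c > 1" for c
        proof -
          have "nf i (c *\<^sub>R x) > kap" using that kap_pos by (simp add: nf_linear n)
          then show ?thesis using octagon_iff by (metis not_le)
        qed
        show ?thesis
        proof (rule closure_radial[of "2 *\<^sub>R x"])
          show "2 *\<^sub>R x \<in> - octagon" using out[of 2] by simp
          fix t :: real assume "0 < t"
          then show "(1 - t) *\<^sub>R x + t *\<^sub>R 2 *\<^sub>R x \<in> - octagon"
            using out[of "1 + t"] by (simp add: scaleR_left_distrib[symmetric] add.commute)
        qed
      qed
    qed
    then show ?thesis using rim True by simp
  next
    case False
    then show ?thesis by (auto simp: rim_of_def words_0)
  qed
next
  case (Suc m)
  let ?TI = "{(u, i). u \<in> words m \<and> i < 8 \<and> gap_hole u i = h}"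
  let ?CI = "{u \<in> words m. Central u = h}"
  have "?TI \<subseteq> words m \<times> {..<8}" by auto
  then have fin: "finite ?TI" "finite ?CI" using finite_words by (auto intro: finite_subset)
  have cl: "closure (hole_of (Suc m) h) = hole_of m h \<union> rim_of m h \<union> (\<Union>(u, i)\<in>?TI. closure (tri_of u i)) \<union> (\<Union>u\<in>?CI. closure (star_of u))"
    using fin by (simp add: Suc closure_finite_UN case_prod_unfold del: Un_iff)
  show ?case
  proof (intro equalityI)
    have 1: "side_of u i \<subseteq> hole_of (Suc m) h \<union> rim_of (Suc m) h"
      if "u \<in> words m" "i < 8" "\<not> shared u i" "gap_hole u i = h" for u i
    proof -
      have "side_of (i # u) i \<subseteq> rim_of (Suc m) h" "side_of (((i + 1) mod 8) # u) i \<subseteq> rim_of (Suc m) h"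
        by (rule side_of_subset_rim_of; use that child_edge_id[OF that(2), of u] in simp)+
      moreover have "tri_of u i \<subseteq> hole_of (Suc m) h" using that by auto
      ultimately show ?thesis using side_of_children(1)[of u i] by blast
    qed
    have 2: "closure (tri_of u i) \<subseteq> hole_of (Suc m) h \<union> rim_of (Suc m) h"
      if "u \<in> words m" "i < 8" "gap_hole u i = h" for u i
    proof -
      have "side_of (i # u) ((i + 1) mod 8) \<subseteq> rim_of (Suc m) h" "side_of (((i + 1) mod 8) # u) ((i + 7) mod 8) \<subseteq> rim_of (Suc m) h"
        by (rule side_of_subset_rim_of; use that child_edge_id[OF that(2), of u] in simp)+
      moreover have "tri_of u i \<subseteq> hole_of (Suc m) h" using that by auto
      ultimately show ?thesis unfolding closure_tri_of by blast
    qed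
    have 3: "closure (star_of u) \<subseteq> hole_of (Suc m) h \<union> rim_of (Suc m) h"
      if "u \<in> words m" "Central u = h" for u
    proof -
      have "side_of (a # u) ((a + 3) mod 8) \<subseteq> rim_of (Suc m) h \<and> side_of (a # u) ((a + 4) mod 8) \<subseteq> rim_of (Suc m) h" if "a < 8" for a
        by (intro conjI; rule side_of_subset_rim_of; use \<open>u \<in> words m\<close> \<open>Central u = h\<close> that child_edge_id[OF that, of u] in simp)
      moreover have "star_of u \<subseteq> hole_of (Suc m) h" using that by auto
      ultimately show ?thesis unfolding closure_star_of by blast
    qed
    have "rim_of m h \<subseteq> hole_of (Suc m) h \<union> rim_of (Suc m) h"
      unfolding rim_of_def[of m] using 1 by blast
    moreover have "hole_of m h \<subseteq> hole_of (Suc m) h" by auto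
    ultimately show "closure (hole_of (Suc m) h) \<subseteq> hole_of (Suc m) h \<union> rim_of (Suc m) h"
      unfolding cl using 2 3 by blast
  next
    \<comment> \<open>Conversely, the position \<open>d\<close> of a rim edge tells which part it
      bounds: the old hole for 0 and 7, a triangle for 1 and 6, the star for 3 and 4. Positions 2
      and 5 are shared.\<close>
    have "side_of w j \<subseteq> closure (hole_of (Suc m) h)"
      if w: "w \<in> words (Suc m)" "j < 8" "\<not> shared w j" "gap_hole w j = h" for w j
    proof -
      obtain b u where u: "w = b # u" "b < 8" "u \<in> words m" using w(1) by (auto simp: words_Suc)
      define d where "d = (j + 8 - b) mod 8"
      have "d < 8" by (simp add: d_def)
      have parent: ?thesis if "side_of w j \<subseteq> side_of u j" "\<not> shared u j" "gap_hole u j = h"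
      proof -
        have "side_of u j \<subseteq> rim_of m h" unfolding rim_of_def using that u w by blast
        then show ?thesis unfolding cl using that by blast
      qed
      have tri: ?thesis if "side_of w j \<subseteq> closure (tri_of u i)" "i < 8" "gap_hole u i = h" for i
        unfolding cl using that u by blast
      have cen: ?thesis if "side_of w j \<subseteq> closure (star_of u)" "Central u = h"
        unfolding cl using that u by blast
      have j: "j = (b + d) mod 8" unfolding d_def by (rule edge_index) fact+
      note e = w(3,4)[unfolded u(1) shared.simps gap_hole.simps Let_def d_def[symmetric]]
      consider "d = 0" | "d = 1" | "d = 3 \<or> d = 4" | "d = 6" | "d = 7"
        using \<open>d < 8\<close> by (rule less8_cases) (use e in auto)
      then show ?thesis
      proof cases
        case 1
        then have "b = j" using j u by simp
        then show ?thesis using parent side_of_children(2) e u 1 by auto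
      next
        case 2
        then show ?thesis using tri[of b] closure_tri_of[of u b] e u j by auto
      next
        case 3
        then have "side_of w j \<subseteq> closure (star_of u)" unfolding closure_star_of u(1) j using u(2) by blast
        moreover have "Central u = h" using e 3 by auto
        ultimately show ?thesis by (rule cen)
      next
        case 4
        define i where "i = (j + 1) mod 8"
        have ib: "b = (i + 1) mod 8" "j = (i + 7) mod 8" unfolding i_def j 4
          by (rule less8_cases[OF u(2)]; simp)+
        have "side_of w j \<subseteq> closure (tri_of u i)" unfolding closure_tri_of u(1) by (simp only: ib) blast
        moreover have "i < 8" "gap_hole u i = h" using e 4 by (simp_all add: i_def)
        ultimately show ?thesis by (rule tri)
      next
        case 5
        have "b = (j + 1) mod 8" unfolding j 5 using u(2) by (rule less8_cases; simp)
        then show ?thesis using parent side_of_children(3)[of j u] e u 5 by auto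
      qed
    qed
    then have "rim_of (Suc m) h \<subseteq> closure (hole_of (Suc m) h)" unfolding rim_of_def by blast
    then show "hole_of (Suc m) h \<union> rim_of (Suc m) h \<subseteq> closure (hole_of (Suc m) h)"
      using closure_subset by blast
  qed
qed

section \<open>Connectedness of the holes\<close>

lemma connected_Un_closure:
  assumes "connected S" "connected U" "closure S \<inter> U \<noteq> {}"
  shows "connected (S \<union> U)"
proof -
  obtain x where x: "x \<in> closure S" "x \<in> U" using assms(3) by blast
  have "connected (insert x S)"
    by (rule connected_intermediate_closure[OF assms(1)]) (use x closure_subset in auto)
  then have "connected (insert x S \<union> U)"
    using x by (intro connected_Un assms(2)) auto
  moreover have "insert x S \<union> U = S \<union> U" using x by auto
  ultimately show ?thesis by simp
qed

lemma connected_Un_closure_UN: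
  assumes "connected S" "\<And>i. i \<in> I \<Longrightarrow> connected (U i)" "\<And>i. i \<in> I \<Longrightarrow> closure S \<inter> U i \<noteq> {}"
  shows "connected (S \<union> (\<Union>i\<in>I. U i))"
proof (cases "I = {}")
  case False
  have "connected (\<Union>i\<in>I. S \<union> U i)"
  proof (rule connected_Union)
    show "connected X" if "X \<in> (\<lambda>i. S \<union> U i) ` I" for X
      using that assms connected_Un_closure by blast
    have "S \<noteq> {}" using False assms(3) by fastforce
    then show "\<Inter> ((\<lambda>i. S \<union> U i) ` I) \<noteq> {}" using False by blast
  qed
  moreover have "(\<Union>i\<in>I. S \<union> U i) = S \<union> (\<Union>i\<in>I. U i)" using False by blast
  ultimately show ?thesis by simp
qed (simp add: assms)

lemma continuous_on_place: "continuous_on S (place u)"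
  unfolding place_def by (intro continuous_intros)

lemma connected_tri_of: "connected (tri_of u i)"
  unfolding tri_of_def by (intro connected_continuous_image continuous_on_place convex_connected convex_Tri)

lemma connected_star_of: "connected (star_of u)"
  unfolding star_of_def by (intro connected_continuous_image continuous_on_place connected_Star)

lemma side_of_tri_of_meet: "side_of u i \<inter> tri_of u i \<noteq> {}"
  unfolding side_of_def tri_of_def using midside_in_side midside_in_Tri by blast

lemma tri_of_partner_meet:
  assumes "u \<in> words m" "i < 8" "shared u i"
  shows "tri_of u i \<inter> tri_of (partner u i) (opposite i) \<noteq> {}"
proof -
  have l: "length (partner u i) = length u" by (rule partner_length[OF assms(1,2)])
  have "place u (midside i) = place (partner u i) (midside i - (V0 i + V0 (i + 1)))"
    unfolding place_def l shared_centre[OF assms] words_length[OF assms(1)] by (simp add: algebra_simps)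
  moreover have "midside i - (V0 i + V0 (i + 1)) \<in> Tri (opposite i)"
    by (rule Tri_opposite[OF midside_in_Tri nf_midside(1)])
  ultimately show ?thesis unfolding tri_of_def using midside_in_Tri[of i] by blast
qed

lemma hole_of_Central_empty: "m \<le> length v \<Longrightarrow> hole_of m (Central v) = {}"
proof (induction m)
  case (Suc m)
  have "gap_hole u i \<noteq> Central v" if "u \<in> words m" for u i
    using gap_hole_Central_level[of u i v] Suc.prems words_length[OF that] by auto
  moreover have "u \<noteq> v" if "u \<in> words m" for u using Suc.prems words_length[OF that] by auto
  ultimately show ?case using Suc by auto
qed simp

lemma hole_of_Square_empty: "(v, j) \<in> K \<Longrightarrow> m \<le> length v \<Longrightarrow> hole_of m (Square p K) = {}"
proof (induction m)
  case (Suc m)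
  have "gap_hole u i \<noteq> Square p K" if "u \<in> words m" "i < 8" for u i
  proof
    assume e: "gap_hole u i = Square p K"
    have l: "length u = m" "length (partner u i) = m"
      using words_length[OF that(1)] partner_length[OF that] by auto
    have "length v \<le> m"
    proof (cases "shared u i")
      case True
      then have "K = {(u, i), (partner u i, opposite i)}" using e gap_hole_shared[OF True] by simp
      then show ?thesis using Suc.prems(1) l by auto
    next
      case False
      then have "\<forall>(v, j)\<in>K. length v < length u" using gap_hole_Square_level that e by blast
      then show ?thesis using Suc.prems(1) l by auto
    qed
    then show False using Suc.prems(2) by simp
  qed
  then show ?case using Suc by auto
qed simp

lemma bounded_octagon: "bounded octagon"
  unfolding octagon_def by (intro bounded_convex_hull finite_imp_bounded) simp

text \<open>A newborn square consists of exactly two triangles meeting along their common base, and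
  a newborn central hole is a star. In all other cases every triangle absorbed has its base on the
  rim of the old part, so it meets the closure of a connected set.\<close>

lemma connected_hole_of: "connected (hole_of m h)"
proof (induction m)
  case 0
  have "connected (- octagon)"
    by (rule connected_complement_bounded_convex) (simp_all add: convex_octagon bounded_octagon)
  then show ?case by simp
next
  case (Suc m)
  let ?TI = "{(u, i). u \<in> words m \<and> i < 8 \<and> gap_hole u i = h}"
  consider u i where "u \<in> words m" "i < 8" "shared u i" "gap_hole u i = h"
    | v where "v \<in> words m" "h = Central v"
    | "\<And>u i. u \<in> words m \<Longrightarrow> i < 8 \<Longrightarrow> gap_hole u i = h \<Longrightarrow> \<not> shared u i" "\<And>v. v \<in> words m \<Longrightarrow> Central v \<noteq> h"
    by blast
  then show ?case
  proof cases
    case 1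
    define p K where "p = midpoint (centre u) (centre (partner u i))" and "K = {(u, i), (partner u i, opposite i)}"
    have h: "h = Square p K" using 1(3,4) gap_hole_shared by (simp add: p_def K_def)
    have 0: "hole_of m h = {}" unfolding h
      by (rule hole_of_Square_empty[of u i]) (use 1 words_length in \<open>auto simp: K_def\<close>)
    have "(w, k) \<in> K" if "(w, k) \<in> ?TI" for w k
    proof -
      have w: "w \<in> words m" "k < 8" "gap_hole w k = Square p K" using that h by auto
      have "shared w k"
      proof (rule ccontr)
        assume "\<not> shared w k"
        then have "\<forall>(v, j)\<in>K. length v < length w" using gap_hole_Square_level w by blast
        then show False using words_length[OF w(1)] words_length[OF 1(1)] by (simp add: K_def)
      qed
      then show ?thesis using gap_hole_shared w(3) by auto
    qed
    moreover have "K \<subseteq> ?TI" using 1 partner_words[OF 1(1,2)] gap_hole_partner[OF 1(1,2)] by (auto simp: K_def opposite_less)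
    ultimately have "?TI = K" by auto
    then have "hole_of (Suc m) h = tri_of u i \<union> tri_of (partner u i) (opposite i)" using 0 h by (auto simp: K_def)
    then show ?thesis
      using connected_Un[OF connected_tri_of connected_tri_of tri_of_partner_meet[OF 1(1-3)]] by (simp only:)
  next
    case 2
    have "hole_of m h = {}" unfolding 2 by (rule hole_of_Central_empty) (use 2 words_length in auto)
    moreover have "?TI = {}" unfolding 2 using gap_hole_not_Central[OF _ 2(1)] by auto
    ultimately have "hole_of (Suc m) h = star_of v" using 2 by auto
    then show ?thesis by (simp only: connected_star_of)
  next
    case 3
    have "{u \<in> words m. Central u = h} = {}" using 3(2) by blast
    then have "hole_of (Suc m) h = hole_of m h \<union> (\<Union>x\<in>?TI. case x of (u, i) \<Rightarrow> tri_of u i)" by auto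
    moreover have "connected (hole_of m h \<union> (\<Union>x\<in>?TI. case x of (u, i) \<Rightarrow> tri_of u i))"
    proof (rule connected_Un_closure_UN[OF Suc.IH])
      fix x assume "x \<in> ?TI"
      then obtain u i where x: "x = (u, i)" "u \<in> words m" "i < 8" "gap_hole u i = h" by auto
      show "connected (case x of (u, i) \<Rightarrow> tri_of u i)" by (simp add: x connected_tri_of)
      have "side_of u i \<subseteq> closure (hole_of m h)"
        unfolding closure_hole_of using side_of_subset_rim_of[OF x(2,3) _ x(4)] 3(1)[OF x(2-4)] by blast
      then show "closure (hole_of m h) \<inter> (case x of (u, i) \<Rightarrow> tri_of u i) \<noteq> {}"
        using side_of_tri_of_meet[of u i] by (auto simp: x(1))
    qed
    ultimately show ?thesis by simp
  qed
qed

section \<open>Central symmetry, components and the antipodal relation\<close>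

lemma place_partner:
  assumes "u \<in> words m" "i < 8"
  shows "place (partner u i) (- x) = 2 *\<^sub>R id_centre (gap_hole u i) - place u x"
  unfolding place_def partner_length[OF assms] centre_partner[OF assms] by simp

lemma Tri_reflect: "x \<in> Tri i \<Longrightarrow> - x \<in> Tri (opposite i)"
proof -
  have "Tri (opposite i) = Tri (i + 4)" unfolding opposite_def by (rule Tri_cong) simp
  then show "x \<in> Tri i \<Longrightarrow> - x \<in> Tri (opposite i)" using Tri_uminus by simp
qed

text \<open>By \<open>place_partner\<close> the reflection in the centre of \<open>h\<close> sends
  each absorbed triangle to the one on the partner edge, which has the same hole name; a star is
  symmetric about the centre of its own cell.\<close>

lemma hole_of_symmetric: "x \<in> hole_of m h \<Longrightarrow> 2 *\<^sub>R id_centre h - x \<in> hole_of m h"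
proof (induction m)
  case 0
  then show ?case by (auto simp: octagon_uminus split: if_splits)
next
  case (Suc m)
  then consider "x \<in> hole_of m h" | u i where "u \<in> words m" "i < 8" "gap_hole u i = h" "x \<in> tri_of u i"
    | u where "u \<in> words m" "h = Central u" "x \<in> star_of u" by auto
  then show ?case
  proof cases
    case 1
    then show ?thesis using Suc.IH by auto
  next
    case 2
    then obtain y where y: "y \<in> Tri i" "x = place u y" by (auto simp: tri_of_def)
    have "2 *\<^sub>R id_centre h - x = place (partner u i) (- y)"
      using place_partner[OF 2(1,2)] 2(3) y by simp
    then have "2 *\<^sub>R id_centre h - x \<in> tri_of (partner u i) (opposite i)" unfolding tri_of_def using Tri_reflect[OF y(1)] by blast
    then show ?thesis using partner_words[OF 2(1,2)] gap_hole_partner[OF 2(1,2)] opposite_less 2(3) by auto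
  next
    case 3
    then obtain y where y: "y \<in> Star" "x = place u y" by (auto simp: star_of_def)
    then have "2 *\<^sub>R id_centre h - x = place u (- y)" by (simp add: 3 place_def scaleR_2)
    then have "2 *\<^sub>R id_centre h - x \<in> star_of u" unfolding star_of_def using y Star_uminus by blast
    then show ?thesis using 3 by auto
  qed
qed

lemma O_level_subset_octagon: "O_level m \<subseteq> octagon"
  by (induction m) (use O_level_0 O_level_mono in auto)

lemma bounded_hole_of: "h \<noteq> Outer \<Longrightarrow> bounded (hole_of m h)"
proof -
  assume h: "h \<noteq> Outer"
  have "hole_of m h \<subseteq> octagon"
  proof (induction m)
    case 0
    then show ?case using h by simp
  next
    case (Suc m)
    have "tri_of u i \<subseteq> octagon" "star_of u \<subseteq> octagon" if "u \<in> words m" for u i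
      using tri_of_subset_O_level star_of_subset_O_level O_level_subset_octagon that by blast+
    with Suc show ?case unfolding hole_of.simps by (intro Un_least UN_least; clarsimp; blast)
  qed
  then show ?thesis using bounded_octagon bounded_subset by blast
qed

text \<open>Composing the two reflections gives a translation by \<open>2 *\<^sub>R (c - d)\<close>
  that preserves \<open>S\<close>; if it were not zero, iterating it would leave every bounded
  set.\<close>

lemma symmetry_centre_unique:
  fixes S :: "'a::real_normed_vector set"
  assumes "bounded S" "S \<noteq> {}" "(\<lambda>x. 2 *\<^sub>R c - x) ` S = S" "(\<lambda>x. 2 *\<^sub>R d - x) ` S = S"
  shows "c = d"
proof (rule ccontr)
  assume ne: "c \<noteq> d"
  obtain x where x: "x \<in> S" using assms(2) by blast
  define e where "e = 2 *\<^sub>R (c - d)"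
  have step: "y + e \<in> S" if "y \<in> S" for y
  proof -
    have "2 *\<^sub>R d - y \<in> S" using assms(4) that by blast
    then have "2 *\<^sub>R c - (2 *\<^sub>R d - y) \<in> S" using assms(3) by blast
    then show ?thesis by (simp add: e_def algebra_simps)
  qed
  have mem: "x + real n *\<^sub>R e \<in> S" for n
  proof (induction n)
    case (Suc n)
    have "x + real (Suc n) *\<^sub>R e = (x + real n *\<^sub>R e) + e" by (simp add: algebra_simps)
    then show ?case using step[OF Suc] by (simp only:)
  qed (simp add: x)
  obtain r where r: "\<And>y. y \<in> S \<Longrightarrow> norm y \<le> r" using assms(1) by (auto simp: bounded_iff)
  have "e \<noteq> 0" using ne by (simp add: e_def)
  then obtain n where n: "r + norm x < real n * norm e"
    using reals_Archimedean3[of "norm e"] by (metis zero_less_norm_iff)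
  have "real n * norm e \<le> norm (x + real n *\<^sub>R e) + norm x"
    using norm_triangle_ineq4[of "x + real n *\<^sub>R e" x] by simp
  then show False using r[OF mem[of n]] n by linarith
qed

lemma hole_center_hole_of:
  assumes "hole_of m h \<noteq> {}"
  shows "hole_center (hole_of m h) = id_centre h"
proof (cases "bounded (hole_of m h)")
  case True
  have sym: "(\<lambda>x. 2 *\<^sub>R id_centre h - x) ` hole_of m h = hole_of m h"
  proof (intro equalityI subsetI)
    fix x assume "x \<in> hole_of m h"
    then have "x = 2 *\<^sub>R id_centre h - (2 *\<^sub>R id_centre h - x)" "2 *\<^sub>R id_centre h - x \<in> hole_of m h"
      using hole_of_symmetric by simp_all
    then show "x \<in> (\<lambda>x. 2 *\<^sub>R id_centre h - x) ` hole_of m h" by blast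
  qed (use hole_of_symmetric in blast)
  have "(THE c. (\<lambda>x. 2 *\<^sub>R c - x) ` hole_of m h = hole_of m h) = id_centre h"
    by (rule the_equality[where a = "id_centre h"]) (use sym symmetry_centre_unique[OF True assms] in blast)+
  then show ?thesis using True by (simp add: hole_center_def)
next
  case False
  then have "h = Outer" using bounded_hole_of by blast
  then show ?thesis using False by (simp add: hole_center_def)
qed

lemma rim_of_subset_O_level: "rim_of m h \<subseteq> O_level m"
  unfolding rim_of_def O_level_eq using side_of_subset_cell_of by fastforce

lemma finite_hole_ids: "finite {h. hole_of m h \<noteq> {}}"
proof (induction m)
  case 0
  have "{h. hole_of 0 h \<noteq> {}} \<subseteq> {Outer}" by auto
  then show ?case using finite_subset by blast
next
  case (Suc m)
  have "{h. hole_of (Suc m) h \<noteq> {}} \<subseteq> {h. hole_of m h \<noteq> {}} \<union> (\<lambda>(u, i). gap_hole u i) ` (words m \<times> {..<8}) \<union> Central ` words m"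
    by auto
  then show ?case using Suc finite_words by (metis finite_SigmaI finite_UnI finite_imageI finite_lessThan finite_subset)
qed

text \<open>The sets \<open>hole_of m h\<close> are finitely many, disjoint, connected and relatively closed in the complement.\<close>

lemma component_is_hole_of:
  assumes "S \<in> components (- O_level m)"
  shows "\<exists>h. S = hole_of m h"
proof -
  have ne: "S \<noteq> {}" "connected S" "S \<subseteq> - O_level m"
    using assms in_components_nonempty in_components_connected in_components_subset by blast+
  then obtain x h where x: "x \<in> S" "x \<in> hole_of m h" using hole_of_cover by blast
  have sub: "hole_of m h \<subseteq> S"
    by (rule components_maximal[OF assms connected_hole_of hole_of_subset]) (use x in blast)
  define R where "R = (\<Union>g\<in>{g. hole_of m g \<noteq> {}} - {h}. hole_of m g)"
  have clR: "closure R = (\<Union>g\<in>{g. hole_of m g \<noteq> {}} - {h}. hole_of m g \<union> rim_of m g)"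
    unfolding R_def using finite_hole_ids by (simp add: closure_finite_UN closure_hole_of)
  have "S \<subseteq> closure (hole_of m h) \<union> closure R"
  proof
    fix y assume "y \<in> S"
    then obtain g where "y \<in> hole_of m g" using ne(3) hole_of_cover[of y m] by blast
    then have "y \<in> hole_of m h \<or> y \<in> R" unfolding R_def by blast
    then show "y \<in> closure (hole_of m h) \<union> closure R"
      using closure_subset[of R] closure_subset[of "hole_of m h"] by blast
  qed
  moreover have "closure (hole_of m h) \<inter> closure R \<inter> S = {}"
  proof (rule ccontr)
    assume "closure (hole_of m h) \<inter> closure R \<inter> S \<noteq> {}"
    then obtain y where y: "y \<in> closure (hole_of m h)" "y \<in> closure R" "y \<in> S" by blast
    have nB: "y \<notin> rim_of m g" for g using y(3) ne(3) rim_of_subset_O_level[of m g] by blast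
    then have "y \<in> hole_of m h" using y(1) unfolding closure_hole_of by blast
    moreover from y(2) obtain g where "g \<noteq> h" "y \<in> hole_of m g" using nB unfolding clR by blast
    ultimately show False using hole_of_disjoint by blast
  qed
  moreover have "closure (hole_of m h) \<inter> S \<noteq> {}" using x closure_subset[of "hole_of m h"] by blast
  ultimately have "closure R \<inter> S = {}"
    using ne(2) unfolding connected_closed by (metis closed_closure)
  then have RS: "R \<inter> S = {}" using closure_subset[of R] by blast
  have "S \<subseteq> hole_of m h"
  proof
    fix y assume y: "y \<in> S"
    then obtain g where g: "y \<in> hole_of m g" using ne(3) hole_of_cover[of y m] by blast
    then show "y \<in> hole_of m h" using y RS unfolding R_def by (cases "g = h") blast+
  qed
  with sub show ?thesis by blast
qed

lemma closed_O_level: "closed (O_level m)"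
proof -
  have "compact octagon" unfolding octagon_def by (intro compact_convex_hull finite_imp_compact) simp
  then have "compact (cell_of u)" for u
    unfolding cell_of_def by (rule compact_continuous_image[OF continuous_on_place])
  then show ?thesis unfolding O_level_eq
    by (intro closed_UN compact_imp_closed) (auto simp: finite_words)
qed

text \<open>The bridge from topology to combinatorics: components are open, so a frontier point lies
  in the closure but not in the hole, hence on an edge of the rim, and the reflection acts there as
  \<open>partner\<close>.\<close>

lemma antipodal_edge:
  assumes "antipodal m x y"
  obtains u i t where "u \<in> words m" "i < 8" "\<not> shared u i" "t \<in> side i" "x = place u t" "y = place (partner u i) (- t)"
proof -
  obtain S where S: "S \<in> components (- O_level m)" "x \<in> frontier S" "y = 2 *\<^sub>R hole_center S - x"
    using assms by (auto simp: antipodal_def)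
  obtain h where h: "S = hole_of m h" using component_is_hole_of[OF S(1)] by blast
  have "open S" using open_components[OF _ S(1)] closed_O_level by (simp add: open_Compl)
  then have "x \<in> closure S" "x \<notin> S" using S(2) by (auto simp: frontier_def interior_open)
  then have "x \<in> rim_of m h" unfolding h closure_hole_of by blast
  then obtain u i where u: "u \<in> words m" "i < 8" "\<not> shared u i" "gap_hole u i = h" "x \<in> side_of u i"
    unfolding rim_of_def by auto
  then obtain t where t: "t \<in> side i" "x = place u t" by (auto simp: side_of_def)
  have "hole_of m h \<noteq> {}" using S(1) in_components_nonempty h by blast
  then have "y = place (partner u i) (- t)"
    using S(3) unfolding h hole_center_hole_of[OF \<open>hole_of m h \<noteq> {}\<close>] t(2) place_partner[OF u(1,2)] u(4) by simp
  then show thesis using that u t by blast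
qed

section \<open>Functions on corners\<close>

text \<open>Corner \<open>i\<close> of a cell is the first end point of its edge \<open>i\<close>. A shared edge is traversed in opposite
  directions by its two cells, whereas the antipodal map preserves the direction.\<close>

definition compat :: "nat \<Rightarrow> (nat list \<Rightarrow> nat \<Rightarrow> 'b) \<Rightarrow> bool" where
  "compat m h \<longleftrightarrow> (\<forall>u\<in>words m. \<forall>i<8.
     if shared u i then h (partner u i) ((i + 5) mod 8) = h u i \<and> h (partner u i) ((i + 4) mod 8) = h u ((i + 1) mod 8)
     else h (partner u i) ((i + 4) mod 8) = h u i \<and> h (partner u i) ((i + 5) mod 8) = h u ((i + 1) mod 8))"

lemma compat_shared:
  assumes "compat m h" "u \<in> words m" "i < 8" "shared u i"
  shows "h (partner u i) ((i + 5) mod 8) = h u i" "h (partner u i) ((i + 4) mod 8) = h u ((i + 1) mod 8)"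
  using assms by (auto simp: compat_def)

lemma compat_not_shared:
  assumes "compat m h" "u \<in> words m" "i < 8" "\<not> shared u i"
  shows "h (partner u i) ((i + 4) mod 8) = h u i" "h (partner u i) ((i + 5) mod 8) = h u ((i + 1) mod 8)"
  using assms by (auto simp: compat_def)

text \<open>The eight corners of a child \<open>a # u\<close> are the old corner \<open>a\<close> of the parent (\<open>P\<close>), the ends \<open>X\<close> of the bases
  and the apices \<open>M\<close> of the triangles on the parent edges \<open>a\<close> and \<open>a - 1\<close>, the inner ends \<open>N\<close> of
  the edges shared with the siblings, and the innermost corner \<open>I\<close>.\<close>

fun corner :: "(nat list \<Rightarrow> nat \<Rightarrow> 'b) \<Rightarrow> (nat list \<Rightarrow> nat \<Rightarrow> 'b) \<Rightarrow> (nat list \<Rightarrow> nat \<Rightarrow> 'b) \<Rightarrow>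
    (nat list \<Rightarrow> nat \<Rightarrow> 'b) \<Rightarrow> (nat list \<Rightarrow> nat \<Rightarrow> 'b) \<Rightarrow> nat list \<Rightarrow> nat \<Rightarrow> 'b" where
  "corner P X M N I [] i = undefined"
| "corner P X M N I (a # u) i = (let d = (i + 8 - a) mod 8 in
     if d = 0 then P u a else if d = 1 then X u a else if d = 2 then M u a else if d = 3 then N u a
     else if d = 4 then I u a else if d = 5 then N u ((a + 7) mod 8) else if d = 6 then M u ((a + 7) mod 8)
     else X u ((a + 7) mod 8))"

declare corner.simps(2) [simp del]

text \<open>Old corners inherit compatibility. Corners on a triangle must match across the partner
  of the parent edge, and corners on the star must be invariant under the half turn; with
  \<open>a\<close> and \<open>i\<close> concrete, each edge of a child reduces to one of these
  conditions.\<close>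

lemma compat_corner:
  assumes P: "compat m P"
    and XM: "\<And>u s. u \<in> words m \<Longrightarrow> s < 8 \<Longrightarrow> X (partner u s) ((s + 4) mod 8) = X u s \<and> M (partner u s) ((s + 4) mod 8) = M u s"
    and NI: "\<And>u s. u \<in> words m \<Longrightarrow> s < 8 \<Longrightarrow> N u ((s + 4) mod 8) = N u s \<and> I u ((s + 4) mod 8) = I u s"
  shows "compat (Suc m) (corner P X M N I)"
  unfolding compat_def
proof (intro ballI allI impI)
  fix u i assume "u \<in> words (Suc m)" and i: "i < (8::nat)"
  then obtain a v where u: "u = a # v" "a < 8" "v \<in> words m" by (auto simp: words_Suc)
  note xm = XM[OF u(3)] and ni = NI[OF u(3)] and p = compat_shared[OF P u(3)] and q = compat_not_shared[OF P u(3)]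
  note xm' = xm[of 0, simplified] xm[of 1, simplified] xm[of 2, simplified] xm[of 3, simplified]
    xm[of 4, simplified] xm[of 5, simplified] xm[of 6, simplified] xm[of 7, simplified]
  note ni' = ni[of 0, simplified] ni[of 1, simplified] ni[of 2, simplified] ni[of 3, simplified]
  note p' = p[of 0, simplified] p[of 1, simplified] p[of 2, simplified] p[of 3, simplified]
    p[of 4, simplified] p[of 5, simplified] p[of 6, simplified] p[of 7, simplified]
  note q' = q[of 0, simplified] q[of 1, simplified] q[of 2, simplified] q[of 3, simplified]
    q[of 4, simplified] q[of 5, simplified] q[of 6, simplified] q[of 7, simplified]
  note r = xm' ni' p' q'
  note r' = r r[unfolded numeral_2_eq_2]
  show "if shared u i
        then corner P X M N I (partner u i) ((i + 5) mod 8) = corner P X M N I u i \<and>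
             corner P X M N I (partner u i) ((i + 4) mod 8) = corner P X M N I u ((i + 1) mod 8)
        else corner P X M N I (partner u i) ((i + 4) mod 8) = corner P X M N I u i \<and>
             corner P X M N I (partner u i) ((i + 5) mod 8) = corner P X M N I u ((i + 1) mod 8)"
    unfolding u(1)
    by (rule less8_cases[OF u(2)]; rule less8_cases[OF i]; cases "shared v i";
        simp add: shared.simps(2) partner.simps(2) corner.simps(2) Let_def r';
        simp add: numeral_2_eq_2)
qed

text \<open>The value \<open>Min + Max\<close> at the inner corners keeps a constant function constant and is otherwise the
  odd number between the two doubled values.\<close>

definition refine :: "(nat list \<Rightarrow> nat \<Rightarrow> int) \<Rightarrow> nat list \<Rightarrow> nat \<Rightarrow> int" where
  "refine h = corner (\<lambda>u a. 2 * h u a) (\<lambda>u s. h u s + h u ((s + 1) mod 8)) (\<lambda>u s. h u s + h u ((s + 1) mod 8))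
     (\<lambda>u s. Min (h u ` {..<8}) + Max (h u ` {..<8})) (\<lambda>u s. Min (h u ` {..<8}) + Max (h u ` {..<8}))"

text \<open>The gluing may keep or reverse the direction of an edge. The sum of the two end values
  is insensitive to this, hence its use at the corners of triangles.\<close>

lemma partner_corner_sum:
  assumes "compat m (h :: nat list \<Rightarrow> nat \<Rightarrow> int)" "u \<in> words m" "s < 8"
  shows "h (partner u s) ((s + 4) mod 8) + h (partner u s) (((s + 4) mod 8 + 1) mod 8) = h u s + h u ((s + 1) mod 8)"
proof -
  have e: "((s + 4) mod 8 + 1) mod 8 = (s + 5) mod 8"
    using assms(3) by (rule less8_cases) simp_all
  show ?thesis unfolding e
    by (cases "shared u s") (simp_all add: compat_shared[OF assms] compat_not_shared[OF assms])
qed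

lemma compat_refine:
  assumes "compat m h"
  shows "compat (Suc m) (refine h)"
  unfolding refine_def
proof (rule compat_corner)
  show "compat m (\<lambda>u a. 2 * h u a)" using assms by (simp add: compat_def)
qed (use partner_corner_sum[OF assms] in simp_all)

text \<open>Only two shapes of values occur on the child \<open>a\<close>; this suffices for
  flatness and for the bounds on iterates. Taking \<open>k = a\<close> covers the old corner with
  its doubled value.\<close>

lemma refine_cases:
  assumes "a < 8"
  shows "\<exists>k<8. refine h (a # u) i = h u a + h u k \<or>
    refine h (a # u) i = Min (h u ` {..<8}) + Max (h u ` {..<8})"
proof -
  have e: "((a + 7) mod 8 + 1) mod 8 = a" using assms by (simp add: mod_simps)
  have k: "(a + 1) mod 8 < 8" "(a + 7) mod 8 < 8" by simp_all
  have "refine h (a # u) i \<in> {h u a + h u a, h u a + h u ((a + 1) mod 8),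
      Min (h u ` {..<8}) + Max (h u ` {..<8}), h u a + h u ((a + 7) mod 8)}"
    unfolding refine_def corner.simps(2) Let_def e by simp
  then consider "refine h (a # u) i = h u a + h u a" | "refine h (a # u) i = h u a + h u ((a + 1) mod 8)"
    | "refine h (a # u) i = Min (h u ` {..<8}) + Max (h u ` {..<8})"
    | "refine h (a # u) i = h u a + h u ((a + 7) mod 8)" by (elim insertE emptyE)
  then show ?thesis
  proof cases
    case 1
    then show ?thesis using assms by (intro exI[of _ a]) simp
  next
    case 2
    then show ?thesis using k by (intro exI[of _ "(a + 1) mod 8"]) simp
  next
    case 3
    then show ?thesis using assms by (intro exI[of _ a]) simp
  next
    case 4
    then show ?thesis using k by (intro exI[of _ "(a + 7) mod 8"]) simp
  qed
qed

section \<open>Flat functions and iterated refinement\<close>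

definition flat :: "nat \<Rightarrow> (nat list \<Rightarrow> nat \<Rightarrow> int) \<Rightarrow> bool" where
  "flat m h \<longleftrightarrow> (\<forall>u\<in>words m. \<exists>q. \<forall>i<8. h u i = q \<or> h u i = q + 1)"

lemma Min_Max_corner:
  fixes f :: "nat \<Rightarrow> int"
  assumes "i < (8::nat)"
  shows "Min (f ` {..<8}) \<le> f i" "f i \<le> Max (f ` {..<8})"
    "\<exists>j<8. f j = Min (f ` {..<8})" "\<exists>j<8. f j = Max (f ` {..<8})"
proof -
  show "Min (f ` {..<8}) \<le> f i" "f i \<le> Max (f ` {..<8})" using assms by simp_all
  have "Min (f ` {..<8}) \<in> f ` {..<8}" "Max (f ` {..<8}) \<in> f ` {..<8}"
    by (intro Min_in Max_in; use assms in auto)+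
  then show "\<exists>j<8. f j = Min (f ` {..<8})" "\<exists>j<8. f j = Max (f ` {..<8})" by auto
qed

lemma flat_refine:
  assumes "flat m h"
  shows "flat (Suc m) (refine h)"
  unfolding flat_def
proof
  fix w assume "w \<in> words (Suc m)"
  then obtain a u where w: "w = a # u" "a < 8" "u \<in> words m" by (auto simp: words_Suc)
  obtain q where q: "\<And>i. i < 8 \<Longrightarrow> h u i = q \<or> h u i = q + 1" using assms w(3) unfolding flat_def by blast
  define lo where "lo = Min (h u ` {..<8})"
  define hi where "hi = Max (h u ` {..<8})"
  note mm = Min_Max_corner[of _ "h u", folded lo_def hi_def]
  have lh: "lo = q \<or> lo = q + 1" "hi = q \<or> hi = q + 1" using mm(3,4)[of 0] q by force+
  \<comment> \<open>If \<open>h u a\<close> is the minimum, the corners take only the values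
    \<open>2 * lo\<close> and \<open>lo + hi\<close>; otherwise only \<open>lo + hi\<close> and
    \<open>2 * hi\<close>. Each pair differs by at most 1.\<close>
  define z where "z = (if h u a = lo then 2 * lo else lo + hi)"
  have "refine h (a # u) i = z \<or> refine h (a # u) i = z + 1" for i
  proof -
    obtain k where k: "k < 8" "refine h (a # u) i = h u a + h u k \<or> refine h (a # u) i = lo + hi"
      using refine_cases[OF w(2), of h u i] unfolding lo_def hi_def by blast
    show ?thesis
      using k(2) mm(1,2)[OF k(1)] mm(1,2)[OF w(2)] lh q[OF k(1)] q[OF w(2)]
      unfolding z_def by (auto split: if_splits)
  qed
  then show "\<exists>q. \<forall>i<8. refine h w i = q \<or> refine h w i = q + 1" unfolding w by blast
qed

lemma iterate_refine:
  assumes "compat m h" "flat m h"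
  shows "compat (k + m) ((refine ^^ k) h) \<and> flat (k + m) ((refine ^^ k) h)"
  by (induction k) (use assms compat_refine flat_refine in auto)

lemma iterate_refine_ge:
  assumes "\<forall>i<8. h v i \<ge> c" "x \<in> words k" "i < 8"
  shows "(refine ^^ k) h (x @ v) i \<ge> 2 ^ k * c"
  using assms(2,3)
proof (induction k arbitrary: x i)
  case 0
  then show ?case using assms(1) by (simp add: words_0)
next
  case (Suc k)
  obtain a y where x: "x = a # y" "a < 8" "y \<in> words k" using Suc.prems(1) by (auto simp: words_Suc)
  let ?h = "(refine ^^ k) h"
  have ge: "\<And>j. j < 8 \<Longrightarrow> ?h (y @ v) j \<ge> 2 ^ k * c" using Suc.IH[OF x(3)] .
  obtain j where j: "j < 8" "refine ?h (a # y @ v) i = ?h (y @ v) a + ?h (y @ v) j \<or>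
    refine ?h (a # y @ v) i = Min (?h (y @ v) ` {..<8}) + Max (?h (y @ v) ` {..<8})"
    using refine_cases[OF x(2)] by blast
  obtain j1 j2 where "j1 < 8" "?h (y @ v) j1 = Min (?h (y @ v) ` {..<8})" "j2 < 8" "?h (y @ v) j2 = Max (?h (y @ v) ` {..<8})"
    using Min_Max_corner(3,4)[OF x(2)] by metis
  then have "refine ?h (a # y @ v) i \<ge> 2 ^ k * c + 2 ^ k * c"
    using j(2) ge[OF x(2)] ge[OF j(1)] ge[of j1] ge[of j2] by linarith
  then show ?case by (simp add: x algebra_simps)
qed

lemma iterate_refine_0:
  assumes "\<forall>i<8. h v i = 0" "x \<in> words k" "i < 8"
  shows "(refine ^^ k) h (x @ v) i = 0"
  using assms(2,3)
proof (induction k arbitrary: x i)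
  case 0
  then show ?case using assms(1) by (simp add: words_0)
next
  case (Suc k)
  obtain a y where x: "x = a # y" "a < 8" "y \<in> words k" using Suc.prems(1) by (auto simp: words_Suc)
  let ?h = "(refine ^^ k) h"
  have 0: "\<And>j. j < 8 \<Longrightarrow> ?h (y @ v) j = 0" using Suc.IH[OF x(3)] .
  obtain j where j: "j < 8" "refine ?h (a # y @ v) i = ?h (y @ v) a + ?h (y @ v) j \<or>
    refine ?h (a # y @ v) i = Min (?h (y @ v) ` {..<8}) + Max (?h (y @ v) ` {..<8})"
    using refine_cases[OF x(2)] by blast
  obtain j1 j2 where "j1 < 8" "?h (y @ v) j1 = Min (?h (y @ v) ` {..<8})" "j2 < 8" "?h (y @ v) j2 = Max (?h (y @ v) ` {..<8})"
    using Min_Max_corner(3,4)[OF x(2)] by metis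
  then have "refine ?h (a # y @ v) i = 0"
    using j(2) 0[OF x(2)] 0[OF j(1)] 0[of j1] 0[of j2] by linarith
  then show ?case by (simp add: x)
qed

section \<open>Small sets of corners invariant under the gluing\<close>

definition corner_class_X :: "nat list \<Rightarrow> nat \<Rightarrow> (nat list \<times> nat) set" where
  "corner_class_X u s = {(s # u, (s + 1) mod 8), (((s + 1) mod 8) # u, s),
     (((s + 4) mod 8) # partner u s, (s + 5) mod 8), (((s + 5) mod 8) # partner u s, (s + 4) mod 8)}"
definition corner_class_M :: "nat list \<Rightarrow> nat \<Rightarrow> (nat list \<times> nat) set" where
  "corner_class_M u s = {(s # u, (s + 2) mod 8), (((s + 1) mod 8) # u, (s + 7) mod 8),
     (((s + 4) mod 8) # partner u s, (s + 6) mod 8), (((s + 5) mod 8) # partner u s, (s + 3) mod 8)}"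
definition corner_class_N :: "nat list \<Rightarrow> nat \<Rightarrow> (nat list \<times> nat) set" where
  "corner_class_N u s = {(s mod 8 # u, (s + 3) mod 8), (((s + 1) mod 8) # u, (s + 6) mod 8),
     (((s + 4) mod 8) # u, (s + 7) mod 8), (((s + 5) mod 8) # u, (s + 2) mod 8)}"
definition corner_class_I :: "nat list \<Rightarrow> nat \<Rightarrow> (nat list \<times> nat) set" where
  "corner_class_I u a = {(a mod 8 # u, (a + 4) mod 8), (((a + 4) mod 8) # u, a mod 8)}"

text \<open>A compatible function with sets as values, assembled by \<open>corner\<close> from the
  four kinds of new corners. A set may be larger than a single gluing class:
  \<open>corner_class_X\<close> lists both base ends of a triangle even if the parent edge is not
  shared. What matters is that identified corners get the same set, that each corner lies in its own
  set, and that there are at most four members.\<close>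

primrec corner_class :: "nat \<Rightarrow> nat list \<Rightarrow> nat \<Rightarrow> (nat list \<times> nat) set" where
  "corner_class 0 = (\<lambda>u i. {([], i), ([], (i + 4) mod 8)})"
| "corner_class (Suc m) = corner (\<lambda>u a. (\<lambda>(v, b). (b # v, b)) ` corner_class m u a) corner_class_X corner_class_M corner_class_N corner_class_I"

lemma compat_corner_class: "compat m (corner_class m)"
proof (induction m)
  case 0
  have "{([] :: nat list, (i + 4) mod 8), ([], ((i + 4) mod 8 + 4) mod 8)} = {([], i), ([], (i + 4) mod 8)} \<and>
      {([] :: nat list, (i + 5) mod 8), ([], ((i + 5) mod 8 + 4) mod 8)} = {([], (i + 1) mod 8), ([], ((i + 1) mod 8 + 4) mod 8)}"
    if "i < 8" for i :: nat
    using that by (rule less8_cases) auto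
  then show ?case by (simp add: compat_def words_0)
next
  case (Suc m)
  show ?case unfolding corner_class.simps
  proof (rule compat_corner)
    show "compat m (\<lambda>u a. (\<lambda>(v, b). (b # v, b)) ` corner_class m u a)"
      using Suc unfolding compat_def by (metis (no_types, lifting))
    fix u s assume u: "u \<in> words m" and s: "s < (8::nat)"
    have p: "partner (partner u s) ((s + 4) mod 8) = u" using partner_involution[OF u s] by (simp add: opposite_def)
    show "corner_class_X (partner u s) ((s + 4) mod 8) = corner_class_X u s \<and> corner_class_M (partner u s) ((s + 4) mod 8) = corner_class_M u s"
      unfolding corner_class_X_def corner_class_M_def p by (rule less8_cases[OF s]; auto)
    show "corner_class_N u ((s + 4) mod 8) = corner_class_N u s \<and> corner_class_I u ((s + 4) mod 8) = corner_class_I u s"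
      unfolding corner_class_N_def corner_class_I_def by (rule less8_cases[OF s]; auto)
  qed
qed

lemma card_corner_class: "finite (corner_class m u i) \<and> card (corner_class m u i) \<le> 4" if "u \<in> words m"
  using that
proof (induction m arbitrary: u i)
  case 0
  have "card {p, q} \<le> 4" for p q :: "nat list \<times> nat"
    using card_length[of "[p, q, q, q]"] by simp
  then show ?case by simp
next
  case (Suc m)
  obtain a v where u: "u = a # v" "v \<in> words m" using Suc.prems by (auto simp: words_Suc)
  have four: "finite {p, q, r, t} \<and> card {p, q, r, t} \<le> 4" for p q r t :: "nat list \<times> nat"
    using card_length[of "[p, q, r, t]"] by simp
  have img: "finite (f ` corner_class m v a) \<and> card (f ` corner_class m v a) \<le> 4" for f :: "nat list \<times> nat \<Rightarrow> nat list \<times> nat"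
    using Suc.IH[OF u(2), of a] card_image_le[of "corner_class m v a" f] by auto
  have I: "finite (corner_class_I v s) \<and> card (corner_class_I v s) \<le> 4" for s
    using four[of "(s mod 8 # v, (s + 4) mod 8)" "(s mod 8 # v, (s + 4) mod 8)" "(s mod 8 # v, (s + 4) mod 8)" "(((s + 4) mod 8) # v, s mod 8)"]
    by (simp add: corner_class_I_def)
  have o: "finite (corner_class_X v s) \<and> card (corner_class_X v s) \<le> 4" "finite (corner_class_M v s) \<and> card (corner_class_M v s) \<le> 4"
    "finite (corner_class_N v s) \<and> card (corner_class_N v s) \<le> 4" for s
    unfolding corner_class_X_def corner_class_M_def corner_class_N_def by (rule four)+
  show ?case unfolding u(1) corner_class.simps corner.simps(2) Let_def using I o img by simp
qed

lemma corner_class_refl: "u \<in> words m \<Longrightarrow> i < 8 \<Longrightarrow> (u, i) \<in> corner_class m u i"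
proof (induction m arbitrary: u i)
  case (Suc m)
  obtain a v where u: "u = a # v" "a < 8" "v \<in> words m" using Suc.prems by (auto simp: words_Suc)
  have im: "(a # v, a) \<in> (\<lambda>(v, b). (b # v, b)) ` corner_class m v a"
    using Suc.IH[OF u(3,2)] by force
  show ?case unfolding u(1) corner_class.simps
    by (rule less8_cases[OF u(2)]; rule less8_cases[OF Suc.prems(2)];
      use im in \<open>simp add: corner.simps(2) Let_def corner_class_X_def corner_class_M_def corner_class_N_def corner_class_I_def\<close>)
qed (simp add: words_0)

section \<open>Growth of balls\<close>

definition side_point :: "nat \<Rightarrow> real \<Rightarrow> real \<times> real" where
  "side_point i s = (1 - s) *\<^sub>R V0 i + s *\<^sub>R V0 (i + 1)"

definition side_value :: "(nat \<Rightarrow> real) \<Rightarrow> nat \<Rightarrow> real \<Rightarrow> real" where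
  "side_value f i s = (1 - s) * f i + s * f ((i + 1) mod 8)"

lemma side_point_in_side: "s \<in> {0..1} \<Longrightarrow> side_point i s \<in> side i"
  unfolding in_side side_point_def by blast

lemma side_side_point: "x \<in> side i \<Longrightarrow> \<exists>s\<in>{0..1}. x = side_point i s"
  unfolding in_side side_point_def .

lemma side_point_cong: "a mod 8 = b mod 8 \<Longrightarrow> side_point a s = side_point b s"
proof -
  assume a: "a mod 8 = b mod 8"
  then have "(a + 1) mod 8 = (b + 1) mod 8" by (rule mod_add_cong[OF _ refl])
  then show ?thesis unfolding side_point_def using V0_cong[OF a] V0_cong[of "a + 1" "b + 1"] by simp
qed

lemma nf_side_point: "nf (j + 1) (side_point j t) = sqrt 2 / 2 + t" "nf j (side_point j t) = kap"
  unfolding side_point_def nf_linear nf_V0 nf_V0_Suc by (simp_all add: kap_def field_simps)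

text \<open>A point on two different edges is their common corner, where both interpolations return
  the corner value. For \<open>d\<close> from 2 to 6 both ends of the edge \<open>j + d\<close> have
  \<open>nf j\<close> below \<open>kap\<close>, so no such point exists.\<close>

lemma side_value_unique:
  assumes "side_point i s = side_point j t" "i < 8" "j < 8" "s \<in> {0..1}" "t \<in> {0..1}"
  shows "side_value f i s = side_value f j t"
proof -
  obtain d where d: "d < 8" "i mod 8 = (j + d) mod 8" by (rule mod8_shift)
  have p: "side_point (j + d) s = side_point j t" using assms(1) side_point_cong[OF d(2)] by simp
  have i: "i = (j + d) mod 8" using d(2) assms(2) by simp
  have "nf j (side_point (j + d) s) = kap" using nf_side_point(2)[of j t] p by simp
  then have k: "(1 - s) * nf j (V0 (j + d)) + s * nf j (V0 (j + d + 1)) = kap"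
    unfolding side_point_def nf_linear .
  have e: "j + 1 + 1 = j + 2" "j + 2 + 1 = j + 3" "j + 3 + 1 = j + 4" "j + 4 + 1 = j + 5" "j + 5 + 1 = j + 6"
    "j + 6 + 1 = j + 7" "j + 7 + 1 = j + 8" by simp_all
  have ub: "(1 - s) * a + s * b < kap" if "a < kap" "b < kap" for a b
    using convex_bound_lt[OF that, of "1 - s" s] assms(4) by simp
  have lt: "sqrt 2 / 2 < kap" "- (sqrt 2 / 2) < kap" "- kap < kap" using sqrt2_bounds by (auto simp: kap_def)
  have k': "(1 - s) * kap + s * (sqrt 2 / 2) = kap - s" "(1 - s) * (sqrt 2 / 2) + s * kap = kap - (1 - s)"
    by (simp_all add: kap_def field_simps)
  consider "d = 0" | "d = 1" | "d = 7" | "d \<in> {2, 3, 4, 5, 6}" using d(1) by force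
  then show ?thesis
  proof cases
    case 1
    then have "s = t" using p nf_side_point(1)[of j s] nf_side_point(1)[of j t] by simp
    then show ?thesis using 1 i assms(3) by simp
  next
    case 2
    have "s = 0" using k unfolding 2 e nf_V0_all k' by simp
    moreover have "t = 1"
      using nf_side_point(1)[of j t] nf_side_point(2)[of "j + 1" s] p unfolding 2 by (simp add: kap_def)
    ultimately show ?thesis unfolding side_value_def i 2 by simp
  next
    case 3
    have "s = 1" using k unfolding 3 e V0_shift(5) nf_V0_all k' by simp
    then have "side_point j t = V0 (j + 8)" using p unfolding 3 side_point_def e by simp
    then have "side_point j t = V0 j" unfolding V0_shift .
    then have "t = 0" using nf_side_point(1)[of j t] nf_V0(2)[of j] by simp
    moreover have "((j + 7) mod 8 + 1) mod 8 = j" using assms(3) by (rule less8_cases) simp_all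
    ultimately show ?thesis unfolding side_value_def i 3 using \<open>s = 1\<close> by simp
  next
    case 4
    then have False
      using k ub lt by (elim insertE emptyE) (simp_all only: e nf_V0_all, (metis less_irrefl)+)
    then show ?thesis ..
  qed
qed

text \<open>Linear interpolation along the edges extends a compatible function on corners to a function on
  points that is constant on the classes of the gluing.\<close>

definition value_at :: "nat \<Rightarrow> (nat list \<Rightarrow> nat \<Rightarrow> real) \<Rightarrow> real \<times> real \<Rightarrow> real \<Rightarrow> bool" where
  "value_at m h x r \<longleftrightarrow> (\<exists>u\<in>words m. \<exists>i<8. \<exists>s\<in>{0..1}. x = place u (side_point i s) \<and> r = side_value (h u) i s)"

lemma side_point_opposite: "- side_point j s = side_point (opposite j) s"
proof -
  have e: "j + 4 + 1 = j + 5" by simp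
  have "side_point (opposite j) s = side_point (j + 4) s" by (rule side_point_cong) (simp add: opposite_def)
  then show ?thesis unfolding side_point_def e V0_shift by simp
qed

lemma side_point_flip: "side_point j s - (V0 j + V0 (j + 1)) = side_point (opposite j) (1 - s)"
  unfolding side_point_opposite[symmetric] unfolding side_point_def by (simp add: algebra_simps)

lemma opposite_Suc: "i < 8 \<Longrightarrow> (opposite i + 1) mod 8 = (i + 5) mod 8"
  unfolding opposite_def by (erule less8_cases) simp_all

text \<open>Two cells through the point share an edge containing it by \<open>common_point\<close>.
  Both values are transferred to that edge; its two cells run along it in opposite directions,
  whence the parameter \<open>1 - q\<close>, and \<open>compat\<close> matches the ends.\<close>

lemma value_at_functional:
  assumes c: "compat m h" and "value_at m h x r" "value_at m h x r'"
  shows "r = r'"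
proof -
  obtain u i s where u: "u \<in> words m" "i < 8" "s \<in> {0..1}" "x = place u (side_point i s)" "r = side_value (h u) i s"
    using assms(2) unfolding value_at_def by blast
  obtain v k t where v: "v \<in> words m" "k < 8" "t \<in> {0..1}" "x = place v (side_point k t)" "r' = side_value (h v) k t"
    using assms(3) unfolding value_at_def by blast
  show ?thesis
  proof (cases "u = v")
    case True
    then have "side_point i s = side_point k t" using u v place_eq_iff by metis
    then show ?thesis using side_value_unique u v True by metis
  next
    case False
    have o: "side_point i s \<in> octagon" "side_point k t \<in> octagon" using side_point_in_side side_iff u v by blast+
    have x: "place u (side_point i s) = place v (side_point k t)" using u(4) v(4) by simp
    obtain j where j: "j < 8" "shared u j" "partner u j = v" "side_point k t = side_point i s - (V0 j + V0 (j + 1))"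
        "nf j (side_point i s) = kap" "nf (opposite j) (side_point k t) = kap"
      by (rule common_point[OF u(1) v(1) False x o])
    then have "side_point i s \<in> side j" using o by (simp add: side_iff)
    then obtain q where q: "q \<in> {0..1}" "side_point i s = side_point j q" using side_side_point by blast
    have "side_point k t = side_point (opposite j) (1 - q)" using j(4) unfolding q(2) side_point_flip .
    then have "r' = side_value (h v) (opposite j) (1 - q)"
      using side_value_unique[of k t "opposite j" "1 - q" "h v"] v q(1) opposite_less by simp
    also have "\<dots> = side_value (h u) j q"
      using compat_shared[OF c u(1) j(1,2)] unfolding side_value_def opposite_Suc[OF j(1)] j(3) unfolding opposite_def by simp
    also have "\<dots> = r" using side_value_unique[OF q(2) u(2) j(1) u(3) q(1)] u(5) by simp
    finally show ?thesis by simp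
  qed
qed

lemma value_at_antipodal:
  assumes c: "compat m h" and "antipodal m x y"
  shows "value_at m h x r \<longleftrightarrow> value_at m h y r"
proof -
  obtain u i t where u: "u \<in> words m" "i < 8" "\<not> shared u i" "t \<in> side i" "x = place u t" "y = place (partner u i) (- t)"
    by (rule antipodal_edge[OF assms(2)])
  obtain s where s: "s \<in> {0..1}" "t = side_point i s" using side_side_point[OF u(4)] by blast
  have x: "value_at m h x (side_value (h u) i s)" unfolding value_at_def using u s by blast
  have "value_at m h y (side_value (h (partner u i)) (opposite i) s)"
    unfolding value_at_def u(6) s(2) side_point_opposite using partner_words[OF u(1,2)] opposite_less s(1) by blast
  also have "side_value (h (partner u i)) (opposite i) s = side_value (h u) i s"
    using compat_not_shared[OF c u(1-3)] unfolding side_value_def opposite_Suc[OF u(2)] unfolding opposite_def by simp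
  finally have "value_at m h y (side_value (h u) i s)" .
  with x show ?thesis using value_at_functional[OF c] by metis
qed

lemma value_at_glue:
  assumes c: "compat m h" and "glue m x = glue m y"
  shows "value_at m h x r \<longleftrightarrow> value_at m h y r"
proof -
  have "y \<in> glue m y" by (simp add: glue_def)
  then have "y \<in> glue m x" using assms(2) by simp
  then have "equivclp (antipodal m) x y" by (simp add: glue_def)
  then show ?thesis
  proof (induction rule: equivclp_induct)
    case (step y z)
    then show ?case using value_at_antipodal[OF c] by blast
  qed simp
qed

section \<open>Adjacent cells, depth and the size of balls\<close>

lemma interior_place_image: "interior (place u ` S) = place u ` interior S"
proof -
  have b: "bij (place u)" using place_eq_iff place_surj by (metis bijI injI surjI surj_def)
  have "- place u ` X = place u ` (- X)" for X using bij_image_Compl_eq[OF b] by metis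
  then show ?thesis unfolding interior_closure using closure_place_image by metis
qed

text \<open>A face of dimension 1 is a proper face of a cell with interior points, so it misses the
  interior and each of its points lies on some side.\<close>

lemma edge_of_cell_of_point:
  assumes "e edge_of cell_of u"
  shows "e \<noteq> {}" "p \<in> e \<Longrightarrow> \<exists>i<8. \<exists>s\<in>{0..1}. p = place u (side_point i s)"
proof -
  have f: "e face_of cell_of u" "aff_dim e = 1" using assms by (auto simp: edge_of_def)
  show "e \<noteq> {}" using f(2) by auto
  have "0 \<in> interior octagon"
  proof (rule ccontr)
    assume "0 \<notin> interior octagon"
    moreover have "0 \<in> octagon" using kap_pos by (simp add: octagon_iff nf_0)
    ultimately obtain i where "0 \<in> side i" using octagon_not_interior by blast
    then show False using kap_pos by (simp add: side_iff nf_0)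
  qed
  then have int: "interior (cell_of u) \<noteq> {}" unfolding cell_of_def interior_place_image by blast
  have "e \<noteq> cell_of u"
  proof
    assume "e = cell_of u"
    then have "aff_dim (cell_of u) = 1" using f by simp
    then show False using aff_dim_nonempty_interior[OF int] by simp
  qed
  then have dis: "e \<inter> interior (cell_of u) = {}" using face_of_disjoint_interior[OF f(1)] by blast
  assume p: "p \<in> e"
  then have "p \<in> cell_of u" using face_of_imp_subset[OF f(1)] by blast
  then obtain x where x: "x \<in> octagon" "p = place u x" by (auto simp: cell_of_def)
  have "x \<notin> interior octagon" using dis p x(2) unfolding cell_of_def interior_place_image by blast
  then obtain i where "i < 8" "x \<in> side i" using octagon_not_interior x(1) by blast
  then show "\<exists>i<8. \<exists>s\<in>{0..1}. p = place u (side_point i s)" using side_side_point x(2) by blast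
qed

text \<open>Equal images of two edges under the gluing provide one glued pair of points, and a
  single such pair already forces a common value on the two boundaries.\<close>

lemma adjacent_common_value:
  assumes c: "compat m h" and "adjacent m (cell_of u) (cell_of v)" "u \<in> words m" "v \<in> words m"
  shows "\<exists>i<8. \<exists>s\<in>{0..1}. \<exists>j<8. \<exists>t\<in>{0..1}. side_value (h u) i s = side_value (h v) j t"
proof -
  obtain e e' where e: "e edge_of cell_of u" "e' edge_of cell_of v" "glue m ` e = glue m ` e'"
    using assms(2) unfolding adjacent_def by blast
  obtain p where p: "p \<in> e" using edge_of_cell_of_point(1)[OF e(1)] by blast
  then obtain q where q: "q \<in> e'" "glue m p = glue m q" using e(3) by blast
  obtain i s where i: "i < 8" "s \<in> {0..1}" "p = place u (side_point i s)" using edge_of_cell_of_point(2)[OF e(1) p] by blast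
  obtain j t where j: "j < 8" "t \<in> {0..1}" "q = place v (side_point j t)" using edge_of_cell_of_point(2)[OF e(2) q(1)] by blast
  have "value_at m h p (side_value (h u) i s)" unfolding value_at_def using assms(3) i by blast
  then have "value_at m h q (side_value (h u) i s)" using value_at_glue[OF c q(2)] by blast
  moreover have "value_at m h q (side_value (h v) j t)" unfolding value_at_def using assms(4) j by blast
  ultimately have "side_value (h u) i s = side_value (h v) j t" by (rule value_at_functional[OF c])
  with i j show ?thesis by blast
qed

text \<open>The choice of a word turns a function on words into one on cells, in which the graph is
  expressed; all later estimates use the chosen word.\<close>

definition depth :: "nat \<Rightarrow> (nat list \<Rightarrow> nat \<Rightarrow> int) \<Rightarrow> (real \<times> real) set \<Rightarrow> int" where
  "depth m h c = Min (h (SOME u. u \<in> words m \<and> cell_of u = c) ` {..<8})"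

lemma representative:
  assumes "c \<in> cells m"
  shows "(SOME u. u \<in> words m \<and> cell_of u = c) \<in> words m" "cell_of (SOME u. u \<in> words m \<and> cell_of u = c) = c"
proof -
  have "\<exists>u. u \<in> words m \<and> cell_of u = c" using assms unfolding cells_eq by blast
  from someI_ex[OF this] show "(SOME u. u \<in> words m \<and> cell_of u = c) \<in> words m" "cell_of (SOME u. u \<in> words m \<and> cell_of u = c) = c"
    by blast+
qed

lemma side_value_flat_bounds:
  fixes f :: "nat \<Rightarrow> int"
  assumes "\<And>i. i < 8 \<Longrightarrow> f i = q \<or> f i = q + 1" "i < 8" "s \<in> {0..1}"
  shows "real_of_int (Min (f ` {..<8})) \<le> side_value (\<lambda>i. real_of_int (f i)) i s"
    "side_value (\<lambda>i. real_of_int (f i)) i s \<le> real_of_int (Min (f ` {..<8})) + 1"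
proof -
  define z where "z = Min (f ` {..<8})"
  have i': "(i + 1) mod 8 < 8" by simp
  have b: "z \<le> f k" "f k \<le> z + 1" if "k < 8" for k
  proof -
    show "z \<le> f k" unfolding z_def by (rule Min_Max_corner(1)[OF that])
    obtain l where "l < 8" "f l = z" using Min_Max_corner(3)[OF assms(2), of f] unfolding z_def by blast
    then show "f k \<le> z + 1" using assms(1)[OF that] assms(1)[of l] by auto
  qed
  have "(1 - s) * real_of_int z + s * real_of_int z \<le> side_value (\<lambda>i. real_of_int (f i)) i s"
    unfolding side_value_def using b[OF assms(2)] b[OF i'] assms(3) by (intro add_mono mult_left_mono) auto
  moreover have "side_value (\<lambda>i. real_of_int (f i)) i s \<le> (1 - s) * real_of_int (z + 1) + s * real_of_int (z + 1)"
    unfolding side_value_def using b[OF assms(2)] b[OF i'] assms(3)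
    by (intro add_mono mult_left_mono) (simp_all only: of_int_le_iff, auto)
  ultimately show "real_of_int (Min (f ` {..<8})) \<le> side_value (\<lambda>i. real_of_int (f i)) i s"
    "side_value (\<lambda>i. real_of_int (f i)) i s \<le> real_of_int (Min (f ` {..<8})) + 1"
    unfolding z_def[symmetric] by (simp_all add: algebra_simps)
qed

text \<open>For a flat function all interpolated values on the boundary of a cell lie between the
  minimum and the minimum plus 1. Two such intervals containing a common value start at most 1
  apart.\<close>

lemma depth_adjacent:
  assumes "compat m h" "flat m h" "adjacent m c d"
  shows "\<bar>depth m h c - depth m h d\<bar> \<le> 1"
proof -
  have cd: "c \<in> cells m" "d \<in> cells m" using assms(3) by (auto simp: adjacent_def)
  define u where "u = (SOME u. u \<in> words m \<and> cell_of u = c)"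
  define v where "v = (SOME u. u \<in> words m \<and> cell_of u = d)"
  have u: "u \<in> words m" "cell_of u = c" and v: "v \<in> words m" "cell_of v = d"
    using representative[OF cd(1)] representative[OF cd(2)] by (simp_all add: u_def v_def)
  have "compat m (\<lambda>u i. real_of_int (h u i))" using assms(1) by (simp add: compat_def)
  then obtain i s j t where ij: "i < 8" "s \<in> {0..1}" "j < 8" "t \<in> {0..1}"
    "side_value (\<lambda>i. real_of_int (h u i)) i s = side_value (\<lambda>i. real_of_int (h v i)) j t"
    using adjacent_common_value[of m _ u v] assms(3) u v by blast
  obtain q where q: "\<And>i. i < 8 \<Longrightarrow> h u i = q \<or> h u i = q + 1" using assms(2) u(1) unfolding flat_def by blast
  obtain q' where q': "\<And>i. i < 8 \<Longrightarrow> h v i = q' \<or> h v i = q' + 1" using assms(2) v(1) unfolding flat_def by blast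
  note 1 = side_value_flat_bounds[of "h u" q, OF q ij(1,2)] and 2 = side_value_flat_bounds[of "h v" q', OF q' ij(3,4)]
  have "real_of_int (Min (h u ` {..<8})) \<le> real_of_int (Min (h v ` {..<8}) + 1)"
    "real_of_int (Min (h v ` {..<8})) \<le> real_of_int (Min (h u ` {..<8}) + 1)"
    using 1 2 ij(5) by simp_all
  then show ?thesis unfolding depth_def u_def[symmetric] v_def[symmetric] of_int_le_iff by linarith
qed

lemma depth_path:
  assumes "compat m h" "flat m h" "is_path m cs"
  shows "\<bar>depth m h (last cs) - depth m h (hd cs)\<bar> \<le> int (length cs - 1)"
proof -
  have "\<bar>depth m h (last cs) - depth m h (hd cs)\<bar> \<le> int (length cs - 1)"
    if "cs \<noteq> []" "successively (adjacent m) cs" for cs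
    using that
  proof (induction cs rule: induct_list012)
    case (3 x y zs)
    then have "\<bar>depth m h (last (y # zs)) - depth m h y\<bar> \<le> int (length zs)" by simp
    moreover have "\<bar>depth m h x - depth m h y\<bar> \<le> 1"
      using depth_adjacent[OF assms(1,2)] 3 by simp
    ultimately show ?case by simp
  qed simp_all
  then show ?thesis using assms(3) by (simp add: is_path_def)
qed

text \<open>The infimum over an empty set of paths would be infinite; over a nonempty set it is
  attained because \<open>enat\<close> is well-ordered.\<close>

lemma graph_ball_path:
  assumes "w \<in> graph_ball m v n"
  obtains cs where "is_path m cs" "hd cs = v" "last cs = w" "length cs - 1 \<le> n"
proof -
  let ?S = "{cs. is_path m cs \<and> hd cs = v \<and> last cs = w}"
  have le: "(INF cs\<in>?S. enat (length cs - 1)) \<le> enat n"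
    using assms by (simp add: graph_ball_def path_dist_def)
  have "?S \<noteq> {}"
  proof
    assume "?S = {}"
    then have "(INF cs\<in>?S. enat (length cs - 1)) = top" by (simp only: image_empty Inf_empty)
    then show False using le by (simp add: top_enat_def)
  qed
  then obtain cs0 where "cs0 \<in> ?S" by blast
  then have "enat (length cs0 - 1) \<in> (\<lambda>cs. enat (length cs - 1)) ` ?S" by blast
  then have "(INF cs\<in>?S. enat (length cs - 1)) \<in> (\<lambda>cs. enat (length cs - 1)) ` ?S"
    by (rule wellorder_InfI)
  then obtain cs where "cs \<in> ?S" "(INF cs\<in>?S. enat (length cs - 1)) = enat (length cs - 1)" by blast
  then show thesis using that[of cs] le by simp
qed

lemma card_words: "card (words m) = 8 ^ m"
proof -
  have "words m = {xs. set xs \<subseteq> {..<8} \<and> length xs = m}" by (auto simp: words_def)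
  then show ?thesis by (simp add: card_lists_length_eq)
qed

lemma ball_card_bound:
  assumes "v \<in> cells (k + l)" "n < 2 ^ k"
  shows "card (graph_ball (k + l) v n) \<le> 25 * 8 ^ k"
proof -
  define u where "u = (SOME u. u \<in> words (k + l) \<and> cell_of u = v)"
  have u: "u \<in> words (k + l)" "cell_of u = v" using representative[OF assms(1)] by (simp_all add: u_def)
  \<comment> \<open>Words start with the innermost letter, so dropping \<open>k\<close> entries
    leaves the ancestor of level \<open>l\<close>.\<close>
  define b where "b = drop k u"
  have split: "take k w \<in> words k \<and> drop k w \<in> words l" if "w \<in> words (k + l)" for w
    using that by (auto simp: words_def dest: in_set_takeD in_set_dropD)
  have b: "b \<in> words l" using split[OF u(1)] by (simp add: b_def)
  \<comment> \<open>The value depends on \<open>(w, i)\<close> only through its corner class, so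
    compatibility is inherited from \<open>corner_class\<close>.\<close>
  define h0 where "h0 = (\<lambda>w i. if \<exists>j<8. corner_class l w i = corner_class l b j then 0 else (1::int))"
  have "compat l h0" using compat_corner_class[of l] unfolding compat_def h0_def by (smt (verit))
  moreover have "flat l h0" unfolding flat_def h0_def by (intro ballI exI[of _ 0]) auto
  ultimately have cf: "compat (k + l) ((refine ^^ k) h0)" "flat (k + l) ((refine ^^ k) h0)"
    using iterate_refine by blast+
  define N where "N = {w \<in> words l. \<exists>i<8. \<exists>j<8. corner_class l w i = corner_class l b j}"
  have "N \<subseteq> insert b (\<Union>j<8. fst ` (corner_class l b j - {(b, j)}))"
  proof
    fix w assume "w \<in> N"
    then obtain i j where w: "w \<in> words l" "i < 8" "j < 8" "corner_class l w i = corner_class l b j" by (auto simp: N_def)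
    then have "(w, i) \<in> corner_class l b j" using corner_class_refl by metis
    then show "w \<in> insert b (\<Union>j<8. fst ` (corner_class l b j - {(b, j)}))" using w(3) by force
  qed
  then have "card N \<le> card (insert b (\<Union>j<8. fst ` (corner_class l b j - {(b, j)})))"
    using card_corner_class[OF b] by (intro card_mono) auto
  also have "\<dots> \<le> Suc (card (\<Union>j<8. fst ` (corner_class l b j - {(b, j)})))" by (rule card_insert_le_m1) auto
  also have "card (\<Union>j<8. fst ` (corner_class l b j - {(b, j)})) \<le> (\<Sum>j<(8::nat). card (fst ` (corner_class l b j - {(b, j)})))"
    by (rule card_UN_le) simp
  also have "\<dots> \<le> (\<Sum>j<(8::nat). 3)"
  proof (rule sum_mono)
    fix j assume "j \<in> {..<8::nat}"
    then have "card (corner_class l b j - {(b, j)}) = card (corner_class l b j) - 1"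
      using corner_class_refl[OF b] by (intro card_Diff_singleton) auto
    then show "card (fst ` (corner_class l b j - {(b, j)})) \<le> 3"
      using card_corner_class[OF b, of j] card_image_le[of "corner_class l b j - {(b, j)}" fst] by fastforce
  qed
  finally have N: "card N \<le> 25" by simp
  have finN: "finite N" unfolding N_def using finite_words by simp
  have "graph_ball (k + l) v n \<subseteq> cell_of ` (\<lambda>(x, y). x @ y) ` (words k \<times> N)"
  proof
    fix c assume c: "c \<in> graph_ball (k + l) v n"
    then have cc: "c \<in> cells (k + l)" by (simp add: graph_ball_def)
    define w where "w = (SOME u. u \<in> words (k + l) \<and> cell_of u = c)"
    have w: "w \<in> words (k + l)" "cell_of w = c" using representative[OF cc] by (simp_all add: w_def)
    obtain cs where cs: "is_path (k + l) cs" "hd cs = v" "last cs = c" "length cs - 1 \<le> n"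
      using graph_ball_path[OF c] by blast
    have "\<bar>depth (k + l) ((refine ^^ k) h0) c - depth (k + l) ((refine ^^ k) h0) v\<bar> \<le> int n"
      using depth_path[OF cf cs(1)] cs(2-4) by simp
    moreover have "depth (k + l) ((refine ^^ k) h0) v = 0"
    proof -
      have "\<forall>i<8. h0 b i = 0" by (auto simp: h0_def)
      then have "(refine ^^ k) h0 (take k u @ b) i = 0" if "i < 8" for i
        using iterate_refine_0 split[OF u(1)] that by blast
      then have "(refine ^^ k) h0 u i = 0" if "i < 8" for i
        using that unfolding b_def append_take_drop_id by blast
      then show ?thesis
        unfolding depth_def u_def[symmetric] using Min_Max_corner(3)[of 0 "(refine ^^ k) h0 u"] by force
    qed
    moreover have "int n < 2 ^ k"
      using of_nat_less_iff[of n "2 ^ k", where 'a = int] assms(2) by simp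
    ultimately have d: "depth (k + l) ((refine ^^ k) h0) c < 2 ^ k" by linarith
    have "drop k w \<in> N"
    proof (rule ccontr)
      assume "drop k w \<notin> N"
      then have "\<forall>i<8. h0 (drop k w) i \<ge> 1" using split[OF w(1)] by (auto simp: h0_def N_def)
      then have ge: "(refine ^^ k) h0 w i \<ge> 2 ^ k" if "i < 8" for i
        using iterate_refine_ge[where h = h0 and v = "drop k w" and c = 1 and x = "take k w" and k = k and i = i] that split[OF w(1)] by simp
      obtain i where "i < 8" "(refine ^^ k) h0 w i = depth (k + l) ((refine ^^ k) h0) c"
        unfolding depth_def w_def[symmetric] using Min_Max_corner(3)[of 0 "(refine ^^ k) h0 w"] by auto
      then show False using ge d by fastforce
    qed
    then have "w \<in> (\<lambda>(x, y). x @ y) ` (words k \<times> N)"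
      using split[OF w(1)] by (intro image_eqI[of _ _ "(take k w, drop k w)"]) auto
    then show "c \<in> cell_of ` (\<lambda>(x, y). x @ y) ` (words k \<times> N)" using w(2) by blast
  qed
  then have "card (graph_ball (k + l) v n) \<le> card (cell_of ` (\<lambda>(x, y). x @ y) ` (words k \<times> N))"
    using finN finite_words by (intro card_mono) auto
  also have "\<dots> \<le> card (words k \<times> N)"
    using finN finite_words by (metis card_image_le finite_SigmaI finite_imageI le_trans)
  also have "\<dots> \<le> 8 ^ k * 25" using N by (simp add: card_cartesian_product card_words)
  finally show ?thesis by simp
qed

theorem proposition9p15:
  fixes m n :: nat and v :: "(real \<times> real) set"
  assumes "m \<ge> 1" and "v \<in> cells m" and "0 < n" and "n < 2 ^ (m - 1)"
  shows "card (graph_ball m v n) \<le> 200 * n ^ 3"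
proof -
  \<comment> \<open>Minimality gives \<open>2 ^ (k - 1) \<le> n\<close>, where \<open>k > 0\<close>
    because \<open>n > 0\<close>; the bound \<open>n < 2 ^ (m - 1)\<close> leaves room for a block
    level \<open>l\<close> with \<open>m = k + l\<close>.\<close>
  define k where "k = (LEAST k. n < 2 ^ k)"
  have k: "n < 2 ^ k" unfolding k_def by (rule LeastI[of "\<lambda>k. n < 2 ^ k", OF assms(4)])
  have "k \<le> m - 1" unfolding k_def by (rule Least_le[of "\<lambda>k. n < 2 ^ k", OF assms(4)])
  then obtain l where m: "m = k + l" using assms(1) by (metis le_add_diff_inverse diff_le_self le_trans)
  have "k \<noteq> 0" using k assms(3) by (cases k) auto
  then obtain k' where k': "k = Suc k'" by (cases k) auto
  have "\<not> n < 2 ^ k'" using not_less_Least[of k' "\<lambda>k. n < 2 ^ k"] k' unfolding k_def by simp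
  then have "(2 ^ k') ^ 3 \<le> n ^ 3" by (intro power_mono) auto
  moreover have "(2::nat) ^ k' ^ 1 = 2 ^ k'" by simp
  moreover have "(8::nat) ^ k = 8 * (2 ^ k') ^ 3"
    by (simp add: k' power_mult[symmetric] mult.commute[of k'] power_mult[of 2 3 k', simplified])
  ultimately have "25 * 8 ^ k \<le> 200 * n ^ 3" by simp
  then show ?thesis using ball_card_bound[of v k l n] assms(2) k unfolding m by linarith
qed

end
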